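(* Let $\mathcal{G}=(V,E)$ be a graph with boundary $V_b=\{v_1,\dots,v_k\}$, $k\ge 2$, such that every interior vertex is connected by an edge to every boundary vertex. Fix distinct boundary values $z_{v_1},\dots,z_{v_k}\in\mathbb{C}$. For generic $q:E\to\mathbb{R}$ satisfying $\sum_{v\sim u}q_{uv}=0$ at every interior vertex $u$, let $N(\mathcal{G})$ be the number of distinct solutions $z:V\to\mathbb{C}$, with the prescribed boundary values, of $$\sum_{v\sim u}\frac{q_{uv}}{z_u-z_v}=0\qquad\text{for every interior vertex }u.$$ Define $N(\mathcal{G}-e)$ and $N(\mathcal{G}/e)$ in the same way, for the same boundary vertices and boundary values and for generic $q$ on the respective graphs. Then for every edge $e$ connecting two interior vertices of $\mathcal{G}$, $$N(\mathcal{G})=N(\mathcal{G}-e)+N(\mathcal{G}/e).$$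
   Context: Graphs are finite and simple (no self-loops, no multiple edges). A graph with boundary is a graph $\mathcal{G}=(V,E)$ with a specified set $V_b\subset V$ of boundary vertices; $V_{int}=V\setminus V_b$ is the set of interior vertices, and every edge has at least one interior endpoint. Functions $q$ are defined on unoriented edges, so $q_{uv}=q_{vu}$. A solution $z$ is required to satisfy $z_u\neq z_v$ for adjacent $u,v$, so that the equations make sense. $\mathcal{G}-e$ is $\mathcal{G}$ with the edge $e$ deleted; $\mathcal{G}/e$ is $\mathcal{G}$ with $e$ contracted (the two endpoints of $e$ are identified and $e$ is removed). Any multiple edges created by contraction are replaced by single edges, the $q$-value of the new edge being the sum of the $q$-values of the multiple edges (this does not affect the equations). Generic: a statement holds for generic $q$ if it holds for all $q$ in a nonempty Zariski open subset of the vector space of functions $q:E\to\mathbb{R}$ satisfying $\sum_{v\sim u}q_{uv}=0$ at all interior vertices $u$ (i.e. the $q$ are algebraically independent modulo these linear relations); the open set may depend on the graph and the fixed boundary values. *)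

theory Defs
  imports Complex_Main "HOL-Library.FuncSet"
begin

definition graph_with_boundary :: "'a set \<Rightarrow> 'a set set \<Rightarrow> 'a set \<Rightarrow> bool" where
  "graph_with_boundary V E B \<longleftrightarrow>
     finite V \<and> B \<subseteq> V \<and>
     (\<forall>e\<in>E. e \<subseteq> V \<and> card e = 2) \<and>
     (\<forall>e\<in>E. \<exists>u\<in>e. u \<notin> B)"

definition nbrs :: "'a set set \<Rightarrow> 'a \<Rightarrow> 'a set" where
  "nbrs E u = {v. {u, v} \<in> E}"

definition delete_edge :: "'a set set \<Rightarrow> 'a set \<Rightarrow> 'a set set" where
  "delete_edge E e = E - {e}"

text \<open>Contraction of the edge \<open>{u, v}\<close>: the identified vertex keeps the name \<open>u\<close>, and the
  name \<open>v\<close> disappears. Since edges form a set, parallel edges created by the contraction are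
  merged.\<close>

definition contract_vertices :: "'a set \<Rightarrow> 'a \<Rightarrow> 'a \<Rightarrow> 'a set" where
  "contract_vertices V u v = id(v := u) ` V"

definition contract_edges :: "'a set set \<Rightarrow> 'a \<Rightarrow> 'a \<Rightarrow> 'a set set" where
  "contract_edges E u v = (\<lambda>e. id(v := u) ` e) ` (E - {{u, v}})"

text \<open>A function \<open>E \<rightarrow> \<real>\<close> is represented by its extension by \<open>0\<close> to all sets of vertices.\<close>

definition balanced_weights :: "'a set \<Rightarrow> 'a set set \<Rightarrow> 'a set \<Rightarrow> ('a set \<Rightarrow> real) set" where
  "balanced_weights V E B =
     {q. (\<forall>e. e \<notin> E \<longrightarrow> q e = 0) \<and> (\<forall>u\<in>V - B. (\<Sum>v\<in>nbrs E u. q {u, v}) = 0)}"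

inductive_set polynomial_functions :: "'i set \<Rightarrow> (('i \<Rightarrow> real) \<Rightarrow> real) set" for I :: "'i set" where
  const: "(\<lambda>q. c) \<in> polynomial_functions I"
| coord: "i \<in> I \<Longrightarrow> (\<lambda>q. q i) \<in> polynomial_functions I"
| add: "f \<in> polynomial_functions I \<Longrightarrow> g \<in> polynomial_functions I \<Longrightarrow>
    (\<lambda>q. f q + g q) \<in> polynomial_functions I"
| mult: "f \<in> polynomial_functions I \<Longrightarrow> g \<in> polynomial_functions I \<Longrightarrow>
    (\<lambda>q. f q * g q) \<in> polynomial_functions I"

definition zariski_open_in :: "'i set \<Rightarrow> ('i \<Rightarrow> real) set \<Rightarrow> ('i \<Rightarrow> real) set \<Rightarrow> bool" where
  "zariski_open_in I X U \<longleftrightarrow>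
     (\<exists>F \<subseteq> polynomial_functions I. U = X - {q \<in> X. \<forall>f\<in>F. f q = 0})"

definition generically :: "'i set \<Rightarrow> ('i \<Rightarrow> real) set \<Rightarrow> (('i \<Rightarrow> real) \<Rightarrow> bool) \<Rightarrow> bool" where
  "generically I X P \<longleftrightarrow> (\<exists>U. zariski_open_in I X U \<and> U \<noteq> {} \<and> (\<forall>q\<in>U. P q))"

text \<open>Solutions are extensional functions on \<open>V\<close>, so that distinct elements of this set are
  distinct functions \<open>V \<rightarrow> \<complex>\<close>.\<close>

definition solutions ::
  "'a set \<Rightarrow> 'a set set \<Rightarrow> 'a set \<Rightarrow> ('a \<Rightarrow> complex) \<Rightarrow> ('a set \<Rightarrow> real) \<Rightarrow> ('a \<Rightarrow> complex) set" where
  "solutions V E B b q =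
     {z \<in> extensional V.
        (\<forall>v\<in>B. z v = b v) \<and>
        (\<forall>u v. {u, v} \<in> E \<longrightarrow> z u \<noteq> z v) \<and>
        (\<forall>u\<in>V - B. (\<Sum>v\<in>nbrs E u. complex_of_real (q {u, v}) / (z u - z v)) = 0)}"

definition generic_number ::
  "'a set \<Rightarrow> 'a set set \<Rightarrow> 'a set \<Rightarrow> ('a \<Rightarrow> complex) \<Rightarrow> nat \<Rightarrow> bool" where
  "generic_number V E B b n \<longleftrightarrow>
     generically E (balanced_weights V E B)
       (\<lambda>q. finite (solutions V E B b q) \<and> card (solutions V E B b q) = n)"

text \<open>The following number is meaningful only if exactly one \<open>n\<close> satisfies
  \<open>generic_number V E B b n\<close>.\<close>

definition num_solutions ::
  "'a set \<Rightarrow> 'a set set \<Rightarrow> 'a set \<Rightarrow> ('a \<Rightarrow> complex) \<Rightarrow> nat" where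
  "num_solutions V E B b = (THE n. generic_number V E B b n)"

end

theory Submission
  imports Defs "HOL-Analysis.Analysis"
begin

text \<open>The idea is to put \<open>\<G>\<close>, \<open>\<G> - e\<close> and \<open>\<G>/e\<close> into one family: the solutions of the latter two are
  the limits of the solutions of \<open>\<G>\<close> as the weight \<open>q\<^sub>e\<close> tends to \<open>0\<close>.

  Move a boundary vertex \<open>o\<close> to infinity by \<open>w = 1 / (z - z\<^sub>o)\<close>. The equations keep their form, the edges
  at \<open>o\<close> disappear from them, and the balance condition only determines the weights of these edges, so
  the weights of the other edges become independent parameters. Introduce the flow
  \<open>p\<^sub>x\<^sub>y = q\<^sub>x\<^sub>y / (w\<^sub>x - w\<^sub>y)\<close>. A solution is then a pair of a potential \<open>w\<close> and a flow \<open>p\<close> with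
    \<^item> \<open>p\<close> conserved at interior vertices, a linear condition,
    \<^item> \<open>p\<^sub>e (w\<^sub>x - w\<^sub>y) = q\<^sub>e\<close> for every edge \<open>e = {x, y}\<close>, and \<open>w\<^sub>x \<noteq> w\<^sub>y\<close>.

  Since each interior vertex has an edge to a remaining boundary vertex, the pairs with conserved \<open>p\<close>
  form an affine space of dimension \<open>|E|\<close>, and \<open>(w, p) \<mapsto> q\<close> is a polynomial map of it to the space of
  weights, which has the same dimension. The solutions for \<open>q\<close> are the points of a fibre of this map,
  restricted to \<open>w\<^sub>x \<noteq> w\<^sub>y\<close> on edges.

  Three facts give a well-defined generic number.
    \<^item> Generic smoothness (\<open>generically_unramified\<close>): over generic \<open>q\<close> the derivative is injective. This
      rests on algebraic dependence, which is obtained by counting monomials.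
    \<^item> Properness (\<open>fibre_limit\<close>): if no nonempty set of edges has total weight \<open>0\<close>, solutions neither
      escape to infinity nor approach \<open>w\<^sub>x = w\<^sub>y\<close> on an edge. If a cluster of vertices did so, summing
      the equations over the cluster would leave in the limit a vanishing sum of weights.
    \<^item> Hence the number of solutions is locally constant on a set of \<open>q\<close> that contains the complement of a
      complex hypersurface (\<open>fibre_locally_constant\<close>). Such a complement is connected along complex lines,
      and so the number is constant there (\<open>generic_count_exists\<close>).

  Properness and local constancy survive at points with \<open>q\<^sub>e = 0\<close> for one interior edge \<open>e = {u, v}\<close>,
  if \<open>w\<^sub>u = w\<^sub>v\<close> is allowed. Over such a point, \<open>p\<^sub>e (w\<^sub>u - w\<^sub>v) = 0\<close> splits the fibre into the part
  \<open>p\<^sub>e = 0\<close>, which is the fibre of \<open>\<G> - e\<close>, and the part \<open>w\<^sub>u = w\<^sub>v\<close>, which is the fibre of \<open>\<G>/e\<close>.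
  Both parts are rigid for generic weights of the other edges, and nearby points with \<open>q\<^sub>e \<noteq> 0\<close> have the
  same number of preimages (\<open>generic_count_deletion_contraction\<close>).

  Contraction creates parallel edges. All counts are therefore done for multigraphs, and
  \<open>generic_number_of_count\<close> merges parallel edges when it returns to simple graphs and real weights.\<close>

section \<open>Polynomial functions and algebraic dependence\<close>

text \<open>Gaussian elimination: eliminating one unknown reduces the system by one equation.\<close>

lemma nontrivial_kernel:
  fixes M :: "'i \<Rightarrow> 'j \<Rightarrow> 'c::field"
  assumes "finite B" "finite A" "card B < card A"
  shows "\<exists>c. (\<exists>i\<in>A. c i \<noteq> 0) \<and> (\<forall>j\<in>B. (\<Sum>i\<in>A. c i * M i j) = 0)"
  using assms
proof (induction B arbitrary: A M rule: finite_induct)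
  case empty
  then have "A \<noteq> {}" by auto
  then show ?case by (intro exI[of _ "\<lambda>_. 1"]) auto
next
  case (insert j B)
  show ?case
  proof (cases "\<forall>i\<in>A. M i j = 0")
    case True
    have "card B < card A" using insert by auto
    from insert.IH[OF insert.prems(1) this, of M]
    obtain c where c: "\<exists>i\<in>A. c i \<noteq> 0" "\<forall>j\<in>B. (\<Sum>i\<in>A. c i * M i j) = 0" by blast
    have "(\<Sum>i\<in>A. c i * M i j) = 0" using True by simp
    with c show ?thesis by (intro exI[of _ c]) auto
  next
    case False
    then obtain i0 where i0: "i0 \<in> A" "M i0 j \<noteq> 0" by auto
    let ?A = "A - {i0}"
    define N where "N = (\<lambda>i l. M i l - M i j / M i0 j * M i0 l)"
    have "card B < card ?A" "finite ?A" using insert i0 by auto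
    then obtain c where c: "\<exists>i\<in>?A. c i \<noteq> 0" "\<forall>l\<in>B. (\<Sum>i\<in>?A. c i * N i l) = 0"
      using insert.IH[of ?A N] by blast
    define S where "S = (\<Sum>i\<in>?A. c i * M i j)"
    define d where "d = c(i0 := - S / M i0 j)"
    have d_sum: "(\<Sum>i\<in>A. d i * M i l) = (\<Sum>i\<in>?A. c i * M i l) - S / M i0 j * M i0 l" for l
    proof -
      have "(\<Sum>i\<in>A. d i * M i l) = d i0 * M i0 l + (\<Sum>i\<in>?A. d i * M i l)"
        using sum.remove[OF insert.prems(1) i0(1)] .
      also have "(\<Sum>i\<in>?A. d i * M i l) = (\<Sum>i\<in>?A. c i * M i l)"
        by (rule sum.cong) (auto simp: d_def)
      finally show ?thesis by (simp add: d_def)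
    qed
    have N_sum: "(\<Sum>i\<in>?A. c i * N i l) = (\<Sum>i\<in>?A. c i * M i l) - S / M i0 j * M i0 l" for l
      by (simp add: N_def S_def right_diff_distrib sum_subtractf sum_distrib_right sum_divide_distrib
          mult.assoc)
    have "(\<Sum>i\<in>A. d i * M i l) = 0" if "l \<in> insert j B" for l
    proof (cases "l = j")
      case True then show ?thesis using i0 by (simp add: d_sum S_def[symmetric])
    next
      case False then show ?thesis using that c(2) N_sum by (simp add: d_sum)
    qed
    moreover have "\<exists>i\<in>A. d i \<noteq> 0"
      using c(1) by (auto simp: d_def)
    ultimately show ?thesis by (intro exI[of _ d]) blast
  qed
qed

text \<open>The counterpart of \<open>polynomial_functions\<close> over an arbitrary field. The argument takes
  place over the complex numbers, where complements of hypersurfaces are connected.\<close>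

inductive_set polyfuns :: "'i set \<Rightarrow> (('i \<Rightarrow> 'c) \<Rightarrow> 'c::field) set" for I :: "'i set" where
  const: "(\<lambda>x. c) \<in> polyfuns I"
| coord: "i \<in> I \<Longrightarrow> (\<lambda>x. x i) \<in> polyfuns I"
| add: "f \<in> polyfuns I \<Longrightarrow> g \<in> polyfuns I \<Longrightarrow> (\<lambda>x. f x + g x) \<in> polyfuns I"
| mult: "f \<in> polyfuns I \<Longrightarrow> g \<in> polyfuns I \<Longrightarrow> (\<lambda>x. f x * g x) \<in> polyfuns I"

lemma polynomial_functions_eq: "polynomial_functions I = polyfuns I"
proof (intro set_eqI iffI)
  fix f assume "f \<in> polynomial_functions I"
  then show "f \<in> polyfuns I" by induction (auto intro: polyfuns.intros)
next
  fix f :: "('a \<Rightarrow> real) \<Rightarrow> real" assume "f \<in> polyfuns I"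
  then show "f \<in> polynomial_functions I" by induction (auto intro: polynomial_functions.intros)
qed

lemma polyfuns_mono: "f \<in> polyfuns I \<Longrightarrow> I \<subseteq> J \<Longrightarrow> f \<in> polyfuns J"
  by (induction rule: polyfuns.induct) (auto intro: polyfuns.intros)

lemma polyfuns_cong: "f \<in> polyfuns I \<Longrightarrow> (\<And>i. i \<in> I \<Longrightarrow> x i = y i) \<Longrightarrow> f x = f y"
  by (induction rule: polyfuns.induct) auto

lemma polyfuns_uminus: "f \<in> polyfuns I \<Longrightarrow> (\<lambda>x. - f x) \<in> polyfuns I"
  using polyfuns.mult[OF polyfuns.const[of "-1"]] by simp

lemma polyfuns_diff: "f \<in> polyfuns I \<Longrightarrow> g \<in> polyfuns I \<Longrightarrow> (\<lambda>x. f x - g x) \<in> polyfuns I"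
  using polyfuns.add[OF _ polyfuns_uminus] by simp

lemma polyfuns_sum: "(\<And>a. a \<in> A \<Longrightarrow> f a \<in> polyfuns I) \<Longrightarrow> (\<lambda>x. \<Sum>a\<in>A. f a x) \<in> polyfuns I"
  by (induction A rule: infinite_finite_induct) (auto intro: polyfuns.intros)

lemma polyfuns_prod: "(\<And>a. a \<in> A \<Longrightarrow> f a \<in> polyfuns I) \<Longrightarrow> (\<lambda>x. \<Prod>a\<in>A. f a x) \<in> polyfuns I"
  by (induction A rule: infinite_finite_induct) (auto intro: polyfuns.intros)

lemma polyfuns_power: "f \<in> polyfuns I \<Longrightarrow> (\<lambda>x. f x ^ n) \<in> polyfuns I"
  by (induction n) (auto intro: polyfuns.intros)

lemmas polyfuns_intros = polyfuns.intros polyfuns_uminus polyfuns_diff polyfuns_sum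
  polyfuns_prod polyfuns_power

lemma polyfuns_compose:
  assumes "f \<in> polyfuns J" "\<And>j. j \<in> J \<Longrightarrow> g j \<in> polyfuns I"
  shows "(\<lambda>x. f (\<lambda>j. g j x)) \<in> polyfuns I"
  using assms by (induction rule: polyfuns.induct) (auto intro: polyfuns.intros)

text \<open>Restriction to a line turns questions about zeros of polynomial functions of many variables into
  the finiteness of the zero set of a polynomial in one variable.\<close>

lemma polyfuns_on_line:
  assumes "f \<in> polyfuns I"
  shows "\<exists>p. \<forall>t. f (\<lambda>i. x i + t * y i) = poly p t"
  using assms
proof induction
  case (const c)
  then show ?case by (intro exI[of _ "[:c:]"]) simp
next
  case (coord i)
  then show ?case by (intro exI[of _ "[:x i, y i:]"]) simp
next
  case (add f g)
  then obtain p q where "\<forall>t. f (\<lambda>i. x i + t * y i) = poly p t" "\<forall>t. g (\<lambda>i. x i + t * y i) = poly q t"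
    by blast
  then show ?case by (intro exI[of _ "p + q"]) simp
next
  case (mult f g)
  then obtain p q where "\<forall>t. f (\<lambda>i. x i + t * y i) = poly p t" "\<forall>t. g (\<lambda>i. x i + t * y i) = poly q t"
    by blast
  then show ?case by (intro exI[of _ "p * q"]) simp
qed

lemma polyfuns_line_zeros_finite:
  assumes "f \<in> polyfuns I" "f (\<lambda>i. x i + t0 * y i) \<noteq> 0"
  shows "finite {t. f (\<lambda>i. x i + t * y i) = 0}"
proof -
  obtain p where p: "\<forall>t. f (\<lambda>i. x i + t * y i) = poly p t"
    using polyfuns_on_line[OF assms(1)] by blast
  with assms(2) have "p \<noteq> 0" by auto
  then show ?thesis using poly_roots_finite p by simp
qed

lemma polyfuns_segment_zeros_finite:
  fixes f :: "('i \<Rightarrow> 'c::field) \<Rightarrow> 'c"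
  assumes "f \<in> polyfuns I" "f x \<noteq> 0 \<or> f y \<noteq> 0"
  shows "finite {t. f (\<lambda>i. x i + t * (y i - x i)) = 0}"
proof -
  have "f (\<lambda>i. x i + 0 * (y i - x i)) \<noteq> 0 \<or> f (\<lambda>i. x i + 1 * (y i - x i)) \<noteq> 0"
    using assms(2) by simp
  then show ?thesis using polyfuns_line_zeros_finite[OF assms(1), of x _ "\<lambda>i. y i - x i"] by blast
qed

text \<open>Irreducibility of affine space: finitely many nonempty Zariski open sets meet. A line through a
  point of the intersection so far and a point of the next set contains only finitely many bad points.\<close>

lemma polyfuns_common_nonzero:
  fixes f :: "'k \<Rightarrow> ('i \<Rightarrow> 'c::field_char_0) \<Rightarrow> 'c"
  assumes "finite K" "\<And>k. k \<in> K \<Longrightarrow> f k \<in> polyfuns I" "\<And>k. k \<in> K \<Longrightarrow> \<exists>x. f k x \<noteq> 0"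
  shows "\<exists>x. \<forall>k\<in>K. f k x \<noteq> 0"
  using assms
proof (induction K rule: finite_induct)
  case (insert k K)
  then obtain x where x: "\<forall>k\<in>K. f k x \<noteq> 0" by auto
  obtain y where y: "f k y \<noteq> 0" using insert.prems by auto
  let ?l = "\<lambda>t i. x i + t * (y i - x i)"
  have "finite (\<Union>j\<in>insert k K. {t. f j (?l t) = 0})"
    using insert.hyps insert.prems x y
    by (intro finite_UN_I polyfuns_segment_zeros_finite) auto
  then obtain t where "t \<notin> (\<Union>j\<in>insert k K. {t. f j (?l t) = 0})"
    using ex_new_if_finite[OF infinite_UNIV_char_0] by blast
  then show ?case by (intro exI[of _ "?l t"]) auto
qed auto

lemma polyfuns_mult_nonzero:
  fixes f :: "('i \<Rightarrow> 'c::field_char_0) \<Rightarrow> 'c"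
  assumes "f \<in> polyfuns I" "g \<in> polyfuns I" "f x \<noteq> 0" "g y \<noteq> 0"
  shows "\<exists>z. f z \<noteq> 0 \<and> g z \<noteq> 0"
proof -
  have "\<exists>z. \<forall>h\<in>{f, g}. h z \<noteq> 0"
    using assms by (intro polyfuns_common_nonzero[where I=I]) auto
  then show ?thesis by auto
qed

text \<open>Real points are Zariski dense. The point \<open>x\<close> lies at parameter \<open>\<i>\<close> on the line through
  \<open>Re x\<close> with direction \<open>Im x\<close>, whose points with real parameter are real.\<close>

lemma polyfuns_real_nonzero:
  fixes f :: "('i \<Rightarrow> complex) \<Rightarrow> complex"
  assumes "f \<in> polyfuns I" "f x \<noteq> 0"
  shows "\<exists>r :: 'i \<Rightarrow> real. f (\<lambda>i. of_real (r i)) \<noteq> 0"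
proof -
  let ?l = "\<lambda>t i. of_real (Re (x i)) + t * of_real (Im (x i)) :: complex"
  have "x = ?l \<i>" using complex_eq by blast
  then have "f (?l \<i>) \<noteq> 0" using assms(2) by simp
  then have "finite {t. f (?l t) = 0}"
    by (rule polyfuns_line_zeros_finite[OF assms(1)])
  moreover have "infinite (range complex_of_real)"
    using finite_imageD[of complex_of_real UNIV] infinite_UNIV_char_0[where 'a=real]
    by (auto simp: inj_def)
  ultimately have "\<not> range complex_of_real \<subseteq> {t. f (?l t) = 0}"
    using finite_subset by blast
  then obtain t where "complex_of_real t \<notin> {t. f (?l t) = 0}" by blast
  then show ?thesis
    by (intro exI[of _ "\<lambda>i. Re (x i) + t * Im (x i)"]) simp
qed

lemma polyfuns_nonzero_nearby:
  fixes f :: "('i \<Rightarrow> complex) \<Rightarrow> complex"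
  assumes f: "f \<in> polyfuns I" "f y \<noteq> 0" and "finite I" "\<epsilon> > 0"
  shows "\<exists>z. f z \<noteq> 0 \<and> (\<forall>i\<in>I. norm (z i - x i) < \<epsilon>)"
proof -
  define C where "C = (\<Sum>i\<in>I. norm (y i - x i)) + 1"
  have C: "norm (y i - x i) < C" if "i \<in> I" for i
    using member_le_sum[of i I "\<lambda>i. norm (y i - x i)"] that \<open>finite I\<close> unfolding C_def by simp
  have "C > 0" unfolding C_def by (simp add: add_nonneg_pos sum_nonneg)
  have "finite {t. f (\<lambda>i. x i + t * (y i - x i)) = 0}"
    using polyfuns_segment_zeros_finite f by blast
  moreover have "infinite (ball (0::complex) (\<epsilon> / C))"
    using \<open>C > 0\<close> \<open>\<epsilon> > 0\<close> by (simp add: uncountable_ball uncountable_infinite)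
  ultimately have "\<not> ball 0 (\<epsilon> / C) \<subseteq> {t. f (\<lambda>i. x i + t * (y i - x i)) = 0}"
    using finite_subset by blast
  then obtain t where "t \<in> ball 0 (\<epsilon> / C)" and nz: "f (\<lambda>i. x i + t * (y i - x i)) \<noteq> 0"
    by blast
  then have t: "norm t < \<epsilon> / C" by simp
  have "norm (t * (y i - x i)) < \<epsilon>" if "i \<in> I" for i
  proof -
    have "norm (t * (y i - x i)) \<le> norm t * C"
      using C[OF that] by (simp add: norm_mult mult_left_mono)
    also have "\<dots> < \<epsilon>" using t \<open>C > 0\<close> by (simp add: pos_less_divide_eq)
    finally show ?thesis .
  qed
  with nz show ?thesis by (intro exI[of _ "\<lambda>i. x i + t * (y i - x i)"]) auto
qed

text \<open>Exponent vectors bounded by \<open>K\<close> in each variable separately. This box shape makes it easy to count the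
  monomials and to split off one variable.\<close>

definition monomials :: "'i set \<Rightarrow> nat \<Rightarrow> ('i \<Rightarrow> nat) set" where
  "monomials I K = (I \<rightarrow>\<^sub>E {..K})"

lemma finite_monomials: "finite I \<Longrightarrow> finite (monomials I K)"
  by (simp add: monomials_def finite_PiE)

lemma monomials_unique:
  fixes c :: "('i \<Rightarrow> nat) \<Rightarrow> complex"
  assumes "finite I" "\<forall>x. (\<Sum>\<alpha>\<in>monomials I K. c \<alpha> * (\<Prod>i\<in>I. x i ^ \<alpha> i)) = 0" "\<alpha> \<in> monomials I K"
  shows "c \<alpha> = 0"
  using assms
proof (induction I arbitrary: c \<alpha> rule: finite_induct)
  case empty
  then show ?case by (simp add: monomials_def)
next
  case (insert j I)
  define C where "C = (\<lambda>x k. \<Sum>\<alpha>\<in>monomials I K. c (\<alpha>(j := k)) * (\<Prod>i\<in>I. x i ^ \<alpha> i))"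
  have inj: "inj_on (\<lambda>(k, \<alpha>). \<alpha>(j := k)) ({..K} \<times> monomials I K)"
    using inj_combinator[OF insert.hyps(2)] by (simp add: monomials_def)
  have split: "(\<Sum>\<alpha>\<in>monomials (insert j I) K. c \<alpha> * (\<Prod>i\<in>insert j I. x i ^ \<alpha> i))
      = (\<Sum>k\<le>K. C x k * x j ^ k)" for x
  proof -
    have "(\<Sum>\<alpha>\<in>monomials (insert j I) K. c \<alpha> * (\<Prod>i\<in>insert j I. x i ^ \<alpha> i))
      = (\<Sum>(k, \<alpha>)\<in>{..K} \<times> monomials I K. c (\<alpha>(j := k)) * (\<Prod>i\<in>insert j I. x i ^ (\<alpha>(j := k)) i))"
      using sum.reindex[OF inj, of "\<lambda>\<alpha>. c \<alpha> * (\<Prod>i\<in>insert j I. x i ^ \<alpha> i)"]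
      by (simp add: monomials_def PiE_insert_eq case_prod_unfold)
    also have "\<dots> = (\<Sum>k\<le>K. \<Sum>\<alpha>\<in>monomials I K.
        c (\<alpha>(j := k)) * (\<Prod>i\<in>insert j I. x i ^ (\<alpha>(j := k)) i))"
      by (simp add: sum.cartesian_product)
    also have "\<dots> = (\<Sum>k\<le>K. C x k * x j ^ k)"
    proof (rule sum.cong[OF refl])
      fix k
      have "(\<Prod>i\<in>insert j I. x i ^ (\<alpha>(j := k)) i) = x j ^ k * (\<Prod>i\<in>I. x i ^ \<alpha> i)" for \<alpha>
      proof -
        have "(\<Prod>i\<in>I. x i ^ (\<alpha>(j := k)) i) = (\<Prod>i\<in>I. x i ^ \<alpha> i)"
          using insert.hyps by (intro prod.cong) auto
        then show ?thesis using insert.hyps by simp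
      qed
      then show "(\<Sum>\<alpha>\<in>monomials I K. c (\<alpha>(j := k)) * (\<Prod>i\<in>insert j I. x i ^ (\<alpha>(j := k)) i))
        = C x k * x j ^ k"
        unfolding C_def sum_distrib_right by (intro sum.cong refl) (simp only: mult_ac)
    qed
    finally show ?thesis .
  qed
  have C0: "C x k = 0" if "k \<le> K" for x k
  proof -
    have "(\<Sum>k\<le>K. C x k * t ^ k) = 0" for t
    proof -
      have "C (x(j := t)) k = C x k" for k
        unfolding C_def using insert.hyps
        by (intro sum.cong refl arg_cong2[where f="(*)"] prod.cong) auto
      then show ?thesis using split[of "x(j := t)"] insert.prems(1) by simp
    qed
    then show ?thesis using that polyfun_eq_0[of "C x" K] by blast
  qed
  obtain k \<beta> where kb: "\<alpha> = \<beta>(j := k)" "k \<le> K" "\<beta> \<in> monomials I K"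
    using insert.prems(2) by (auto simp: monomials_def PiE_insert_eq)
  have "\<forall>x. (\<Sum>\<alpha>\<in>monomials I K. c (\<alpha>(j := k)) * (\<Prod>i\<in>I. x i ^ \<alpha> i)) = 0"
    using C0[OF kb(2)] by (simp add: C_def)
  from insert.IH[OF this kb(3)] show ?case by (simp add: kb(1))
qed

definition monomial_span :: "'i set \<Rightarrow> nat \<Rightarrow> (('i \<Rightarrow> complex) \<Rightarrow> complex) set" where
  "monomial_span I K = {f. \<exists>c. \<forall>x. f x = (\<Sum>\<alpha>\<in>monomials I K. c \<alpha> * (\<Prod>i\<in>I. x i ^ \<alpha> i))}"

lemma monomial_span_single:
  assumes "finite I" "\<alpha> \<in> monomials I K"
  shows "(\<lambda>x. c * (\<Prod>i\<in>I. x i ^ \<alpha> i)) \<in> monomial_span I K"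
proof -
  have "c * (\<Prod>i\<in>I. x i ^ \<alpha> i) =
      (\<Sum>\<beta>\<in>monomials I K. (if \<beta> = \<alpha> then c else 0) * (\<Prod>i\<in>I. x i ^ \<beta> i))" for x :: "_ \<Rightarrow> complex"
    using assms by (simp add: if_distrib[of "\<lambda>c. c * _"] finite_monomials cong: if_cong)
  then show ?thesis unfolding monomial_span_def
    by (intro CollectI exI[of _ "\<lambda>\<beta>. if \<beta> = \<alpha> then c else 0"]) blast
qed

lemma monomial_span_sum:
  assumes "\<And>a. a \<in> A \<Longrightarrow> f a \<in> monomial_span I K"
  shows "(\<lambda>x. \<Sum>a\<in>A. f a x) \<in> monomial_span I K"
proof -
  have "\<forall>a\<in>A. \<exists>c. \<forall>x. f a x = (\<Sum>\<alpha>\<in>monomials I K. c \<alpha> * (\<Prod>i\<in>I. x i ^ \<alpha> i))"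
    using assms unfolding monomial_span_def by blast
  then obtain c where c: "\<And>a x. a \<in> A \<Longrightarrow> f a x = (\<Sum>\<alpha>\<in>monomials I K. c a \<alpha> * (\<Prod>i\<in>I. x i ^ \<alpha> i))"
    by metis
  have "(\<Sum>a\<in>A. f a x) = (\<Sum>\<alpha>\<in>monomials I K. (\<Sum>a\<in>A. c a \<alpha>) * (\<Prod>i\<in>I. x i ^ \<alpha> i))" for x
    using c by (simp add: sum_distrib_right sum.swap[of _ A])
  then show ?thesis unfolding monomial_span_def
    by (intro CollectI exI[of _ "\<lambda>\<alpha>. \<Sum>a\<in>A. c a \<alpha>"] allI)
qed

lemma monomial_span_mult:
  assumes "finite I" "f \<in> monomial_span I K" "g \<in> monomial_span I L"
  shows "(\<lambda>x. f x * g x) \<in> monomial_span I (K + L)"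
proof -
  obtain c d where c: "\<And>x. f x = (\<Sum>\<alpha>\<in>monomials I K. c \<alpha> * (\<Prod>i\<in>I. x i ^ \<alpha> i))"
    and d: "\<And>x. g x = (\<Sum>\<alpha>\<in>monomials I L. d \<alpha> * (\<Prod>i\<in>I. x i ^ \<alpha> i))"
    using assms unfolding monomial_span_def by blast
  have eq: "f x * g x = (\<Sum>(\<alpha>, \<beta>)\<in>monomials I K \<times> monomials I L.
      (c \<alpha> * d \<beta>) * (\<Prod>i\<in>I. x i ^ restrict (\<lambda>i. \<alpha> i + \<beta> i) I i))" for x
    by (simp add: c d sum_product sum.cartesian_product power_add prod.distrib mult_ac)
  have restrict_mono: "restrict (\<lambda>i. \<alpha> i + \<beta> i) I \<in> monomials I (K + L)"
    if "\<alpha> \<in> monomials I K" "\<beta> \<in> monomials I L" for \<alpha> \<beta>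
    using that by (fastforce simp: monomials_def PiE_iff intro: add_mono)
  have "(\<lambda>x. \<Sum>p\<in>monomials I K \<times> monomials I L.
      (c (fst p) * d (snd p)) * (\<Prod>i\<in>I. x i ^ restrict (\<lambda>i. fst p i + snd p i) I i))
      \<in> monomial_span I (K + L)"
  proof (intro monomial_span_sum monomial_span_single)
    fix p assume "p \<in> monomials I K \<times> monomials I L"
    then show "restrict (\<lambda>i. fst p i + snd p i) I \<in> monomials I (K + L)"
      by (intro restrict_mono) auto
  qed (use assms(1) in auto)
  with eq show ?thesis by (simp add: case_prod_unfold)
qed

lemma monomial_span_mono:
  assumes "finite I" "f \<in> monomial_span I K" "K \<le> L"
  shows "f \<in> monomial_span I L"
proof -
  obtain c where c: "\<And>x. f x = (\<Sum>\<alpha>\<in>monomials I K. c \<alpha> * (\<Prod>i\<in>I. x i ^ \<alpha> i))"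
    using assms unfolding monomial_span_def by blast
  have "(\<lambda>x. \<Sum>\<alpha>\<in>monomials I K. c \<alpha> * (\<Prod>i\<in>I. x i ^ \<alpha> i)) \<in> monomial_span I L"
    using assms by (intro monomial_span_sum monomial_span_single)
      (auto simp: monomials_def PiE_iff intro: order_trans)
  then show ?thesis using c by presburger
qed

lemma monomial_span_const: "finite I \<Longrightarrow> (\<lambda>x. c) \<in> monomial_span I K"
  using monomial_span_single[of I "restrict (\<lambda>_. 0) I" K c]
  by (simp add: monomials_def)

lemma monomial_span_prod:
  assumes "finite I" "\<And>a. a \<in> A \<Longrightarrow> f a \<in> monomial_span I (K a)"
  shows "(\<lambda>x. \<Prod>a\<in>A. f a x) \<in> monomial_span I (\<Sum>a\<in>A. K a)"
  using assms(2)
proof (induction A rule: infinite_finite_induct)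
  case (insert a A)
  then show ?case using monomial_span_mult[OF assms(1), of "f a" "K a"] by simp
qed (auto simp: monomial_span_const assms(1))

lemma monomial_span_power:
  assumes "finite I" "f \<in> monomial_span I K"
  shows "(\<lambda>x. f x ^ n) \<in> monomial_span I (n * K)"
  using monomial_span_prod[of I "{..<n}" "\<lambda>_. f" "\<lambda>_. K"] assms by simp

lemma polyfuns_in_monomial_span:
  assumes "finite I" "f \<in> polyfuns I"
  shows "\<exists>K. f \<in> monomial_span I K"
  using assms(2)
proof induction
  case (const c)
  then show ?case using monomial_span_const[OF assms(1)] by blast
next
  case (coord i)
  let ?\<alpha> = "restrict (\<lambda>j. if j = i then 1 else 0) I :: _ \<Rightarrow> nat"
  have "(\<lambda>x. 1 * (\<Prod>j\<in>I. x j ^ ?\<alpha> j)) \<in> monomial_span I 1"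
    by (rule monomial_span_single[OF assms(1)]) (auto simp: monomials_def)
  moreover have "(\<Prod>j\<in>I. x j ^ ?\<alpha> j) = x i" for x :: "_ \<Rightarrow> complex"
  proof -
    have "(\<Prod>j\<in>I. x j ^ ?\<alpha> j) = (\<Prod>j\<in>I. if j = i then x j else 1)"
      by (rule prod.cong) auto
    then show ?thesis using coord assms(1) by simp
  qed
  ultimately have "(\<lambda>x. x i) \<in> monomial_span I 1" by simp
  then show ?case by blast
next
  case (add f g)
  then obtain K L where "f \<in> monomial_span I K" "g \<in> monomial_span I L" by blast
  then have "f \<in> monomial_span I (K + L)" "g \<in> monomial_span I (K + L)"
    using monomial_span_mono[OF assms(1)] by auto
  then have "(\<lambda>x. \<Sum>b\<in>{True, False}. (if b then f else g) x) \<in> monomial_span I (K + L)"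
    by (intro monomial_span_sum) auto
  then show ?case by (intro exI[of _ "K + L"]) simp
next
  case (mult f g)
  then show ?case using monomial_span_mult[OF assms(1)] by blast
qed

text \<open>More functions than variables are algebraically dependent. With \<open>n\<close> variables, the products of
  powers up to \<open>d\<close> of the given functions lie in a space of dimension of order \<open>d ^ n\<close>, but there are
  at least \<open>(d + 1) ^ (n + 1)\<close> of them.\<close>

lemma algebraic_dependence:
  fixes G :: "'j \<Rightarrow> ('i \<Rightarrow> complex) \<Rightarrow> complex"
  assumes "finite I" "finite J" "card I < card J" "\<And>j. j \<in> J \<Longrightarrow> G j \<in> polyfuns I"
  shows "\<exists>d c. (\<exists>\<alpha>\<in>monomials J d. c \<alpha> \<noteq> 0) \<and>
    (\<forall>x. (\<Sum>\<alpha>\<in>monomials J d. c \<alpha> * (\<Prod>j\<in>J. G j x ^ \<alpha> j)) = 0)"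
proof -
  have "\<forall>j\<in>J. \<exists>K. G j \<in> monomial_span I K"
    using assms polyfuns_in_monomial_span by blast
  then obtain K where K: "\<And>j. j \<in> J \<Longrightarrow> G j \<in> monomial_span I (K j)" by metis
  define D where "D = (\<Sum>j\<in>J. K j)"
  \<comment> \<open>with this choice the number of products exceeds the dimension bound below\<close>
  define d where "d = (D + 1) ^ card I"
  have "(\<lambda>x. \<Prod>j\<in>J. G j x ^ \<alpha> j) \<in> monomial_span I (d * D)" if "\<alpha> \<in> monomials J d" for \<alpha>
  proof -
    have "(\<lambda>x. \<Prod>j\<in>J. G j x ^ \<alpha> j) \<in> monomial_span I (\<Sum>j\<in>J. \<alpha> j * K j)"
      using assms(1) K by (intro monomial_span_prod monomial_span_power) auto
    moreover have "(\<Sum>j\<in>J. \<alpha> j * K j) \<le> d * D"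
      unfolding D_def sum_distrib_left using that
      by (intro sum_mono mult_right_mono) (auto simp: monomials_def)
    ultimately show ?thesis using monomial_span_mono[OF assms(1)] by blast
  qed
  then have "\<forall>\<alpha>\<in>monomials J d. \<exists>M. \<forall>x. (\<Prod>j\<in>J. G j x ^ \<alpha> j) =
      (\<Sum>\<beta>\<in>monomials I (d * D). M \<beta> * (\<Prod>i\<in>I. x i ^ \<beta> i))"
    unfolding monomial_span_def by blast
  from bchoice[OF this] obtain M where M: "\<And>\<alpha> x. \<alpha> \<in> monomials J d \<Longrightarrow>
      (\<Prod>j\<in>J. G j x ^ \<alpha> j) = (\<Sum>\<beta>\<in>monomials I (d * D). M \<alpha> \<beta> * (\<Prod>i\<in>I. x i ^ \<beta> i))"
    by blast
  have "card (monomials I (d * D)) = (d * D + 1) ^ card I"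
    using assms(1) by (simp add: monomials_def card_funcsetE)
  also have "\<dots> \<le> ((d + 1) * (D + 1)) ^ card I"
    by (intro power_mono) (simp_all add: distrib_left distrib_right)
  also have "\<dots> = (d + 1) ^ card I * d"
    by (simp only: power_mult_distrib d_def)
  also have "\<dots> < (d + 1) ^ card I * (d + 1)"
    by (intro mult_strict_left_mono) auto
  also have "\<dots> = (d + 1) ^ (card I + 1)" by simp
  also have "\<dots> \<le> (d + 1) ^ card J"
    using assms(3) by (intro power_increasing) auto
  also have "\<dots> = card (monomials J d)"
    using assms(2) by (simp add: monomials_def card_funcsetE)
  finally have "card (monomials I (d * D)) < card (monomials J d)" .
  from nontrivial_kernel[OF finite_monomials[OF assms(1)] finite_monomials[OF assms(2)] this, of M]
  obtain c where c: "\<exists>\<alpha>\<in>monomials J d. c \<alpha> \<noteq> 0"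
    "\<And>\<beta>. \<beta> \<in> monomials I (d * D) \<Longrightarrow> (\<Sum>\<alpha>\<in>monomials J d. c \<alpha> * M \<alpha> \<beta>) = 0" by blast
  have "(\<Sum>\<alpha>\<in>monomials J d. c \<alpha> * (\<Prod>j\<in>J. G j x ^ \<alpha> j)) = 0" for x
  proof -
    have "(\<Sum>\<alpha>\<in>monomials J d. c \<alpha> * (\<Prod>j\<in>J. G j x ^ \<alpha> j))
      = (\<Sum>\<alpha>\<in>monomials J d. \<Sum>\<beta>\<in>monomials I (d * D). c \<alpha> * M \<alpha> \<beta> * (\<Prod>i\<in>I. x i ^ \<beta> i))"
      by (simp add: M sum_distrib_left mult.assoc)
    also have "\<dots> = (\<Sum>\<beta>\<in>monomials I (d * D). (\<Sum>\<alpha>\<in>monomials J d. c \<alpha> * M \<alpha> \<beta>) * (\<Prod>i\<in>I. x i ^ \<beta> i))"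
      by (subst sum.swap) (simp add: sum_distrib_right)
    also have "\<dots> = 0" using c(2) by simp
    finally show ?thesis .
  qed
  with c(1) show ?thesis by blast
qed

text \<open>A further function \<open>D\<close> on the source of a map \<open>Q\<close> to a space of at least the same dimension satisfies
  a polynomial equation over the functions of \<open>Q\<close>. The relation comes from the family that
  consists of \<open>D\<close> (index \<open>None\<close>) and the components of \<open>Q\<close>, grouped by powers of \<open>D\<close>.\<close>

lemma algebraic_relation:
  fixes Q :: "'j \<Rightarrow> ('i \<Rightarrow> complex) \<Rightarrow> complex"
  assumes "finite I" "finite J" "card I \<le> card J" "\<And>j. j \<in> J \<Longrightarrow> Q j \<in> polyfuns I"
    and "D \<in> polyfuns I"
  shows "\<exists>d R. (\<forall>k. R k \<in> polyfuns J) \<and> (\<exists>k\<le>d. \<exists>y. R k y \<noteq> 0) \<and>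
    (\<forall>x. (\<Sum>k\<le>d. R k (\<lambda>j. Q j x) * D x ^ k) = 0)"
proof -
  let ?J = "insert None (Some ` J)"
  define G where "G = (\<lambda>j. case j of None \<Rightarrow> D | Some j \<Rightarrow> Q j)"
  have "card I < card ?J" using assms(2,3) by (simp add: card_image)
  moreover have "G j \<in> polyfuns I" if "j \<in> ?J" for j
    using that assms by (auto simp: G_def)
  ultimately obtain d c where c: "\<exists>\<alpha>\<in>monomials ?J d. c \<alpha> \<noteq> 0"
    and rel: "\<And>x. (\<Sum>\<alpha>\<in>monomials ?J d. c \<alpha> * (\<Prod>j\<in>?J. G j x ^ \<alpha> j)) = 0"
    using algebraic_dependence[of I ?J G] assms(1,2) by blast
  define R where "R = (\<lambda>k (y :: 'j \<Rightarrow> complex).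
    \<Sum>\<alpha>\<in>{\<alpha>\<in>monomials ?J d. \<alpha> None = k}. c \<alpha> * (\<Prod>j\<in>J. y j ^ \<alpha> (Some j)))"
  have R: "(\<Sum>\<alpha>\<in>monomials ?J d. c \<alpha> * (\<Prod>j\<in>?J. z j ^ \<alpha> j))
      = (\<Sum>k\<le>d. R k (\<lambda>j. z (Some j)) * z None ^ k)" for z :: "'j option \<Rightarrow> complex"
  proof -
    have prod_eq: "(\<Prod>j\<in>?J. z j ^ \<alpha> j) = z None ^ \<alpha> None * (\<Prod>j\<in>J. z (Some j) ^ \<alpha> (Some j))" for \<alpha>
      using assms(2) by (simp add: prod.reindex)
    have "(\<Sum>\<alpha>\<in>monomials ?J d. c \<alpha> * (\<Prod>j\<in>?J. z j ^ \<alpha> j))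
      = (\<Sum>k\<le>d. \<Sum>\<alpha>\<in>{\<alpha>\<in>monomials ?J d. \<alpha> None = k}. c \<alpha> * (\<Prod>j\<in>?J. z j ^ \<alpha> j))"
      using assms(2) by (intro sum.group[symmetric]) (auto simp: finite_monomials, auto simp: monomials_def)
    also have "\<dots> = (\<Sum>k\<le>d. R k (\<lambda>j. z (Some j)) * z None ^ k)"
      unfolding R_def sum_distrib_right prod_eq
      by (intro sum.cong refl) (auto simp: mult_ac)
    finally show ?thesis .
  qed
  have "R k \<in> polyfuns J" for k
    unfolding R_def by (intro polyfuns_intros)
  moreover have "\<exists>k\<le>d. \<exists>y. R k y \<noteq> 0"
  proof (rule ccontr)
    assume "\<not> ?thesis"
    then have "(\<Sum>\<alpha>\<in>monomials ?J d. c \<alpha> * (\<Prod>j\<in>?J. z j ^ \<alpha> j)) = 0" for z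
      by (simp add: R)
    then have "c \<alpha> = 0" if "\<alpha> \<in> monomials ?J d" for \<alpha>
      using monomials_unique[where I="?J" and K=d and c=c] assms(2) that by blast
    with c show False by blast
  qed
  moreover have "(\<Sum>k\<le>d. R k (\<lambda>j. Q j x) * D x ^ k) = 0" for x
    using rel[of x] R[of "\<lambda>j. G j x"] by (simp add: G_def)
  ultimately show ?thesis by blast
qed

text \<open>A polynomial map to a space of at least the same dimension sends a hypersurface \<open>D = 0\<close>
  into a hypersurface. Divide the relation for \<open>D\<close> by the largest possible power of \<open>D\<close>; the lowest
  remaining coefficient then vanishes where \<open>D\<close> does.\<close>

lemma image_of_hypersurface:
  fixes Q :: "'j \<Rightarrow> ('i \<Rightarrow> complex) \<Rightarrow> complex"
  assumes "finite I" "finite J" "card I \<le> card J" and Q: "\<And>j. j \<in> J \<Longrightarrow> Q j \<in> polyfuns I"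
    and D: "D \<in> polyfuns I" "D x0 \<noteq> 0"
  shows "\<exists>R\<in>polyfuns J. (\<exists>y. R y \<noteq> 0) \<and> (\<forall>x. R (\<lambda>j. Q j x) \<noteq> 0 \<longrightarrow> D x \<noteq> 0)"
proof -
  obtain d R where R: "\<And>k. R k \<in> polyfuns J" "\<exists>k\<le>d. \<exists>y. R k y \<noteq> 0"
    "\<And>x. (\<Sum>k\<le>d. R k (\<lambda>j. Q j x) * D x ^ k) = 0"
    using algebraic_relation[of I J Q D] assms by blast
  define m where "m = (LEAST k. k \<le> d \<and> (\<exists>y. R k y \<noteq> 0))"
  have m: "m \<le> d" "\<exists>y. R m y \<noteq> 0"
    using LeastI_ex[OF R(2)[unfolded Bex_def], folded m_def] by auto
  have below: "R k y = 0" if "k < m" for k y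
    using not_less_Least[of k "\<lambda>k. k \<le> d \<and> (\<exists>y. R k y \<noteq> 0)", folded m_def] that m by auto
  define S where "S = (\<lambda>x. \<Sum>k\<in>{m..d}. R k (\<lambda>j. Q j x) * D x ^ (k - m))"
  have RQ: "(\<lambda>x. R k (\<lambda>j. Q j x)) \<in> polyfuns I" for k
    using polyfuns_compose[OF R(1) Q] .
  have S: "S \<in> polyfuns I"
    unfolding S_def by (intro polyfuns_intros RQ D(1))
  have "S x = 0" for x
  proof (rule ccontr)
    assume "S x \<noteq> 0"
    then obtain z where z: "S z \<noteq> 0" "D z \<noteq> 0"
      using polyfuns_mult_nonzero[OF S D(1) _ D(2)] by blast
    have "0 = (\<Sum>k\<in>{m..d}. R k (\<lambda>j. Q j z) * D z ^ k)"
      unfolding R(3)[of z, symmetric] by (rule sum.mono_neutral_right) (auto simp: below)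
    also have "\<dots> = (\<Sum>k\<in>{m..d}. R k (\<lambda>j. Q j z) * D z ^ (k - m) * D z ^ m)"
      by (rule sum.cong) (auto simp: mult.assoc power_add[symmetric])
    also have "\<dots> = S z * D z ^ m"
      by (simp add: S_def sum_distrib_right)
    finally show False using z by simp
  qed
  moreover have "S x = R m (\<lambda>j. Q j x)" if "D x = 0" for x
  proof -
    have "S x = (\<Sum>k\<in>{m}. R k (\<lambda>j. Q j x) * D x ^ (k - m))"
      unfolding S_def using that m(1) by (intro sum.mono_neutral_right) auto
    then show ?thesis by simp
  qed
  ultimately show ?thesis using R(1) m(2) by metis
qed

lemma polyfuns_stationary:
  fixes f :: "('j \<Rightarrow> complex) \<Rightarrow> complex"
  assumes "f \<in> polyfuns J" "\<And>j. j \<in> J \<Longrightarrow> ((\<lambda>s. y j s) has_field_derivative 0) (at t)"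
  shows "((\<lambda>s. f (\<lambda>j. y j s)) has_field_derivative 0) (at t)"
  using assms
proof induction
  case (add f g)
  then show ?case using DERIV_add[of _ 0 t UNIV _ 0] by simp
next
  case (mult f g)
  then show ?case using DERIV_mult'[of _ 0 t UNIV _ 0] by simp
qed auto

text \<open>Generic smoothness in the form needed here: over generic values of \<open>Q\<close>, a direction in which \<open>Q\<close> is
  stationary is one in which \<open>g\<close> is stationary. Take a relation of minimal degree \<open>d\<close> in \<open>g\<close>. Its derivative
  in such a direction is \<open>\<gamma>\<close> times the derivative of the relation with respect to \<open>g\<close>, which by minimality
  is not identically zero and so, by \<open>image_of_hypersurface\<close>, vanishes only over a hypersurface. If \<open>d = 0\<close>,
  the map \<open>Q\<close> is not dominant and a generic point has no preimage at all.\<close>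

lemma generically_unramified:
  fixes Q :: "'j \<Rightarrow> ('i \<Rightarrow> complex) \<Rightarrow> complex"
  assumes "finite I" "finite J" "card I \<le> card J" and Q: "\<And>j. j \<in> J \<Longrightarrow> Q j \<in> polyfuns I"
    and g: "g \<in> polyfuns I"
  shows "\<exists>R\<in>polyfuns J. (\<exists>y. R y \<noteq> 0) \<and>
    (\<forall>x v \<gamma>. R (\<lambda>j. Q j x) \<noteq> 0 \<longrightarrow>
       (\<forall>j\<in>J. ((\<lambda>s. Q j (\<lambda>i. x i + s * v i)) has_field_derivative 0) (at 0)) \<longrightarrow>
       ((\<lambda>s. g (\<lambda>i. x i + s * v i)) has_field_derivative \<gamma>) (at 0) \<longrightarrow> \<gamma> = 0)"
proof -
  define rel where "rel = (\<lambda>d R. (\<forall>k. R k \<in> polyfuns J) \<and> (\<exists>y. R d y \<noteq> 0) \<and>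
    (\<forall>x. (\<Sum>k\<le>d. R k (\<lambda>j. Q j x) * g x ^ k) = 0))"
  have ex: "\<exists>d R. rel d R"
  proof -
    obtain d R where R: "\<And>k. R k \<in> polyfuns J" "\<exists>k\<le>d. \<exists>y. R k y \<noteq> 0"
      "\<And>x. (\<Sum>k\<le>d. R k (\<lambda>j. Q j x) * g x ^ k) = 0"
      using algebraic_relation[of I J Q g] assms by blast
    let ?P = "\<lambda>k. k \<le> d \<and> (\<exists>y. R k y \<noteq> 0)"
    define m where "m = (GREATEST k. ?P k)"
    have "?P m" unfolding m_def using R(2) by (intro GreatestI_ex_nat[of ?P d]) auto
    have above: "R k y = 0" if "m < k" "k \<le> d" for k y
      using Greatest_le_nat[of ?P k d, folded m_def] that by auto
    have "(\<Sum>k\<le>m. R k (\<lambda>j. Q j x) * g x ^ k) = (\<Sum>k\<le>d. R k (\<lambda>j. Q j x) * g x ^ k)" for x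
      using \<open>?P m\<close> above by (intro sum.mono_neutral_left) auto
    then have "rel m R" unfolding rel_def using R(1,3) \<open>?P m\<close> by simp
    then show ?thesis by blast
  qed
  define d where "d = (LEAST d. \<exists>R. rel d R)"
  obtain R where "rel d R" using LeastI_ex[OF ex, folded d_def] by blast
  then have R: "\<And>k. R k \<in> polyfuns J" "\<exists>y. R d y \<noteq> 0"
    "\<And>x. (\<Sum>k\<le>d. R k (\<lambda>j. Q j x) * g x ^ k) = 0" by (auto simp: rel_def)
  have minimal: "\<not> rel m R'" if "m < d" for m R'
    using not_less_Least[of m "\<lambda>d. \<exists>R. rel d R", folded d_def] that by blast
  show ?thesis
  proof (cases d)
    case 0
    then have "R 0 (\<lambda>j. Q j x) = 0" for x using R(3)[of x] by simp
    then show ?thesis using R(1)[of 0] R(2) 0 by auto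
  next
    case (Suc m)
    define R' where "R' = (\<lambda>k y. of_nat (Suc k) * R (Suc k) y)"
    define D where "D = (\<lambda>x. \<Sum>k\<le>m. R' k (\<lambda>j. Q j x) * g x ^ k)"
    have R'_poly: "R' k \<in> polyfuns J" for k
      unfolding R'_def by (intro polyfuns_intros R(1))
    have "(\<lambda>x. R' k (\<lambda>j. Q j x)) \<in> polyfuns I" for k
      using polyfuns_compose[OF R'_poly Q] .
    then have D: "D \<in> polyfuns I" unfolding D_def by (intro polyfuns_intros g)
    have "\<not> rel m R'" using minimal Suc by simp
    moreover have "\<exists>y. R' m y \<noteq> 0"
      using R(2) Suc by (simp add: R'_def del: of_nat_Suc)
    ultimately obtain x0 where "D x0 \<noteq> 0"
      using R'_poly by (auto simp: rel_def D_def)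
    from image_of_hypersurface[of I J Q D, OF assms(1-3) Q D this]
    obtain T where T: "T \<in> polyfuns J" "\<exists>y. T y \<noteq> 0" "\<And>x. T (\<lambda>j. Q j x) \<noteq> 0 \<Longrightarrow> D x \<noteq> 0" by blast
    have "\<gamma> = 0" if "T (\<lambda>j. Q j x) \<noteq> 0"
      and dQ: "\<forall>j\<in>J. ((\<lambda>s. Q j (\<lambda>i. x i + s * v i)) has_field_derivative 0) (at 0)"
      and dg: "((\<lambda>s. g (\<lambda>i. x i + s * v i)) has_field_derivative \<gamma>) (at 0)" for x v \<gamma>
    proof -
      let ?l = "\<lambda>s i. x i + s * v i"
      have dR: "((\<lambda>s. R k (\<lambda>j. Q j (?l s))) has_field_derivative 0) (at 0)" for k
        using polyfuns_stationary[OF R(1), of "\<lambda>j s. Q j (?l s)" 0] dQ by blast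
      have "((\<lambda>s. R k (\<lambda>j. Q j (?l s)) * g (?l s) ^ k) has_field_derivative
          R k (\<lambda>j. Q j x) * (of_nat k * (\<gamma> * g x ^ (k - 1)))) (at 0)" for k
        using DERIV_mult'[OF dR[of k] DERIV_power[OF dg, of k]] by (simp add: mult_ac)
      then have "((\<lambda>s. \<Sum>k\<le>d. R k (\<lambda>j. Q j (?l s)) * g (?l s) ^ k) has_field_derivative
          (\<Sum>k\<le>d. R k (\<lambda>j. Q j x) * (of_nat k * (\<gamma> * g x ^ (k - 1))))) (at 0)"
        by (intro DERIV_sum) blast
      then have "((\<lambda>s. 0) has_field_derivative
          (\<Sum>k\<le>d. R k (\<lambda>j. Q j x) * (of_nat k * (\<gamma> * g x ^ (k - 1))))) (at 0)"
        by (simp only: R(3))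
      then have "(\<Sum>k\<le>d. R k (\<lambda>j. Q j x) * (of_nat k * (\<gamma> * g x ^ (k - 1)))) = 0"
        using DERIV_unique[OF _ DERIV_const] by blast
      then have "\<gamma> * D x = 0"
        unfolding Suc D_def R'_def sum_distrib_left
        by (simp add: sum.atMost_Suc_shift mult_ac del: sum.atMost_Suc)
      then show ?thesis using T(3)[OF that(1)] by simp
    qed
    with T show ?thesis by blast
  qed
qed

section \<open>Local inversion of finite systems of equations\<close>

text \<open>The number of variables varies with the graph, so vectors are functions that are
  compared on a finite index set \<open>K\<close> and fixed outside it; estimates are in the maximum norm.\<close>

definition polydisc :: "'k set \<Rightarrow> ('k \<Rightarrow> complex) \<Rightarrow> real \<Rightarrow> ('k \<Rightarrow> complex) set" where
  "polydisc K c r = {\<xi>. (\<forall>k\<in>K. norm (\<xi> k - c k) \<le> r) \<and> (\<forall>k. k \<notin> K \<longrightarrow> \<xi> k = c k)}"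

lemma polydisc_mono: "r \<le> s \<Longrightarrow> polydisc K c r \<subseteq> polydisc K c s"
  by (force simp: polydisc_def)

text \<open>Banach iteration. The contraction hypothesis is stated with an arbitrary bound \<open>D\<close> instead of a
  distance, which avoids introducing the maximum norm as a metric.\<close>

lemma contraction_fixed_point:
  fixes T :: "('k \<Rightarrow> complex) \<Rightarrow> 'k \<Rightarrow> complex"
  assumes "finite K" "0 \<le> r"
    and maps: "\<And>\<xi> k. \<xi> \<in> polydisc K c r \<Longrightarrow> k \<in> K \<Longrightarrow> norm (T \<xi> k - c k) \<le> r"
    and contr: "\<And>\<xi> \<xi>' D k. \<xi> \<in> polydisc K c r \<Longrightarrow> \<xi>' \<in> polydisc K c r \<Longrightarrow>
      (\<And>k. k \<in> K \<Longrightarrow> norm (\<xi> k - \<xi>' k) \<le> D) \<Longrightarrow> k \<in> K \<Longrightarrow> norm (T \<xi> k - T \<xi>' k) \<le> D / 2"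
  shows "\<exists>\<xi>\<in>polydisc K c r. \<forall>k\<in>K. T \<xi> k = \<xi> k"
proof -
  define x where "x = rec_nat c (\<lambda>_ \<xi> k. if k \<in> K then T \<xi> k else c k)"
  have x0: "x 0 = c" and xS: "\<And>n k. x (Suc n) k = (if k \<in> K then T (x n) k else c k)"
    by (auto simp: x_def)
  have x_in: "x n \<in> polydisc K c r" for n
  proof (induction n)
    case 0 then show ?case using assms(2) by (simp add: x0 polydisc_def)
  next
    case (Suc n) then show ?case using maps[OF Suc] by (simp add: xS polydisc_def)
  qed
  have step: "norm (x (Suc n) k - x n k) \<le> r * (1 / 2) ^ n" if "k \<in> K" for n k
    using that
  proof (induction n arbitrary: k)
    case 0
    then show ?case using maps[OF x_in[of 0] 0] by (simp add: xS x0)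
  next
    case (Suc n)
    have "norm (T (x (Suc n)) k - T (x n) k) \<le> r * (1 / 2) ^ n / 2"
      using contr[OF x_in x_in Suc.IH Suc.prems] .
    then show ?case using Suc.prems by (simp add: xS[of "Suc n"] xS[of n])
  qed
  have "convergent (\<lambda>n. x n k)" if "k \<in> K" for k
  proof -
    have "summable (\<lambda>n. x (Suc n) k - x n k)"
    proof (rule summable_comparison_test')
      show "summable (\<lambda>n. r * (1 / 2) ^ n)"
        by (intro summable_mult summable_geometric) simp
      show "norm (x (Suc n) k - x n k) \<le> r * (1 / 2) ^ n" if "n \<ge> 0" for n
        by (rule step[OF \<open>k \<in> K\<close>])
    qed
    then have "(\<lambda>n. c k + (\<Sum>i<n. x (Suc i) k - x i k)) \<longlonglongrightarrow> c k + (\<Sum>i. x (Suc i) k - x i k)"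
      by (intro tendsto_intros summable_LIMSEQ)
    moreover have "c k + (\<Sum>i<n. x (Suc i) k - x i k) = x n k" for n
      by (induction n) (simp_all add: x0 flip: add.assoc)
    ultimately show ?thesis by (auto simp: convergent_def)
  qed
  then have l: "(\<lambda>n. x n k) \<longlonglongrightarrow> lim (\<lambda>n. x n k)" if "k \<in> K" for k
    using that convergent_LIMSEQ_iff by blast
  define \<xi> where "\<xi> = (\<lambda>k. if k \<in> K then lim (\<lambda>n. x n k) else c k)"
  have lim: "(\<lambda>n. x n k) \<longlonglongrightarrow> \<xi> k" if "k \<in> K" for k
    using l[OF that] that by (simp add: \<xi>_def)
  have \<xi>_in: "\<xi> \<in> polydisc K c r"
  proof -
    have "norm (\<xi> k - c k) \<le> r" if "k \<in> K" for k
      using x_in that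
      by (intro LIMSEQ_le_const2[OF tendsto_norm[OF tendsto_diff[OF lim[OF that] tendsto_const]]])
        (auto simp: polydisc_def)
    then show ?thesis by (simp add: polydisc_def \<xi>_def)
  qed
  have "T \<xi> k = \<xi> k" if k: "k \<in> K" for k
  proof (rule ccontr)
    assume "T \<xi> k \<noteq> \<xi> k"
    define e where "e = norm (T \<xi> k - \<xi> k) / 2"
    have "e > 0" using \<open>T \<xi> k \<noteq> \<xi> k\<close> by (simp add: e_def)
    have "eventually (\<lambda>n. \<forall>k\<in>K. norm (\<xi> k - x n k) < e) sequentially"
    proof (intro eventually_ball_finite ballI assms(1))
      fix k assume "k \<in> K"
      from tendstoD[OF lim[OF this] \<open>e > 0\<close>]
      show "eventually (\<lambda>n. norm (\<xi> k - x n k) < e) sequentially"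
        by (simp add: dist_norm norm_minus_commute)
    qed
    then obtain n where n: "\<And>m k. m \<ge> n \<Longrightarrow> k \<in> K \<Longrightarrow> norm (\<xi> k - x m k) < e"
      unfolding eventually_sequentially by blast
    have "norm (T \<xi> k - T (x n) k) \<le> e / 2"
      using n[of n] by (intro contr[OF \<xi>_in x_in _ k]) (auto intro: less_imp_le)
    moreover have "norm (\<xi> k - T (x n) k) < e" using n[of "Suc n" k] k by (simp add: xS)
    moreover have "norm (T \<xi> k - \<xi> k) \<le> norm (T \<xi> k - T (x n) k) + norm (\<xi> k - T (x n) k)"
      by (metis dist_commute dist_norm dist_triangle)
    ultimately show False using \<open>e > 0\<close> unfolding e_def by linarith
  qed
  with \<xi>_in show ?thesis by blast
qed

text \<open>The components in \<open>K\<close> of \<open>L\<close>, restricted to functions supported on \<open>K\<close>, form a square matrix with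
  trivial kernel.\<close>

locale finite_linear =
  fixes K :: "'k set" and L :: "('k \<Rightarrow> complex) \<Rightarrow> 'k \<Rightarrow> complex"
  assumes finite_K: "finite K"
    and L_add: "L (\<lambda>k. x k + y k) j = L x j + L y j"
    and L_scale: "L (\<lambda>k. a * x k) j = a * L x j"
    and L_inj: "(\<And>k. k \<notin> K \<Longrightarrow> \<zeta> k = 0) \<Longrightarrow> (\<And>k. k \<in> K \<Longrightarrow> L \<zeta> k = 0) \<Longrightarrow> \<zeta> k = 0"
begin

lemma L_sum: "finite S \<Longrightarrow> L (\<lambda>k. \<Sum>i\<in>S. a i * x i k) j = (\<Sum>i\<in>S. a i * L (x i) j)"
proof (induction S rule: finite_induct)
  case empty
  then show ?case using L_scale[of 0 "\<lambda>_. 0" j] by simp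
next
  case (insert i S)
  then show ?case
    using L_add[of "\<lambda>k. a i * x i k" "\<lambda>k. \<Sum>i\<in>S. a i * x i k" j] by (simp add: L_scale)
qed

text \<open>Injectivity gives surjectivity: the columns of \<open>L\<close> together with a unit vector (index \<open>None\<close>) are
  linearly dependent, and the unit vector must occur in the dependence.\<close>

lemma L_surj:
  assumes "j \<in> K"
  shows "\<exists>\<zeta>. (\<forall>k. k \<notin> K \<longrightarrow> \<zeta> k = 0) \<and> (\<forall>k\<in>K. L \<zeta> k = (if k = j then 1 else 0))"
proof -
  let ?A = "insert None (Some ` K)"
  let ?u = "\<lambda>i k. if k = i then 1 else 0 :: complex"
  define M where "M = (\<lambda>i k. case i of None \<Rightarrow> ?u j k | Some i \<Rightarrow> L (?u i) k)"
  have "card K < card ?A" using finite_K by (simp add: card_image)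
  then obtain c where c: "\<exists>i\<in>?A. c i \<noteq> 0" "\<And>k. k \<in> K \<Longrightarrow> (\<Sum>i\<in>?A. c i * M i k) = 0"
    using nontrivial_kernel[of K ?A M] finite_K by blast
  define \<zeta> where "\<zeta> = (\<lambda>k. \<Sum>i\<in>K. c (Some i) * ?u i k)"
  have \<zeta>: "\<zeta> k = (if k \<in> K then c (Some k) else 0)" for k
    using finite_K by (simp add: \<zeta>_def if_distrib[of "\<lambda>x. _ * x"] cong: if_cong)
  have L\<zeta>: "L \<zeta> k = - c None * ?u j k" if "k \<in> K" for k
  proof -
    have "(\<Sum>i\<in>?A. c i * M i k) = c None * ?u j k + L \<zeta> k"
      using finite_K unfolding \<zeta>_def L_sum[OF finite_K] by (simp add: sum.reindex M_def)
    then show ?thesis using c(2)[OF that] by (simp add: eq_neg_iff_add_eq_0 add.commute)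
  qed
  have "c None \<noteq> 0"
  proof
    assume "c None = 0"
    then have "\<zeta> k = 0" for k using L_inj[of \<zeta> k] L\<zeta> \<zeta> by simp
    then show False using c(1) \<open>c None = 0\<close> \<zeta> by auto metis
  qed
  then have "L (\<lambda>k. - 1 / c None * \<zeta> k) k = (if k = j then 1 else 0)" if "k \<in> K" for k
    unfolding L_scale L\<zeta>[OF that] by simp
  then have "(\<forall>k. k \<notin> K \<longrightarrow> - 1 / c None * \<zeta> k = 0) \<and>
      (\<forall>k\<in>K. L (\<lambda>k. - 1 / c None * \<zeta> k) k = (if k = j then 1 else 0))"
    by (simp add: \<zeta>)
  then show ?thesis by (intro exI)
qed

lemma bounded_inverse:
  obtains A C where "C > 0"
    and "\<And>y k. k \<in> K \<Longrightarrow> L (A y) k = y k"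
    and "\<And>\<zeta> k. (\<And>k. k \<notin> K \<Longrightarrow> \<zeta> k = 0) \<Longrightarrow> A (L \<zeta>) k = \<zeta> k"
    and "\<And>y z k. A (\<lambda>k. y k - z k) k = A y k - A z k"
    and "\<And>y B k. (\<And>j. j \<in> K \<Longrightarrow> norm (y j) \<le> B) \<Longrightarrow> k \<in> K \<Longrightarrow> norm (A y k) \<le> C * B"
    and "\<And>y k. k \<notin> K \<Longrightarrow> A y k = 0"
    and "\<And>y k. (\<And>j. j \<in> K \<Longrightarrow> y j = 0) \<Longrightarrow> A y k = 0"
proof -
  from bchoice[OF ballI[OF L_surj]]
  obtain a where aK: "\<forall>j\<in>K. (\<forall>k. k \<notin> K \<longrightarrow> a j k = 0) \<and>
      (\<forall>k\<in>K. L (a j) k = (if k = j then 1 else 0))"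
    by (rule exE)
  have a: "j \<in> K \<Longrightarrow> k \<notin> K \<Longrightarrow> a j k = 0"
    "j \<in> K \<Longrightarrow> k \<in> K \<Longrightarrow> L (a j) k = (if k = j then 1 else 0)" for j k
    using aK by simp_all
  define A where "A = (\<lambda>y k. \<Sum>j\<in>K. y j * a j k)"
  define C where "C = 1 + (\<Sum>k\<in>K. \<Sum>j\<in>K. norm (a j k))"
  have LA: "L (A y) k = y k" if "k \<in> K" for y k
    unfolding A_def L_sum[OF finite_K] using that a(2) finite_K
    by (simp add: if_distrib[of "\<lambda>x. _ * x"] cong: if_cong)
  have A0: "A y k = 0" if "k \<notin> K" for y k
    using that a(1) by (simp add: A_def)
  show ?thesis
  proof
    show "C > 0" unfolding C_def by (simp add: add_pos_nonneg sum_nonneg)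
    show "L (A y) k = y k" if "k \<in> K" for y k by (rule LA[OF that])
    show "A (L \<zeta>) k = \<zeta> k" if "\<And>k. k \<notin> K \<Longrightarrow> \<zeta> k = 0" for \<zeta> k
    proof -
      have "L (\<lambda>k. A (L \<zeta>) k + (- 1) * \<zeta> k) k = 0" if "k \<in> K" for k
        unfolding L_add[of "A (L \<zeta>)"] L_scale LA[OF that] by simp
      moreover have "A (L \<zeta>) k + (- 1) * \<zeta> k = 0" if "k \<notin> K" for k
        using A0[OF that] \<open>\<And>k. k \<notin> K \<Longrightarrow> \<zeta> k = 0\<close>[OF that] by simp
      ultimately have "A (L \<zeta>) k + (- 1) * \<zeta> k = 0"
        using L_inj[of "\<lambda>k. A (L \<zeta>) k + (- 1) * \<zeta> k" k] by blast
      then show ?thesis by simp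
    qed
    show "A (\<lambda>k. y k - z k) k = A y k - A z k" for y z k
      by (simp add: A_def left_diff_distrib sum_subtractf)
    show "norm (A y k) \<le> C * B" if "\<And>j. j \<in> K \<Longrightarrow> norm (y j) \<le> B" "k \<in> K" for y B k
    proof -
      have "B \<ge> 0" using that norm_ge_zero order_trans by blast
      have "norm (A y k) \<le> (\<Sum>j\<in>K. norm (y j) * norm (a j k))"
        unfolding A_def by (rule order_trans[OF norm_sum]) (simp add: norm_mult)
      also have "\<dots> \<le> (\<Sum>j\<in>K. B * norm (a j k))"
        using that by (intro sum_mono mult_right_mono) auto
      also have "\<dots> = B * (\<Sum>j\<in>K. norm (a j k))" by (simp add: sum_distrib_left)
      also have "\<dots> \<le> B * C"
      proof (rule mult_left_mono[OF _ \<open>B \<ge> 0\<close>])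
        have "(\<Sum>j\<in>K. norm (a j k)) \<le> (\<Sum>k\<in>K. \<Sum>j\<in>K. norm (a j k))"
          using that(2) finite_K by (intro member_le_sum) (auto simp: sum_nonneg)
        then show "(\<Sum>j\<in>K. norm (a j k)) \<le> C" by (simp add: C_def)
      qed
      finally show ?thesis by (simp add: mult.commute)
    qed
    show "A y k = 0" if "k \<notin> K" for y k by (rule A0[OF that])
    show "A y k = 0" if "\<And>j. j \<in> K \<Longrightarrow> y j = 0" for y k
      using that by (simp add: A_def)
  qed
qed

text \<open>The inverse function theorem by Newton iteration with fixed inverse \<open>A\<close> of the derivative. The neighbourhood
  in the source may be any sufficiently small polydisc, so that several local inverses
  can later be used with one common radius.\<close>

theorem local_inverse:
  assumes strict: "\<And>\<delta>. \<delta> > 0 \<Longrightarrow> \<exists>r>0. \<forall>\<xi>\<in>polydisc K c r. \<forall>\<xi>'\<in>polydisc K c r. \<forall>D.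
      (\<forall>k\<in>K. norm (\<xi> k - \<xi>' k) \<le> D) \<longrightarrow>
      (\<forall>k\<in>K. norm (F \<xi> k - F \<xi>' k - L (\<lambda>k. \<xi> k - \<xi>' k) k) \<le> \<delta> * D)"
  shows "\<exists>r0>0. \<forall>r. 0 < r \<and> r \<le> r0 \<longrightarrow> (\<exists>\<epsilon>>0. \<forall>\<eta>. (\<forall>k\<in>K. norm (\<eta> k - F c k) < \<epsilon>) \<longrightarrow>
      (\<exists>!\<xi>. \<xi> \<in> polydisc K c r \<and> (\<forall>k\<in>K. F \<xi> k = \<eta> k)))"
proof -
  obtain A C where AC: "C > 0"
    and LA: "\<And>y k. k \<in> K \<Longrightarrow> L (A y) k = y k"
    and AL: "\<And>\<zeta> k. (\<And>k. k \<notin> K \<Longrightarrow> \<zeta> k = 0) \<Longrightarrow> A (L \<zeta>) k = \<zeta> k"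
    and A_diff: "\<And>y z k. A (\<lambda>k. y k - z k) k = A y k - A z k"
    and A_le: "\<And>y B k. (\<And>j. j \<in> K \<Longrightarrow> norm (y j) \<le> B) \<Longrightarrow> k \<in> K \<Longrightarrow> norm (A y k) \<le> C * B"
    and A_off: "\<And>y k. k \<notin> K \<Longrightarrow> A y k = 0"
    and A_0: "\<And>y k. (\<And>j. j \<in> K \<Longrightarrow> y j = 0) \<Longrightarrow> A y k = 0"
    by (rule bounded_inverse) blast
  \<comment> \<open>with this accuracy of the linearisation, the Newton map contracts by the factor 1/2\<close>
  have "1 / (2 * C) > 0" using AC by simp
  from strict[OF this] obtain r0 where r0: "r0 > 0"
    and sd: "\<And>\<xi> \<xi>' D k. \<xi> \<in> polydisc K c r0 \<Longrightarrow> \<xi>' \<in> polydisc K c r0 \<Longrightarrow>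
      (\<And>k. k \<in> K \<Longrightarrow> norm (\<xi> k - \<xi>' k) \<le> D) \<Longrightarrow> k \<in> K \<Longrightarrow>
      norm (F \<xi> k - F \<xi>' k - L (\<lambda>k. \<xi> k - \<xi>' k) k) \<le> 1 / (2 * C) * D" by blast
  show ?thesis
  proof (rule exI[of _ r0], rule conjI[OF r0], intro allI impI)
    fix r assume r: "0 < r \<and> r \<le> r0"
    have sub: "polydisc K c r \<subseteq> polydisc K c r0" using polydisc_mono r by blast
    define \<epsilon> where "\<epsilon> = r / (2 * C)"
    have "\<epsilon> > 0" using AC r by (simp add: \<epsilon>_def)
    moreover have "\<exists>!\<xi>. \<xi> \<in> polydisc K c r \<and> (\<forall>k\<in>K. F \<xi> k = \<eta> k)"
      if \<eta>: "\<forall>k\<in>K. norm (\<eta> k - F c k) < \<epsilon>" for \<eta>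
    proof -
      define T where "T = (\<lambda>\<xi> k. \<xi> k - A (\<lambda>j. F \<xi> j - \<eta> j) k)"
      have contr: "norm (T \<xi> k - T \<xi>' k) \<le> D / 2"
        if in_disc: "\<xi> \<in> polydisc K c r" "\<xi>' \<in> polydisc K c r"
          and D: "\<And>k. k \<in> K \<Longrightarrow> norm (\<xi> k - \<xi>' k) \<le> D" and "k \<in> K" for \<xi> \<xi>' D k
      proof -
        let ?d = "\<lambda>k. \<xi> k - \<xi>' k"
        have off: "\<And>k. k \<notin> K \<Longrightarrow> ?d k = 0" using in_disc by (simp add: polydisc_def)
        have "A (\<lambda>j. L ?d j - ((F \<xi> j - \<eta> j) - (F \<xi>' j - \<eta> j))) k = T \<xi> k - T \<xi>' k"
          unfolding A_diff[of "L ?d"] A_diff[of "\<lambda>j. F \<xi> j - \<eta> j"] by (simp add: T_def AL[of ?d, OF off])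
        moreover have "norm (A (\<lambda>j. L ?d j - ((F \<xi> j - \<eta> j) - (F \<xi>' j - \<eta> j))) k)
            \<le> C * (1 / (2 * C) * D)"
        proof (rule A_le[OF _ \<open>k \<in> K\<close>])
          fix j assume "j \<in> K"
          have "norm (F \<xi> j - F \<xi>' j - L ?d j) \<le> 1 / (2 * C) * D"
            using sd[of \<xi> \<xi>' D j] in_disc sub D \<open>j \<in> K\<close> by blast
          then show "norm (L ?d j - ((F \<xi> j - \<eta> j) - (F \<xi>' j - \<eta> j))) \<le> 1 / (2 * C) * D"
            by (simp add: norm_minus_commute)
        qed
        ultimately show ?thesis using AC by simp
      qed
      have c_in: "c \<in> polydisc K c r" using r by (simp add: polydisc_def)
      have maps: "norm (T \<xi> k - c k) \<le> r" if "\<xi> \<in> polydisc K c r" "k \<in> K" for \<xi> k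
      proof -
        have "norm (A (\<lambda>j. F c j - \<eta> j) k) \<le> C * \<epsilon>"
          using \<eta> that(2) by (intro A_le) (auto simp: norm_minus_commute less_imp_le)
        then have "norm (T c k - c k) \<le> r / 2" using AC by (simp add: T_def \<epsilon>_def)
        moreover have "norm (T \<xi> k - T c k) \<le> r / 2"
          using that by (intro contr[OF that(1) c_in]) (auto simp: polydisc_def)
        ultimately show ?thesis
          using norm_triangle_ineq[of "T \<xi> k - T c k" "T c k - c k"] by simp
      qed
      have fixed_iff: "(\<forall>k\<in>K. T \<xi> k = \<xi> k) \<longleftrightarrow> (\<forall>k\<in>K. F \<xi> k = \<eta> k)" for \<xi>
      proof
        assume "\<forall>k\<in>K. T \<xi> k = \<xi> k"
        then have "A (\<lambda>j. F \<xi> j - \<eta> j) = (\<lambda>_. 0)"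
          using A_off by (auto simp: T_def)
        then have "F \<xi> k - \<eta> k = 0" if "k \<in> K" for k
          using LA[OF that, of "\<lambda>j. F \<xi> j - \<eta> j"] L_scale[of 0 "\<lambda>_. 0" k] by simp
        then show "\<forall>k\<in>K. F \<xi> k = \<eta> k" by simp
      next
        assume "\<forall>k\<in>K. F \<xi> k = \<eta> k"
        then show "\<forall>k\<in>K. T \<xi> k = \<xi> k" using A_0[of "\<lambda>j. F \<xi> j - \<eta> j"] by (simp add: T_def)
      qed
      obtain \<xi> where \<xi>: "\<xi> \<in> polydisc K c r" "\<forall>k\<in>K. T \<xi> k = \<xi> k"
        using contraction_fixed_point[of K r c T] finite_K maps contr r by force
      show ?thesis
      proof (rule ex1I[of _ \<xi>])
        show "\<xi> \<in> polydisc K c r \<and> (\<forall>k\<in>K. F \<xi> k = \<eta> k)" using \<xi> fixed_iff by blast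
      next
        fix \<xi>' assume \<xi>': "\<xi>' \<in> polydisc K c r \<and> (\<forall>k\<in>K. F \<xi>' k = \<eta> k)"
        define m where "m = Max (insert 0 ((\<lambda>k. norm (\<xi>' k - \<xi> k)) ` K))"
        have m: "norm (\<xi>' k - \<xi> k) \<le> m" if "k \<in> K" for k
          unfolding m_def using finite_K that by (intro Max_ge) auto
        have half: "norm (\<xi>' k - \<xi> k) \<le> m / 2" if "k \<in> K" for k
          using contr[of \<xi>' \<xi> m k] \<xi>' \<xi> m that fixed_iff by metis
        have "m \<ge> 0" unfolding m_def using finite_K by (intro Max_ge) auto
        moreover have "Max (insert 0 ((\<lambda>k. norm (\<xi>' k - \<xi> k)) ` K)) \<le> m / 2"
          using finite_K half \<open>m \<ge> 0\<close> by (intro Max.boundedI) auto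
        ultimately have "m \<le> 0" unfolding m_def[symmetric] by simp
        then have "\<xi>' k = \<xi> k" if "k \<in> K" for k using m[OF that]
          by (metis norm_le_zero_iff order_trans right_minus_eq)
        then have "\<xi>' k = \<xi> k" for k using \<xi>' \<xi> by (cases "k \<in> K") (auto simp: polydisc_def)
        then show "\<xi>' = \<xi>" by blast
      qed
    qed
    ultimately show "\<exists>\<epsilon>>0. \<forall>\<eta>. (\<forall>k\<in>K. norm (\<eta> k - F c k) < \<epsilon>) \<longrightarrow>
      (\<exists>!\<xi>. \<xi> \<in> polydisc K c r \<and> (\<forall>k\<in>K. F \<xi> k = \<eta> k))" by blast
  qed
qed

end

section \<open>Potentials and flows on networks\<close>

text \<open>A network is a directed multigraph with edges \<open>e\<close> from \<open>s e\<close> to \<open>t e\<close>. A potential on vertices and a flow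
  on edges are combined into one function on the sum type, since both are unknowns of one
  square system of equations.\<close>

definition outflow :: "'e set \<Rightarrow> ('e \<Rightarrow> 'v) \<Rightarrow> ('e \<Rightarrow> 'v) \<Rightarrow> ('v + 'e \<Rightarrow> complex) \<Rightarrow> 'v \<Rightarrow> complex" where
  "outflow E s t \<eta> x = (\<Sum>e\<in>{e\<in>E. s e = x}. \<eta> (Inr e)) - (\<Sum>e\<in>{e\<in>E. t e = x}. \<eta> (Inr e))"

definition stretch :: "('e \<Rightarrow> 'v) \<Rightarrow> ('e \<Rightarrow> 'v) \<Rightarrow> ('v + 'e \<Rightarrow> complex) \<Rightarrow> 'e \<Rightarrow> complex" where
  "stretch s t \<eta> e = \<eta> (Inl (s e)) - \<eta> (Inl (t e))"

text \<open>The solutions with weights \<open>q\<close> and boundary values \<open>a\<close>, as pairs of potential and flow. Nonzero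
  potential difference is demanded only on \<open>F\<close>: the case \<open>F = E\<close> describes the solutions proper, and one edge
  is left out when its weight tends to \<open>0\<close>.\<close>

definition fibre :: "'v set \<Rightarrow> 'e set \<Rightarrow> ('e \<Rightarrow> 'v) \<Rightarrow> ('e \<Rightarrow> 'v) \<Rightarrow> ('v \<Rightarrow> complex) \<Rightarrow> 'e set \<Rightarrow>
    ('e \<Rightarrow> complex) \<Rightarrow> ('v + 'e \<Rightarrow> complex) set" where
  "fibre I E s t a F q = {\<eta>. (\<forall>x. x \<notin> I \<longrightarrow> \<eta> (Inl x) = a x) \<and> (\<forall>e. e \<notin> E \<longrightarrow> \<eta> (Inr e) = 0) \<and>
     (\<forall>x\<in>I. outflow E s t \<eta> x = 0) \<and> (\<forall>e\<in>E. \<eta> (Inr e) * stretch s t \<eta> e = q e) \<and>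
     (\<forall>e\<in>F. stretch s t \<eta> e \<noteq> 0)}"

text \<open>Injectivity of the derivative at \<open>\<eta>\<close> of the system that defines a fibre; the hypotheses on \<open>\<zeta>\<close> say
  that it is a tangent vector of the fibre.\<close>

definition rigid :: "'v set \<Rightarrow> 'e set \<Rightarrow> ('e \<Rightarrow> 'v) \<Rightarrow> ('e \<Rightarrow> 'v) \<Rightarrow> ('v + 'e \<Rightarrow> complex) \<Rightarrow> bool" where
  "rigid I E s t \<eta> \<longleftrightarrow> (\<forall>\<zeta>. (\<forall>x. x \<notin> I \<longrightarrow> \<zeta> (Inl x) = 0) \<and> (\<forall>e. e \<notin> E \<longrightarrow> \<zeta> (Inr e) = 0) \<and>
     (\<forall>x\<in>I. outflow E s t \<zeta> x = 0) \<and>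
     (\<forall>e\<in>E. \<eta> (Inr e) * stretch s t \<zeta> e + \<zeta> (Inr e) * stretch s t \<eta> e = 0) \<longrightarrow>
     (\<forall>k. \<zeta> k = 0))"

lemma rigidD:
  assumes "rigid I E s t \<eta>" "\<And>x. x \<notin> I \<Longrightarrow> \<zeta> (Inl x) = 0" "\<And>e. e \<notin> E \<Longrightarrow> \<zeta> (Inr e) = 0"
    "\<And>x. x \<in> I \<Longrightarrow> outflow E s t \<zeta> x = 0"
    "\<And>e. e \<in> E \<Longrightarrow> \<eta> (Inr e) * stretch s t \<zeta> e + \<zeta> (Inr e) * stretch s t \<eta> e = 0"
  shows "\<zeta> k = 0"
  using assms unfolding rigid_def by blast

lemma outflow_add: "outflow E s t (\<lambda>k. \<eta> k + \<zeta> k) x = outflow E s t \<eta> x + outflow E s t \<zeta> x"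
  by (simp add: outflow_def sum.distrib)

lemma outflow_diff: "outflow E s t (\<lambda>k. \<eta> k - \<zeta> k) x = outflow E s t \<eta> x - outflow E s t \<zeta> x"
  by (simp add: outflow_def sum_subtractf)

lemma outflow_scale: "outflow E s t (\<lambda>k. c * \<eta> k) x = c * outflow E s t \<eta> x"
  by (simp add: outflow_def sum_distrib_left right_diff_distrib)

lemma stretch_add: "stretch s t (\<lambda>k. \<eta> k + \<zeta> k) e = stretch s t \<eta> e + stretch s t \<zeta> e"
  by (simp add: stretch_def)

lemma stretch_diff: "stretch s t (\<lambda>k. \<eta> k - \<zeta> k) e = stretch s t \<eta> e - stretch s t \<zeta> e"
  by (simp add: stretch_def)

lemma stretch_scale: "stretch s t (\<lambda>k. c * \<eta> k) e = c * stretch s t \<eta> e"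
  by (simp add: stretch_def right_diff_distrib)

text \<open>Discrete integration by parts. It turns a combination of the conservation laws over a cluster of vertices into
  a sum over edges, in which inner edges contribute their weights.\<close>

lemma sum_by_parts:
  assumes "finite I" "finite E" "\<And>x. x \<notin> I \<Longrightarrow> f x = 0"
  shows "(\<Sum>x\<in>I. f x * outflow E s t \<eta> x) = (\<Sum>e\<in>E. \<eta> (Inr e) * (f (s e) - f (t e)))"
proof -
  have *: "(\<Sum>x\<in>I. f x * (\<Sum>e\<in>{e\<in>E. g e = x}. \<eta> (Inr e))) = (\<Sum>e\<in>E. \<eta> (Inr e) * f (g e))" for g
  proof -
    have "(\<Sum>x\<in>I. f x * (\<Sum>e\<in>{e\<in>E. g e = x}. \<eta> (Inr e))) =
        (\<Sum>x\<in>I. \<Sum>e\<in>E. if g e = x then f (g e) * \<eta> (Inr e) else 0)"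
      unfolding sum.inter_filter[OF assms(2), symmetric] sum_distrib_left
      by (intro sum.cong refl) auto
    also have "\<dots> = (\<Sum>e\<in>E. \<Sum>x\<in>I. if g e = x then f (g e) * \<eta> (Inr e) else 0)"
      by (rule sum.swap)
    also have "\<dots> = (\<Sum>e\<in>E. \<eta> (Inr e) * f (g e))"
      using assms(1,3) by (intro sum.cong refl) (auto simp: mult.commute)
    finally show ?thesis .
  qed
  show ?thesis
    by (simp add: outflow_def right_diff_distrib sum_subtractf *)
qed

lemma subsequence_convergent_or_infinite:
  fixes f :: "'x \<Rightarrow> nat \<Rightarrow> complex"
  assumes "finite I"
  shows "\<exists>r. strict_mono r \<and> (\<forall>x\<in>I. convergent (\<lambda>n. f x (r n)) \<or>
    filterlim (\<lambda>n. f x (r n)) at_infinity sequentially)"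
  using assms
proof (induction I rule: finite_induct)
  case empty
  then show ?case by (auto intro: strict_mono_id[unfolded id_def])
next
  case (insert y I)
  then obtain r where r: "strict_mono r" "\<And>x. x \<in> I \<Longrightarrow> convergent (\<lambda>n. f x (r n)) \<or>
    filterlim (\<lambda>n. f x (r n)) at_infinity sequentially" by blast
  have keep: "convergent (\<lambda>n. f x (r (r' n))) \<or> filterlim (\<lambda>n. f x (r (r' n))) at_infinity sequentially"
    if "strict_mono r'" "x \<in> I" for r' x
    using r(2)[OF that(2)]
  proof
    assume "convergent (\<lambda>n. f x (r n))"
    from convergent_subseq_convergent[OF this that(1)] show ?thesis by (simp add: o_def)
  next
    assume "filterlim (\<lambda>n. f x (r n)) at_infinity sequentially"
    from filterlim_compose[OF this filterlim_subseq[OF that(1)]] show ?thesis by simp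
  qed
  show ?case
  proof (cases "filterlim (\<lambda>n. f y (r n)) at_infinity sequentially")
    case True
    with r show ?thesis by blast
  next
    case False
    then obtain B where "\<not> eventually (\<lambda>n. B \<le> norm (f y (r n))) sequentially"
      using filterlim_at_infinity[of 0 "\<lambda>n. f y (r n)" sequentially] by auto
    then have "infinite {n. norm (f y (r n)) < B}"
      unfolding eventually_sequentially infinite_nat_iff_unbounded_le
      by (auto simp: not_le)
    then obtain r1 :: "nat \<Rightarrow> nat" where r1: "strict_mono r1" "\<And>n. norm (f y (r (r1 n))) < B"
      using infinite_enumerate by blast
    have "bounded (range (\<lambda>n. f y (r (r1 n))))"
      using r1(2) by (auto intro!: boundedI[of _ B] less_imp_le)
    from bounded_imp_convergent_subsequence[OF this]
    obtain l r2 where r2: "strict_mono r2" "((\<lambda>n. f y (r (r1 n))) \<circ> r2) \<longlonglongrightarrow> l" by blast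
    have sub: "strict_mono (\<lambda>n. r1 (r2 n))" "strict_mono (\<lambda>n. r (r1 (r2 n)))"
      using r(1) r1(1) r2(1) by (auto simp: strict_mono_def)
    moreover have "convergent (\<lambda>n. f y (r (r1 (r2 n))))"
      using r2(2) by (auto simp: convergent_def o_def)
    ultimately show ?thesis using keep[OF sub(1)]
      by (intro exI[of _ "\<lambda>n. r (r1 (r2 n))"]) auto
  qed
qed

lemma ratio_at_infinity:
  fixes x y :: "nat \<Rightarrow> complex"
  assumes x: "filterlim x at_infinity sequentially" and y: "y \<longlonglongrightarrow> c"
  shows "(\<lambda>n. x n / (x n - y n)) \<longlonglongrightarrow> 1" "eventually (\<lambda>n. x n - y n \<noteq> 0) sequentially"
proof -
  have lim: "(\<lambda>n. 1 - y n / x n) \<longlonglongrightarrow> 1"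
    using tendsto_diff[OF tendsto_const[of 1] tendsto_divide_0[OF y x]] by simp
  have x0: "eventually (\<lambda>n. x n \<noteq> 0) sequentially"
    using filterlim_at_infinity_imp_eventually_ne[OF x] .
  have ne: "eventually (\<lambda>n. 1 - y n / x n \<noteq> 0) sequentially"
    using lim by (rule tendsto_imp_eventually_ne) simp
  show "eventually (\<lambda>n. x n - y n \<noteq> 0) sequentially"
    using x0 ne by eventually_elim (auto simp: field_simps)
  have "(\<lambda>n. 1 / (1 - y n / x n)) \<longlonglongrightarrow> 1 / 1"
    by (intro tendsto_divide lim) auto
  moreover have "eventually (\<lambda>n. 1 / (1 - y n / x n) = x n / (x n - y n)) sequentially"
    using x0 ne by eventually_elim (auto simp: field_simps)
  ultimately show "(\<lambda>n. x n / (x n - y n)) \<longlonglongrightarrow> 1"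
    using tendsto_cong by fastforce
qed

text \<open>Every edge starts at an interior vertex, and \<open>h x\<close> is an edge from the interior vertex \<open>x\<close> to the boundary.
  These edges make the system solvable for \<open>|I|\<close> of the flow values and enter every cluster argument at infinity.\<close>

locale network =
  fixes I :: "'v set" and E :: "'e set" and s t :: "'e \<Rightarrow> 'v" and a :: "'v \<Rightarrow> complex"
    and h :: "'v \<Rightarrow> 'e"
  assumes finite_I: "finite I" and finite_E: "finite E"
    and s_in: "e \<in> E \<Longrightarrow> s e \<in> I" and no_loop: "e \<in> E \<Longrightarrow> s e \<noteq> t e"
    and h_in: "x \<in> I \<Longrightarrow> h x \<in> E" and s_h: "x \<in> I \<Longrightarrow> s (h x) = x" and t_h: "x \<in> I \<Longrightarrow> t (h x) \<notin> I"
begin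

abbreviation "Fibre \<equiv> fibre I E s t a"

definition index :: "('v + 'e) set" where "index = I <+> E"

lemma index_iff [simp]: "Inl x \<in> index \<longleftrightarrow> x \<in> I" "Inr e \<in> index \<longleftrightarrow> e \<in> E"
  by (auto simp: index_def)

lemma finite_index: "finite index"
  by (simp add: index_def finite_I finite_E)

lemma limit_relation:
  assumes cons: "\<And>n x. x \<in> I \<Longrightarrow> outflow E s t (\<eta> n) x = 0"
    and f0: "\<And>n x. x \<notin> I \<Longrightarrow> f n x = 0"
    and lim: "\<And>e. e \<in> E \<Longrightarrow> (\<lambda>n. \<eta> n (Inr e) * (f n (s e) - f n (t e))) \<longlonglongrightarrow> (if e \<in> A then q e else 0)"
    and "A \<subseteq> E"
  shows "(\<Sum>e\<in>A. q e) = 0"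
proof -
  have "(\<lambda>n. \<Sum>e\<in>E. \<eta> n (Inr e) * (f n (s e) - f n (t e))) \<longlonglongrightarrow> (\<Sum>e\<in>E. if e \<in> A then q e else 0)"
    by (intro tendsto_sum lim)
  moreover have "(\<Sum>e\<in>E. \<eta> n (Inr e) * (f n (s e) - f n (t e))) = 0" for n
    using sum_by_parts[OF finite_I finite_E f0, where s = s and t = t and \<eta> = "\<eta> n"] cons by simp
  ultimately have "(\<Sum>e\<in>E. if e \<in> A then q e else 0) = 0"
    using LIMSEQ_unique[OF tendsto_const] by fastforce
  then show ?thesis
    using \<open>A \<subseteq> E\<close> finite_E by (simp add: sum.inter_restrict[symmetric] inf.absorb2)
qed

end

section \<open>Properness\<close>

context network
begin

text \<open>Properness of the map from solutions to weights. Pass to a subsequence along which each potential converges or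
  tends to infinity. If some set \<open>S\<close> of vertices tends to infinity, multiply the conservation law at
  \<open>x \<in> S\<close> by \<open>w\<^sub>x\<close> and add: the edges touching \<open>S\<close> contribute their weights in the limit. If
  the ends of an edge converge to the same \<open>c\<close>, use the multiplier \<open>w\<^sub>x - c\<close> on the cluster at \<open>c\<close>: only the edges inside the
  cluster survive. Both sums vanish, against the assumption on sums of weights.\<close>

lemma fibre_limit:
  assumes "F \<subseteq> E" "h ` I \<subseteq> F" "E - F \<subseteq> {e0}"
    and sums: "\<And>A. A \<subseteq> E \<Longrightarrow> A \<inter> F \<noteq> {} \<Longrightarrow> (\<Sum>e\<in>A. q0 e) \<noteq> 0"
    and q: "\<And>e. e \<in> E \<Longrightarrow> (\<lambda>n. q n e) \<longlonglongrightarrow> q0 e"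
    and \<eta>: "\<And>n. \<eta> n \<in> Fibre F (q n)"
  shows "\<exists>r \<eta>'. strict_mono r \<and> \<eta>' \<in> Fibre F q0 \<and> (\<forall>k. (\<lambda>n. \<eta> (r n) k) \<longlonglongrightarrow> \<eta>' k)"
proof -
  obtain r where r: "strict_mono r" and dich: "\<And>x. x \<in> I \<Longrightarrow> convergent (\<lambda>n. \<eta> (r n) (Inl x)) \<or>
    filterlim (\<lambda>n. \<eta> (r n) (Inl x)) at_infinity sequentially"
    using subsequence_convergent_or_infinite[OF finite_I, of "\<lambda>x n. \<eta> n (Inl x)"] by blast
  define w where "w = (\<lambda>x n. \<eta> (r n) (Inl x))"
  define p where "p = (\<lambda>e n. \<eta> (r n) (Inr e))"
  have w_off: "w x n = a x" if "x \<notin> I" for x n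
    using \<eta>[of "r n"] that by (simp add: fibre_def w_def)
  have p_off: "p e n = 0" if "e \<notin> E" for e n
    using \<eta>[of "r n"] that by (simp add: fibre_def p_def)
  have cons: "outflow E s t (\<eta> (r n)) x = 0" if "x \<in> I" for x n
    using \<eta>[of "r n"] that by (simp add: fibre_def)
  have pq: "p e n * (w (s e) n - w (t e) n) = q (r n) e" if "e \<in> E" for e n
    using \<eta>[of "r n"] that by (simp add: fibre_def w_def p_def stretch_def)
  have F_ne: "w (s e) n - w (t e) n \<noteq> 0" if "e \<in> F" for e n
    using \<eta>[of "r n"] that by (simp add: fibre_def w_def stretch_def)
  have qr: "(\<lambda>n. q (r n) e) \<longlonglongrightarrow> q0 e" if "e \<in> E" for e
    using LIMSEQ_subseq_LIMSEQ[OF q[OF that] r] by (simp add: o_def)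
  have dich': "convergent (w x)" if "\<not> filterlim (w x) at_infinity sequentially" for x
  proof (cases "x \<in> I")
    case True with dich that show ?thesis by (auto simp: w_def)
  next
    case False
    then have "w x = (\<lambda>_. a x)" using w_off by blast
    then show ?thesis by (simp add: convergent_const)
  qed
  have bounded: "\<not> filterlim (w x) at_infinity sequentially" for x
  proof
    define S where "S = {x. filterlim (w x) at_infinity sequentially}"
    assume "filterlim (w x) at_infinity sequentially"
    then have "x \<in> S" by (simp add: S_def)
    have "S \<subseteq> I"
    proof
      fix y assume "y \<in> S"
      show "y \<in> I"
      proof (rule ccontr)
        assume "y \<notin> I"
        then have "w y = (\<lambda>_. a y)" using w_off by blast
        with \<open>y \<in> S\<close> show False
          using not_tendsto_and_filterlim_at_infinity[OF sequentially_bot tendsto_const, of "a y"]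
          by (simp add: S_def)
      qed
    qed
    have conv: "\<exists>c. w y \<longlonglongrightarrow> c" if "y \<notin> S" for y
      using dich'[of y] that by (simp add: S_def convergent_def)
    \<comment> \<open>the edges whose weights survive when the conservation laws on the cluster are added\<close>
    define A where "A = {e\<in>E. s e \<in> S \<or> t e \<in> S}"
    define f where "f = (\<lambda>n x. if x \<in> S then w x n else 0)"
    have out: "(\<lambda>n. p' n * w y n) \<longlonglongrightarrow> q0 e"
      if e: "e \<in> E" and y: "y \<in> S" "z \<notin> S" and pq': "\<And>n. p' n * (w y n - w z n) = q (r n) e"
      for e y z p'
    proof -
      obtain c where c: "w z \<longlonglongrightarrow> c" using conv[OF y(2)] by blast
      have inf: "filterlim (w y) at_infinity sequentially" using y(1) by (simp add: S_def)
      note ratio = ratio_at_infinity[OF inf c]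
      have "(\<lambda>n. q (r n) e * (w y n / (w y n - w z n))) \<longlonglongrightarrow> q0 e * 1"
        by (intro tendsto_mult qr e ratio(1))
      moreover have "eventually (\<lambda>n. q (r n) e * (w y n / (w y n - w z n)) = p' n * w y n) sequentially"
        using ratio(2) by eventually_elim (simp add: pq'[symmetric])
      ultimately show ?thesis using tendsto_cong by fastforce
    qed
    have "(\<Sum>e\<in>A. q0 e) = 0"
    proof (rule limit_relation[where \<eta> = "\<lambda>n. \<eta> (r n)" and f = f])
      show "outflow E s t (\<eta> (r n)) x = 0" if "x \<in> I" for n x by (rule cons[OF that])
      show "f n x = 0" if "x \<notin> I" for n x using that \<open>S \<subseteq> I\<close> by (auto simp: f_def)
      show "A \<subseteq> E" by (auto simp: A_def)
      fix e assume e: "e \<in> E"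
      have "(\<lambda>n. p e n * (f n (s e) - f n (t e))) \<longlonglongrightarrow> (if e \<in> A then q0 e else 0)"
      proof (cases "s e \<in> S"; cases "t e \<in> S")
        assume "s e \<in> S" "t e \<in> S"
        then show ?thesis using e qr[OF e] by (simp add: f_def A_def pq)
      next
        assume st: "s e \<in> S" "t e \<notin> S"
        then show ?thesis using e out[OF e st pq[OF e]] by (simp add: f_def A_def)
      next
        assume st: "s e \<notin> S" "t e \<in> S"
        have "- p e n * (w (t e) n - w (s e) n) = q (r n) e" for n
          using pq[OF e, of n] by (simp add: algebra_simps)
        from out[OF e st(2,1), of "\<lambda>n. - p e n", OF this]
        show ?thesis using e st by (simp add: f_def A_def)
      next
        assume "s e \<notin> S" "t e \<notin> S"
        then show ?thesis by (simp add: f_def A_def)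
      qed
      then show "(\<lambda>n. \<eta> (r n) (Inr e) * (f n (s e) - f n (t e))) \<longlonglongrightarrow> (if e \<in> A then q0 e else 0)"
        by (simp add: p_def)
    qed
    moreover have "x \<in> I" using \<open>x \<in> S\<close> \<open>S \<subseteq> I\<close> by blast
    then have "h x \<in> A \<inter> F"
      using \<open>x \<in> S\<close> h_in s_h assms(2) by (auto simp: A_def)
    ultimately show False using sums[of A] by (auto simp: A_def)
  qed
  define l where "l = (\<lambda>x. lim (w x))"
  have wl: "w x \<longlonglongrightarrow> l x" for x
    using dich'[OF bounded] by (simp add: l_def convergent_LIMSEQ_iff)
  have l_off: "l x = a x" if "x \<notin> I" for x
  proof -
    have "w x = (\<lambda>_. a x)" using w_off[OF that] by blast
    then show ?thesis using LIMSEQ_unique[OF wl[of x]] tendsto_const by metis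
  qed
  have l_ne: "l (s e) \<noteq> l (t e)" if "e \<in> F" for e
  proof
    assume eq: "l (s e) = l (t e)"
    define c where "c = l (s e)"
    \<comment> \<open>boundary vertices in the cluster have multiplier 0, consistently with their potential being equal to c\<close>
    define T where "T = {x. l x = c}"
    define A where "A = {e\<in>E. s e \<in> T \<and> t e \<in> T}"
    define f where "f = (\<lambda>n x. if x \<in> T then w x n - c else 0)"
    have f_lim: "(\<lambda>n. f n x) \<longlonglongrightarrow> 0" for x
      using tendsto_diff[OF wl[of x] tendsto_const[of c]] by (cases "l x = c") (simp_all add: f_def T_def)
    have "(\<Sum>e\<in>A. q0 e) = 0"
    proof (rule limit_relation[where \<eta> = "\<lambda>n. \<eta> (r n)" and f = f])
      show "outflow E s t (\<eta> (r n)) x = 0" if "x \<in> I" for n x by (rule cons[OF that])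
      show "f n x = 0" if "x \<notin> I" for n x
        using w_off[OF that] l_off[OF that] by (auto simp: f_def T_def)
      show "A \<subseteq> E" by (auto simp: A_def)
      fix e assume e: "e \<in> E"
      have "(\<lambda>n. p e n * (f n (s e) - f n (t e))) \<longlonglongrightarrow> (if e \<in> A then q0 e else 0)"
      proof (cases "s e \<in> T \<longleftrightarrow> t e \<in> T")
        case True
        then show ?thesis using e qr[OF e] pq[OF e] by (auto simp: f_def A_def)
      next
        case False
        then have "l (s e) - l (t e) \<noteq> 0" by (auto simp: T_def)
        have diff: "(\<lambda>n. w (s e) n - w (t e) n) \<longlonglongrightarrow> l (s e) - l (t e)"
          by (intro tendsto_diff wl)
        have "(\<lambda>n. q (r n) e / (w (s e) n - w (t e) n) * (f n (s e) - f n (t e)))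
            \<longlonglongrightarrow> q0 e / (l (s e) - l (t e)) * (0 - 0)"
          by (intro tendsto_mult tendsto_divide tendsto_diff wl f_lim qr e) fact
        moreover have "eventually (\<lambda>n. q (r n) e / (w (s e) n - w (t e) n) * (f n (s e) - f n (t e))
            = p e n * (f n (s e) - f n (t e))) sequentially"
          using tendsto_imp_eventually_ne[OF diff \<open>l (s e) - l (t e) \<noteq> 0\<close>]
          by eventually_elim (simp add: pq[OF e, symmetric])
        ultimately have "(\<lambda>n. p e n * (f n (s e) - f n (t e))) \<longlonglongrightarrow> 0"
          using tendsto_cong by fastforce
        then show ?thesis using False by (auto simp: A_def)
      qed
      then show "(\<lambda>n. \<eta> (r n) (Inr e) * (f n (s e) - f n (t e))) \<longlonglongrightarrow> (if e \<in> A then q0 e else 0)"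
        by (simp add: p_def)
    qed
    moreover have "e \<in> A \<inter> F"
      using that assms(1) eq by (auto simp: A_def T_def c_def)
    ultimately show False using sums[of A] by (auto simp: A_def)
  qed
  have pF: "convergent (p e)" if "e \<in> F" for e
  proof -
    have "(\<lambda>n. q (r n) e / (w (s e) n - w (t e) n)) \<longlonglongrightarrow> q0 e / (l (s e) - l (t e))"
      using l_ne[OF that] that assms(1) by (intro tendsto_divide tendsto_diff wl qr) auto
    moreover have "q (r n) e / (w (s e) n - w (t e) n) = p e n" for n
      using F_ne[OF that, of n] pq[of e n] that assms(1) by (auto simp: field_simps)
    ultimately show ?thesis by (auto simp: convergent_def)
  qed
  have pE: "convergent (p e)" for e
  proof (cases "e \<in> E - F")
    case False
    then consider "e \<in> F" | "e \<notin> E" by blast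
    then show ?thesis
    proof cases
      case 2
      then have "p e = (\<lambda>_. 0)" using p_off by blast
      then show ?thesis by (simp add: convergent_const)
    qed (rule pF)
  next
    case True
    \<comment> \<open>the flow on the exceptional edge is determined by conservation at its source\<close>
    have others: "e' \<in> F" if "e' \<in> E" "e' \<noteq> e" for e' using True that assms(3) by blast
    let ?S = "{e'\<in>E. s e' = s e} - {e}" and ?T = "{e'\<in>E. t e' = s e}"
    have "p e n = (\<Sum>e'\<in>?T. p e' n) - (\<Sum>e'\<in>?S. p e' n)" for n
    proof -
      have "(\<Sum>e'\<in>{e'\<in>E. s e' = s e}. p e' n) = p e n + (\<Sum>e'\<in>?S. p e' n)"
        using True finite_E by (intro sum.remove) auto
      then show ?thesis using cons[OF s_in[of e], of n] True by (simp add: outflow_def p_def algebra_simps)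
    qed
    then have "p e = (\<lambda>n. (\<Sum>e'\<in>?T. p e' n) - (\<Sum>e'\<in>?S. p e' n))" by blast
    moreover have "?S \<subseteq> F" "?T \<subseteq> F" using others no_loop[of e] True by force+
    then have "convergent (\<lambda>n. (\<Sum>e'\<in>?T. p e' n) - (\<Sum>e'\<in>?S. p e' n))"
      by (intro convergent_diff convergent_sum pF) blast+
    ultimately show ?thesis by simp
  qed
  define \<eta>' where "\<eta>' = (\<lambda>k. lim (\<lambda>n. \<eta> (r n) k))"
  have lim: "(\<lambda>n. \<eta> (r n) k) \<longlonglongrightarrow> \<eta>' k" for k
  proof (cases k)
    case (Inl x)
    then show ?thesis using dich'[OF bounded[of x]] by (simp add: \<eta>'_def w_def convergent_LIMSEQ_iff)
  next
    case (Inr e)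
    then show ?thesis using pE[of e] by (simp add: \<eta>'_def p_def convergent_LIMSEQ_iff)
  qed
  have "\<eta>' (Inl x) = l x" for x using LIMSEQ_unique[OF lim[of "Inl x"]] wl[of x] by (simp add: w_def)
  then have "\<eta>' (Inl x) = a x" if "x \<notin> I" for x using l_off[OF that] by simp
  moreover have "\<eta>' (Inr e) = 0" if "e \<notin> E" for e
  proof -
    have "(\<lambda>n. \<eta> (r n) (Inr e)) = (\<lambda>_. 0)" using p_off[OF that] by (simp add: p_def)
    then show ?thesis using LIMSEQ_unique[OF lim[of "Inr e"]] tendsto_const by metis
  qed
  moreover have "outflow E s t \<eta>' x = 0" if "x \<in> I" for x
  proof -
    have "(\<lambda>n. outflow E s t (\<eta> (r n)) x) \<longlonglongrightarrow> outflow E s t \<eta>' x"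
      unfolding outflow_def by (intro tendsto_intros lim)
    then have "(\<lambda>n. 0) \<longlonglongrightarrow> outflow E s t \<eta>' x" by (simp add: cons[OF that])
    from LIMSEQ_unique[OF this tendsto_const] show ?thesis .
  qed
  moreover have "\<eta>' (Inr e) * stretch s t \<eta>' e = q0 e" if "e \<in> E" for e
  proof -
    have "(\<lambda>n. \<eta> (r n) (Inr e) * stretch s t (\<eta> (r n)) e) \<longlonglongrightarrow> \<eta>' (Inr e) * stretch s t \<eta>' e"
      unfolding stretch_def by (intro tendsto_intros lim)
    moreover have "\<eta> (r n) (Inr e) * stretch s t (\<eta> (r n)) e = q (r n) e" for n
      using pq[OF that, of n] by (simp add: stretch_def p_def w_def)
    ultimately show ?thesis using LIMSEQ_unique[OF _ qr[OF that]] by simp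
  qed
  moreover have "stretch s t \<eta>' e \<noteq> 0" if "e \<in> F" for e
    using l_ne[OF that] \<open>\<And>x. \<eta>' (Inl x) = l x\<close> by (simp add: stretch_def)
  ultimately have "\<eta>' \<in> Fibre F q0" by (simp add: fibre_def)
  with r lim show ?thesis by blast
qed

end

section \<open>Local constancy of the number of solutions\<close>

context network
begin

text \<open>The square system that defines a fibre, with unknowns and equations indexed by vertices and edges, and
  below it its derivative.\<close>

definition eqs :: "('v + 'e \<Rightarrow> complex) \<Rightarrow> 'v + 'e \<Rightarrow> complex" where
  "eqs \<xi> k = (case k of Inl x \<Rightarrow> outflow E s t \<xi> x | Inr e \<Rightarrow> \<xi> (Inr e) * stretch s t \<xi> e)"

definition deqs :: "('v + 'e \<Rightarrow> complex) \<Rightarrow> ('v + 'e \<Rightarrow> complex) \<Rightarrow> 'v + 'e \<Rightarrow> complex" where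
  "deqs \<eta> \<zeta> k = (case k of Inl x \<Rightarrow> outflow E s t \<zeta> x
     | Inr e \<Rightarrow> \<eta> (Inr e) * stretch s t \<zeta> e + \<zeta> (Inr e) * stretch s t \<eta> e)"

lemma finite_linear_deqs:
  assumes "rigid I E s t \<eta>"
  shows "finite_linear index (deqs \<eta>)"
proof
  fix x y :: "'v + 'e \<Rightarrow> complex" and c j
  show "deqs \<eta> (\<lambda>k. x k + y k) j = deqs \<eta> x j + deqs \<eta> y j"
    by (simp add: deqs_def outflow_add stretch_add distrib_left distrib_right split: sum.split)
  show "deqs \<eta> (\<lambda>k. c * x k) j = c * deqs \<eta> x j"
    by (simp add: deqs_def outflow_scale stretch_scale distrib_left split: sum.split)
next
  fix \<zeta> :: "'v + 'e \<Rightarrow> complex" and k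
  assume off: "\<And>k. k \<notin> index \<Longrightarrow> \<zeta> k = 0" and zero: "\<And>k. k \<in> index \<Longrightarrow> deqs \<eta> \<zeta> k = 0"
  have "\<zeta> (Inl x) = 0" if "x \<notin> I" for x using off[of "Inl x"] that by (auto simp: index_def)
  moreover have "\<zeta> (Inr e) = 0" if "e \<notin> E" for e using off[of "Inr e"] that by (auto simp: index_def)
  moreover have "outflow E s t \<zeta> x = 0" if "x \<in> I" for x
    using zero[of "Inl x"] that by (auto simp: index_def deqs_def)
  moreover have "\<eta> (Inr e) * stretch s t \<zeta> e + \<zeta> (Inr e) * stretch s t \<eta> e = 0" if "e \<in> E" for e
    using zero[of "Inr e"] that by (auto simp: index_def deqs_def)
  ultimately show "\<zeta> k = 0" using assms unfolding rigid_def by blast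
qed (rule finite_index)

text \<open>The system is quadratic, so the error of the linearisation is bilinear in the distance of the two points from each
  other and from \<open>\<eta>\<close>.\<close>

lemma eqs_strictly_differentiable:
  assumes "\<delta> > 0"
  shows "\<exists>r>0. \<forall>\<xi>\<in>polydisc index \<eta> r. \<forall>\<xi>'\<in>polydisc index \<eta> r. \<forall>D.
      (\<forall>k\<in>index. norm (\<xi> k - \<xi>' k) \<le> D) \<longrightarrow>
      (\<forall>k\<in>index. norm (eqs \<xi> k - eqs \<xi>' k - deqs \<eta> (\<lambda>k. \<xi> k - \<xi>' k) k) \<le> \<delta> * D)"
proof -
  define r where "r = \<delta> / 4"
  have "r > 0" using assms by (simp add: r_def)
  moreover have "norm (eqs \<xi> k - eqs \<xi>' k - deqs \<eta> (\<lambda>k. \<xi> k - \<xi>' k) k) \<le> \<delta> * D"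
    if disc: "\<xi> \<in> polydisc index \<eta> r" "\<xi>' \<in> polydisc index \<eta> r"
      and D: "\<forall>k\<in>index. norm (\<xi> k - \<xi>' k) \<le> D" and k: "k \<in> index" for \<xi> \<xi>' D k
  proof -
    have "D \<ge> 0" using D k norm_ge_zero order_trans by blast
    have d: "norm (\<xi> k - \<xi>' k) \<le> D" for k
      using disc D \<open>D \<ge> 0\<close> by (cases "k \<in> index") (auto simp: polydisc_def)
    have near: "norm (\<xi>' k - \<eta> k) \<le> r" "norm (\<xi> k - \<eta> k) \<le> r" for k
      using disc \<open>r > 0\<close> by (cases "k \<in> index"; auto simp: polydisc_def)+
    show ?thesis
    proof (cases k)
      case (Inl x)
      then show ?thesis using \<open>D \<ge> 0\<close> assms by (simp add: eqs_def deqs_def outflow_diff)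
    next
      case (Inr e)
      let ?d = "\<lambda>k. \<xi> k - \<xi>' k" and ?d' = "\<lambda>k. \<xi>' k - \<eta> k"
      have stretch_le: "norm (stretch s t \<zeta> e) \<le> 2 * B" if "\<And>k. norm (\<zeta> k) \<le> B" for \<zeta> B
        using norm_triangle_ineq4[of "\<zeta> (Inl (s e))" "\<zeta> (Inl (t e))"]
          that[of "Inl (s e)"] that[of "Inl (t e)"] by (simp add: stretch_def)
      have "eqs \<xi> k - eqs \<xi>' k - deqs \<eta> ?d k =
          (\<xi> k - \<eta> k) * stretch s t ?d e + ?d k * stretch s t ?d' e"
        by (simp add: eqs_def deqs_def Inr stretch_diff algebra_simps)
      also have "norm \<dots> \<le> r * (2 * D) + D * (2 * r)"
        using near(2) d stretch_le[of ?d, OF d] stretch_le[of ?d', OF near(1)] \<open>D \<ge> 0\<close> \<open>r > 0\<close>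
        by (intro norm_triangle_le add_mono) (auto simp: norm_mult intro!: mult_mono)
      also have "\<dots> = \<delta> * D" by (simp add: r_def)
      finally show ?thesis .
    qed
  qed
  ultimately show ?thesis by blast
qed

lemma fibre_off:
  assumes "\<eta> \<in> Fibre F q" "\<xi> \<in> Fibre F' q'" "k \<notin> index"
  shows "\<xi> k = \<eta> k"
  using assms by (cases k) (simp_all add: fibre_def)

lemma fibre_iff_eqs:
  assumes "\<eta> \<in> Fibre F' q'" and "\<xi> \<in> polydisc index \<eta> r"
  shows "\<xi> \<in> Fibre F q \<longleftrightarrow> (\<forall>k\<in>index. eqs \<xi> k = (case k of Inl x \<Rightarrow> 0 | Inr e \<Rightarrow> q e)) \<and>
    (\<forall>e\<in>F. stretch s t \<xi> e \<noteq> 0)"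
proof -
  have "\<xi> k = \<eta> k" if "k \<notin> index" for k using assms(2) that by (simp add: polydisc_def)
  then have "\<xi> (Inl x) = a x" if "x \<notin> I" for x
    using assms(1) that by (simp add: fibre_def)
  moreover have "\<xi> (Inr e) = 0" if "e \<notin> E" for e
    using assms(1) that \<open>\<And>k. k \<notin> index \<Longrightarrow> \<xi> k = \<eta> k\<close> by (simp add: fibre_def)
  ultimately show ?thesis
    unfolding fibre_def index_def Plus_def by (simp add: ball_Un eqs_def)
qed

text \<open>Near a rigid point, each nearby fibre has exactly one point. The nested filters
  express that the radius \<open>r\<close> is chosen first and the bound \<open>\<epsilon>\<close> on the weights may depend on it.\<close>

lemma fibre_local_section:
  assumes "F \<subseteq> E" and \<eta>: "\<eta> \<in> Fibre F q0" and rigid: "rigid I E s t \<eta>"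
  shows "eventually (\<lambda>r. eventually (\<lambda>\<epsilon>. \<forall>q. (\<forall>e\<in>E. norm (q e - q0 e) < \<epsilon>) \<longrightarrow>
    (\<exists>!\<xi>. \<xi> \<in> Fibre F q \<inter> polydisc index \<eta> r)) (at_right 0)) (at_right 0)"
proof -
  interpret finite_linear index "deqs \<eta>" by (rule finite_linear_deqs[OF rigid])
  let ?y = "\<lambda>q k. case k of Inl x \<Rightarrow> 0 | Inr e \<Rightarrow> q e"
  define good where "good = (\<lambda>r. \<exists>\<epsilon>>0. \<forall>y. (\<forall>k\<in>index. norm (y k - eqs \<eta> k) < \<epsilon>) \<longrightarrow>
      (\<exists>!\<xi>. \<xi> \<in> polydisc index \<eta> r \<and> (\<forall>k\<in>index. eqs \<xi> k = y k)))"
  have "\<exists>r0>0. \<forall>r. 0 < r \<and> r \<le> r0 \<longrightarrow> good r"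
    unfolding good_def by (rule local_inverse[OF eqs_strictly_differentiable])
  then obtain r0 where "r0 > 0" and r0: "\<And>r. 0 < r \<Longrightarrow> r \<le> r0 \<Longrightarrow> good r" by blast
  have eqs_\<eta>: "eqs \<eta> k = ?y q0 k" if "k \<in> index" for k
    using \<eta> that by (auto simp: fibre_def eqs_def index_def)
  have "eventually (\<lambda>r. r \<le> r0) (at_right 0)"
    using eventually_at_right_less[of 0] eventually_at_right_field[of _ 0] \<open>r0 > 0\<close>
    by (metis less_imp_le)
  moreover have "eventually (\<lambda>r. 0 < r) (at_right (0::real))"
    by (rule eventually_at_right_less)
  moreover have "eventually (\<lambda>r. \<forall>e\<in>F. \<forall>\<xi>\<in>polydisc index \<eta> r. stretch s t \<xi> e \<noteq> 0) (at_right 0)"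
  proof (intro eventually_ball_finite ballI)
    show "finite F" using assms(1) finite_E finite_subset by blast
    fix e assume "e \<in> F"
    define m where "m = norm (stretch s t \<eta> e) / 2"
    have "m > 0" using \<eta> \<open>e \<in> F\<close> by (simp add: m_def fibre_def)
    have "stretch s t \<xi> e \<noteq> 0" if r: "0 < r" "r < m" and \<xi>: "\<xi> \<in> polydisc index \<eta> r" for r \<xi>
    proof
      assume "stretch s t \<xi> e = 0"
      have near: "norm (\<xi> k - \<eta> k) < m" for k
        using \<xi> r by (cases "k \<in> index") (auto simp: polydisc_def intro: le_less_trans)
      have "stretch s t \<eta> e = (\<xi> (Inl (t e)) - \<eta> (Inl (t e))) - (\<xi> (Inl (s e)) - \<eta> (Inl (s e)))"
        using \<open>stretch s t \<xi> e = 0\<close> by (simp add: stretch_def)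
      also have "norm \<dots> < 2 * m"
        using norm_triangle_ineq4[of "\<xi> (Inl (t e)) - \<eta> (Inl (t e))" "\<xi> (Inl (s e)) - \<eta> (Inl (s e))"]
          near[of "Inl (t e)"] near[of "Inl (s e)"] by linarith
      finally show False by (simp add: m_def)
    qed
    then show "eventually (\<lambda>r. \<forall>\<xi>\<in>polydisc index \<eta> r. stretch s t \<xi> e \<noteq> 0) (at_right 0)"
      using \<open>m > 0\<close> unfolding eventually_at_right_field by blast
  qed
  ultimately show ?thesis
  proof eventually_elim
    case (elim r)
    then have "good r" using r0 by blast
    then obtain \<epsilon>0 where \<epsilon>0: "\<epsilon>0 > 0" and ex1: "\<forall>y. (\<forall>k\<in>index. norm (y k - eqs \<eta> k) < \<epsilon>0) \<longrightarrow>
      (\<exists>!\<xi>. \<xi> \<in> polydisc index \<eta> r \<and> (\<forall>k\<in>index. eqs \<xi> k = y k))"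
      unfolding good_def by (elim exE conjE)
    have "\<exists>!\<xi>. \<xi> \<in> Fibre F q \<inter> polydisc index \<eta> r"
      if "\<epsilon> < \<epsilon>0" and q: "\<forall>e\<in>E. norm (q e - q0 e) < \<epsilon>" for \<epsilon> q
    proof -
      have "norm (?y q k - eqs \<eta> k) < \<epsilon>0" if "k \<in> index" for k
        unfolding eqs_\<eta>[OF that] using q that \<open>\<epsilon> < \<epsilon>0\<close> \<epsilon>0 by (force simp: index_def)
      then have "\<exists>!\<xi>. \<xi> \<in> polydisc index \<eta> r \<and> (\<forall>k\<in>index. eqs \<xi> k = ?y q k)"
        using ex1[rule_format, of "?y q"] by blast
      moreover have "\<xi> \<in> Fibre F q \<inter> polydisc index \<eta> r \<longleftrightarrow>
          \<xi> \<in> polydisc index \<eta> r \<and> (\<forall>k\<in>index. eqs \<xi> k = ?y q k)" for \<xi>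
        using fibre_iff_eqs[OF \<eta>, of \<xi> r F q] elim by blast
      ultimately show ?thesis by simp
    qed
    then show ?case
      using \<epsilon>0 unfolding eventually_at_right_field by blast
  qed
qed

lemma fibre_eventually_in_polydisc:
  assumes "\<And>n. g n \<in> Fibre F (q n)" "\<eta> \<in> Fibre F q'" "\<And>k. (\<lambda>n. g n k) \<longlonglongrightarrow> \<eta> k" "r > 0"
  shows "eventually (\<lambda>n. g n \<in> polydisc index \<eta> r) sequentially"
proof -
  have "eventually (\<lambda>n. \<forall>k\<in>index. norm (g n k - \<eta> k) < r) sequentially"
    using tendstoD[OF assms(3) assms(4)]
    by (intro eventually_ball_finite finite_index) (auto simp: dist_norm)
  then show ?thesis
    by eventually_elim
      (use fibre_off[OF assms(2) assms(1)] in \<open>auto simp: polydisc_def less_imp_le\<close>)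
qed

text \<open>The local sections through the points of the fibre over \<open>q0\<close> give distinct points of nearby fibres, and properness
  shows that there are no others. Properness also makes the fibre over \<open>q0\<close> finite, because an
  accumulation point would contradict local uniqueness.\<close>

lemma fibre_locally_constant:
  assumes F: "F \<subseteq> E" "h ` I \<subseteq> F" "E - F \<subseteq> {e0}"
    and sums: "\<And>A. A \<subseteq> E \<Longrightarrow> A \<inter> F \<noteq> {} \<Longrightarrow> (\<Sum>e\<in>A. q0 e) \<noteq> 0"
    and rigid: "\<And>\<eta>. \<eta> \<in> Fibre F q0 \<Longrightarrow> rigid I E s t \<eta>"
  shows "finite (Fibre F q0) \<and> (\<exists>\<epsilon>>0. \<forall>q. (\<forall>e\<in>E. norm (q e - q0 e) < \<epsilon>) \<longrightarrow>
    finite (Fibre F q) \<and> card (Fibre F q) = card (Fibre F q0))"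
proof
  let ?near = "\<lambda>\<epsilon> q. \<forall>e\<in>E. norm (q e - q0 e) < \<epsilon>"
  note limit = fibre_limit[OF F sums]
  note sect = fibre_local_section[OF F(1) _ rigid]
  show fin: "finite (Fibre F q0)"
  proof (rule ccontr)
    assume "infinite (Fibre F q0)"
    then obtain f :: "nat \<Rightarrow> _" where f: "inj f" "range f \<subseteq> Fibre F q0"
      using infinite_countable_subset by blast
    then obtain r \<eta> where r: "strict_mono r" and \<eta>: "\<eta> \<in> Fibre F q0" "\<And>k. (\<lambda>n. f (r n) k) \<longlonglongrightarrow> \<eta> k"
      using limit[of "\<lambda>_. q0" f] by blast
    have "eventually (\<lambda>\<rho>. \<rho> > 0 \<and> (\<exists>\<epsilon>>0. \<forall>q. ?near \<epsilon> q \<longrightarrow>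
        (\<exists>!\<xi>. \<xi> \<in> Fibre F q \<inter> polydisc index \<eta> \<rho>))) (at_right 0)"
      using sect[OF \<eta>(1) \<eta>(1)] eventually_at_right_less[of 0]
    proof eventually_elim
      case (elim \<rho>)
      have "eventually (\<lambda>\<epsilon>. \<epsilon> > 0 \<and> (\<forall>q. ?near \<epsilon> q \<longrightarrow>
          (\<exists>!\<xi>. \<xi> \<in> Fibre F q \<inter> polydisc index \<eta> \<rho>))) (at_right 0)"
        using elim(1) eventually_at_right_less[of 0] by eventually_elim blast
      from eventually_happens'[OF trivial_limit_at_right_real this] elim(2) show ?case by blast
    qed
    from eventually_happens'[OF trivial_limit_at_right_real this]
    obtain \<rho> \<epsilon> where \<rho>: "\<rho> > 0" "\<epsilon> > 0"
      and uniq: "\<And>q. ?near \<epsilon> q \<Longrightarrow> \<exists>!\<xi>. \<xi> \<in> Fibre F q \<inter> polydisc index \<eta> \<rho>" by blast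
    have "eventually (\<lambda>n. f (r n) \<in> polydisc index \<eta> \<rho>) sequentially"
      using f(2) \<rho>(1) by (intro fibre_eventually_in_polydisc[where F=F and q="\<lambda>_. q0" and q'=q0] \<eta>) auto
    then obtain n where "f (r n) \<in> polydisc index \<eta> \<rho>" "f (r (Suc n)) \<in> polydisc index \<eta> \<rho>"
      unfolding eventually_sequentially using le_Suc_eq by blast
    moreover have "f m \<in> Fibre F q0" for m using f(2) by blast
    ultimately have "f (r n) = f (r (Suc n))" using uniq[of q0] \<rho>(2) by auto
    then show False using f(1) r strict_mono_Suc_iff by (metis injD less_irrefl)
  qed
  have "eventually (\<lambda>r. \<forall>\<eta>\<in>Fibre F q0. eventually (\<lambda>\<epsilon>. \<forall>q. ?near \<epsilon> q \<longrightarrow>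
    (\<exists>!\<xi>. \<xi> \<in> Fibre F q \<inter> polydisc index \<eta> r)) (at_right 0)) (at_right 0)"
    using sect by (intro eventually_ball_finite fin) blast
  moreover have "eventually (\<lambda>r. \<forall>\<eta>\<in>Fibre F q0. \<forall>\<eta>'\<in>Fibre F q0. \<eta> \<noteq> \<eta>' \<longrightarrow>
      polydisc index \<eta> r \<inter> polydisc index \<eta>' r = {}) (at_right 0)"
  proof (intro eventually_ball_finite fin ballI)
    fix \<eta> \<eta>' assume \<eta>: "\<eta> \<in> Fibre F q0" "\<eta>' \<in> Fibre F q0"
    show "eventually (\<lambda>r. \<eta> \<noteq> \<eta>' \<longrightarrow> polydisc index \<eta> r \<inter> polydisc index \<eta>' r = {}) (at_right 0)"
    proof (cases "\<eta> = \<eta>'")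
      case False
      then obtain k where k: "\<eta> k \<noteq> \<eta>' k" by blast
      then have "k \<in> index" using fibre_off \<eta> by metis
      have "polydisc index \<eta> r \<inter> polydisc index \<eta>' r = {}" if "r < norm (\<eta> k - \<eta>' k) / 2" for r
      proof (rule ccontr)
        assume "\<not> ?thesis"
        then obtain \<xi> where \<xi>: "norm (\<xi> k - \<eta> k) \<le> r" "norm (\<xi> k - \<eta>' k) \<le> r"
          using \<open>k \<in> index\<close> by (auto simp: polydisc_def)
        have "norm (\<eta> k - \<eta>' k) \<le> norm (\<xi> k - \<eta>' k) + norm (\<xi> k - \<eta> k)"
          using norm_triangle_ineq4[of "\<xi> k - \<eta>' k" "\<xi> k - \<eta> k"] by simp
        with \<xi> that show False by simp
      qed
      moreover have "norm (\<eta> k - \<eta>' k) / 2 > 0" using k by simp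
      ultimately show ?thesis unfolding eventually_at_right_field by blast
    qed simp
  qed
  ultimately have "eventually (\<lambda>r. r > 0 \<and> (\<forall>\<eta>\<in>Fibre F q0. eventually (\<lambda>\<epsilon>. \<forall>q. ?near \<epsilon> q \<longrightarrow>
    (\<exists>!\<xi>. \<xi> \<in> Fibre F q \<inter> polydisc index \<eta> r)) (at_right 0)) \<and>
    (\<forall>\<eta>\<in>Fibre F q0. \<forall>\<eta>'\<in>Fibre F q0. \<eta> \<noteq> \<eta>' \<longrightarrow>
      polydisc index \<eta> r \<inter> polydisc index \<eta>' r = {})) (at_right 0)"
    using eventually_at_right_less[of 0] by eventually_elim blast
  from eventually_happens'[OF trivial_limit_at_right_real this]
  obtain r where "r > 0" and sec: "\<forall>\<eta>\<in>Fibre F q0. eventually (\<lambda>\<epsilon>. \<forall>q. ?near \<epsilon> q \<longrightarrow>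
    (\<exists>!\<xi>. \<xi> \<in> Fibre F q \<inter> polydisc index \<eta> r)) (at_right 0)"
    and disj: "\<forall>\<eta>\<in>Fibre F q0. \<forall>\<eta>'\<in>Fibre F q0. \<eta> \<noteq> \<eta>' \<longrightarrow>
      polydisc index \<eta> r \<inter> polydisc index \<eta>' r = {}" by (elim exE conjE)
  have "eventually (\<lambda>\<epsilon>. \<forall>\<eta>\<in>Fibre F q0. \<forall>q. ?near \<epsilon> q \<longrightarrow>
    (\<exists>!\<xi>. \<xi> \<in> Fibre F q \<inter> polydisc index \<eta> r)) (at_right 0)"
    using sec by (intro eventually_ball_finite fin)
  moreover have "eventually (\<lambda>\<epsilon>. \<forall>q. ?near \<epsilon> q \<longrightarrow>
      (\<forall>\<xi>\<in>Fibre F q. \<exists>\<eta>\<in>Fibre F q0. \<xi> \<in> polydisc index \<eta> r)) (at_right 0)"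
  proof (rule ccontr)
    assume not_ev: "\<not> ?thesis"
    have bad: "\<exists>q \<xi>. ?near (1 / real (Suc n)) q \<and> \<xi> \<in> Fibre F q \<and> (\<forall>\<eta>\<in>Fibre F q0. \<xi> \<notin> polydisc index \<eta> r)" for n
    proof (rule ccontr)
      assume no: "\<not> ?thesis"
      have "\<exists>\<eta>\<in>Fibre F q0. \<xi> \<in> polydisc index \<eta> r"
        if "\<epsilon> < 1 / real (Suc n)" "?near \<epsilon> q" "\<xi> \<in> Fibre F q" for \<epsilon> q \<xi>
        using no that by (meson less_trans)
      moreover have "(0::real) < 1 / real (Suc n)" by simp
      ultimately show False using not_ev unfolding eventually_at_right_field by blast
    qed
    have "\<forall>n. \<exists>z. ?near (1 / real (Suc n)) (fst z) \<and> snd z \<in> Fibre F (fst z) \<and>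
        (\<forall>\<eta>\<in>Fibre F q0. snd z \<notin> polydisc index \<eta> r)"
    proof
      fix n
      from bad[of n] obtain q \<xi> where "?near (1 / real (Suc n)) q \<and> \<xi> \<in> Fibre F q \<and>
          (\<forall>\<eta>\<in>Fibre F q0. \<xi> \<notin> polydisc index \<eta> r)" by (elim exE)
      then show "\<exists>z. ?near (1 / real (Suc n)) (fst z) \<and> snd z \<in> Fibre F (fst z) \<and>
          (\<forall>\<eta>\<in>Fibre F q0. snd z \<notin> polydisc index \<eta> r)"
        by (intro exI[of _ "(q, \<xi>)"]) simp
    qed
    from choice[OF this] obtain z where z: "\<forall>n. ?near (1 / real (Suc n)) (fst (z n)) \<and>
        snd (z n) \<in> Fibre F (fst (z n)) \<and> (\<forall>\<eta>\<in>Fibre F q0. snd (z n) \<notin> polydisc index \<eta> r)"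
      by (rule exE)
    define q \<xi> where "q = (\<lambda>n. fst (z n))" and "\<xi> = (\<lambda>n. snd (z n))"
    have q: "?near (1 / real (Suc n)) (q n)" and \<xi>: "\<xi> n \<in> Fibre F (q n)"
      and out: "\<eta> \<in> Fibre F q0 \<Longrightarrow> \<xi> n \<notin> polydisc index \<eta> r" for n \<eta>
      using z by (simp_all add: q_def \<xi>_def)
    have "(\<lambda>n. q n e) \<longlonglongrightarrow> q0 e" if "e \<in> E" for e
    proof (rule LIM_zero_cancel, rule Lim_null_comparison[OF always_eventually])
      show "\<forall>n. norm (q n e - q0 e) \<le> 1 / real (Suc n)" using q that less_imp_le by blast
      show "(\<lambda>n. 1 / real (Suc n)) \<longlonglongrightarrow> 0"
        by (simp only: inverse_eq_divide[symmetric] LIMSEQ_inverse_real_of_nat)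
    qed
    from limit[OF _ _ this \<xi>] obtain \<rho> \<eta> where \<rho>: "strict_mono \<rho>"
      and \<eta>: "\<eta> \<in> Fibre F q0" "\<And>k. (\<lambda>n. \<xi> (\<rho> n) k) \<longlonglongrightarrow> \<eta> k" by blast
    have "eventually (\<lambda>n. \<xi> (\<rho> n) \<in> polydisc index \<eta> r) sequentially"
      using \<xi> \<open>r > 0\<close> by (intro fibre_eventually_in_polydisc[where F=F and q="\<lambda>n. q (\<rho> n)" and q'=q0] \<eta>)
    then show False using out[OF \<eta>(1)] by simp
  qed
  ultimately have "eventually (\<lambda>\<epsilon>. \<epsilon> > 0 \<and> (\<forall>q. ?near \<epsilon> q \<longrightarrow>
      finite (Fibre F q) \<and> card (Fibre F q) = card (Fibre F q0))) (at_right 0)"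
    using eventually_at_right_less[of 0]
  proof eventually_elim
    case (elim \<epsilon>)
    have "finite (Fibre F q) \<and> card (Fibre F q) = card (Fibre F q0)" if "?near \<epsilon> q" for q
    proof -
      have ex1: "\<And>\<eta>. \<eta> \<in> Fibre F q0 \<Longrightarrow> \<exists>!\<xi>. \<xi> \<in> Fibre F q \<inter> polydisc index \<eta> r"
        and cover: "\<And>\<xi>. \<xi> \<in> Fibre F q \<Longrightarrow> \<exists>\<eta>\<in>Fibre F q0. \<xi> \<in> polydisc index \<eta> r"
        using elim that by blast+
      define g where "g = (\<lambda>\<eta>. THE \<xi>. \<xi> \<in> Fibre F q \<inter> polydisc index \<eta> r)"
      have g: "g \<eta> \<in> Fibre F q \<inter> polydisc index \<eta> r" if "\<eta> \<in> Fibre F q0" for \<eta>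
        using theI'[OF ex1[OF that]] by (simp add: g_def)
      have "bij_betw g (Fibre F q0) (Fibre F q)"
      proof (rule bij_betw_imageI)
        show "inj_on g (Fibre F q0)"
        proof (rule inj_onI, rule ccontr)
          fix \<eta> \<eta>' assume "\<eta> \<in> Fibre F q0" "\<eta>' \<in> Fibre F q0" "g \<eta> = g \<eta>'" "\<eta> \<noteq> \<eta>'"
          then have "polydisc index \<eta> r \<inter> polydisc index \<eta>' r = {}" using disj by blast
          then show False using g[OF \<open>\<eta> \<in> Fibre F q0\<close>] g[OF \<open>\<eta>' \<in> Fibre F q0\<close>] \<open>g \<eta> = g \<eta>'\<close> by auto
        qed
        show "g ` Fibre F q0 = Fibre F q"
        proof
          show "g ` Fibre F q0 \<subseteq> Fibre F q" using g by blast
          show "Fibre F q \<subseteq> g ` Fibre F q0"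
          proof
            fix \<xi> assume \<xi>: "\<xi> \<in> Fibre F q"
            then obtain \<eta> where \<eta>: "\<eta> \<in> Fibre F q0" "\<xi> \<in> polydisc index \<eta> r" using cover by blast
            then have "\<xi> = g \<eta>" using ex1[OF \<eta>(1)] g[OF \<eta>(1)] \<xi> by blast
            then show "\<xi> \<in> g ` Fibre F q0" using \<eta>(1) by blast
          qed
        qed
      qed
      then show ?thesis using fin bij_betw_finite bij_betw_same_card by metis
    qed
    then show ?case using elim by blast
  qed
  from eventually_happens'[OF trivial_limit_at_right_real this]
  show "\<exists>\<epsilon>>0. \<forall>q. ?near \<epsilon> q \<longrightarrow> finite (Fibre F q) \<and> card (Fibre F q) = card (Fibre F q0)" by blast
qed

end

section \<open>Generic counts\<close>

context network
begin

text \<open>Free coordinates on the space of pairs with conserved flow: the potentials, and the flows on the edges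
  other than the chosen ones to the boundary.\<close>

definition params :: "('v + 'e) set" where "params = I <+> (E - h ` I)"

text \<open>The projection to pairs with conserved flow that keeps the free coordinates. Edges of the form \<open>h x\<close>
  occur in no conservation law except the one at \<open>x\<close>, so these laws can be solved for them independently.\<close>

definition complete :: "('v + 'e \<Rightarrow> complex) \<Rightarrow> 'v + 'e \<Rightarrow> complex" where
  "complete \<xi> k = (case k of
     Inl x \<Rightarrow> if x \<in> I then \<xi> k else a x
   | Inr e \<Rightarrow> if e \<notin> E then 0
       else if e = h (s e) then
         (\<Sum>e'\<in>{e'\<in>E. t e' = s e}. \<xi> (Inr e')) - (\<Sum>e'\<in>{e'\<in>E. s e' = s e} - {e}. \<xi> (Inr e'))
       else \<xi> k)"

lemma finite_params: "finite params"
  by (simp add: params_def finite_I finite_E)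

lemma card_params: "card params = card E"
proof -
  have "inj_on h I" using s_h by (metis inj_onI)
  moreover have "h ` I \<subseteq> E" using h_in by blast
  ultimately show ?thesis
    using card_mono[OF finite_E \<open>h ` I \<subseteq> E\<close>] finite_I finite_E
    by (simp add: params_def card_Plus card_Diff_subset card_image finite_subset)
qed

lemma not_h: "e \<in> E \<Longrightarrow> e \<noteq> h (s e) \<Longrightarrow> e \<in> E - h ` I"
  using s_h by auto

lemma complete_polyfuns: "(\<lambda>\<xi>. complete \<xi> k) \<in> polyfuns params"
proof (cases k)
  case (Inl x)
  then show ?thesis
    by (cases "x \<in> I") (auto simp: complete_def params_def intro: polyfuns.intros)
next
  case (Inr e)
  have coord: "(\<lambda>\<xi>. \<xi> (Inr e')) \<in> polyfuns params" if "e' \<in> E" "e' \<noteq> h (s e')" for e'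
    using not_h[OF that] by (intro polyfuns.coord) (auto simp: params_def)
  have "(\<lambda>\<xi>. (\<Sum>e'\<in>{e'\<in>E. t e' = s e}. \<xi> (Inr e')) - (\<Sum>e'\<in>{e'\<in>E. s e' = s e} - {e}. \<xi> (Inr e')))
      \<in> polyfuns params" if "e \<in> E" "e = h (s e)"
  proof (intro polyfuns_diff polyfuns_sum coord)
    fix e' assume "e' \<in> {e'\<in>E. t e' = s e}"
    then show "e' \<in> E" "e' \<noteq> h (s e')" using s_in[OF that(1)] s_in[of e'] t_h[of "s e'"] by auto
  next
    fix e' assume "e' \<in> {e'\<in>E. s e' = s e} - {e}"
    then show "e' \<in> E" "e' \<noteq> h (s e')" using that by auto
  qed
  then show ?thesis using Inr coord
    by (cases "e \<in> E"; cases "e = h (s e)") (auto simp: complete_def intro: polyfuns.const)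
qed

lemma complete_eq:
  assumes "\<And>x. x \<notin> I \<Longrightarrow> \<eta> (Inl x) = a x" "\<And>e. e \<notin> E \<Longrightarrow> \<eta> (Inr e) = 0"
    "\<And>x. x \<in> I \<Longrightarrow> outflow E s t \<eta> x = 0"
  shows "complete \<eta> = \<eta>"
proof
  fix k
  show "complete \<eta> k = \<eta> k"
  proof (cases k)
    case (Inl x)
    then show ?thesis using assms(1) by (simp add: complete_def)
  next
    case (Inr e)
    have "(\<Sum>e'\<in>{e'\<in>E. t e' = s e}. \<eta> (Inr e')) - (\<Sum>e'\<in>{e'\<in>E. s e' = s e} - {e}. \<eta> (Inr e')) = \<eta> (Inr e)"
      if "e \<in> E"
    proof -
      have remove: "(\<Sum>e'\<in>{e'\<in>E. s e' = s e}. \<eta> (Inr e')) =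
          \<eta> (Inr e) + (\<Sum>e'\<in>{e'\<in>E. s e' = s e} - {e}. \<eta> (Inr e'))"
        using that finite_E by (intro sum.remove) auto
      have balance: "(\<Sum>e'\<in>{e'\<in>E. s e' = s e}. \<eta> (Inr e')) = (\<Sum>e'\<in>{e'\<in>E. t e' = s e}. \<eta> (Inr e'))"
        using assms(3)[OF s_in[OF that]] by (simp add: outflow_def)
      show ?thesis unfolding balance[symmetric] remove by (rule add_diff_cancel_right')
    qed
    then show ?thesis using Inr assms(2) by (simp add: complete_def)
  qed
qed

text \<open>The map to weights in the free coordinates. It is polynomial, and by \<open>card_params\<close> source and target have
  the same dimension.\<close>

definition weight :: "'e \<Rightarrow> ('v + 'e \<Rightarrow> complex) \<Rightarrow> complex" where
  "weight e \<xi> = complete \<xi> (Inr e) * stretch s t (complete \<xi>) e"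

lemma weight_polyfuns: "weight e \<in> polyfuns params"
  unfolding weight_def[abs_def] stretch_def
  by (intro polyfuns.mult polyfuns_diff complete_polyfuns)

lemma weight_fibre:
  assumes "R \<in> polyfuns E" "\<eta> \<in> Fibre F q"
  shows "R (\<lambda>e. weight e \<eta>) = R q"
proof (rule polyfuns_cong[OF assms(1)])
  have "complete \<eta> = \<eta>" using assms(2) by (intro complete_eq) (auto simp: fibre_def)
  then show "weight e \<eta> = q e" if "e \<in> E" for e
    using assms(2) that by (simp add: weight_def fibre_def)
qed

lemma generic_fibre_avoids:
  assumes "D \<in> polyfuns params" "D \<xi>0 \<noteq> 0"
  shows "\<exists>R\<in>polyfuns E. (\<exists>y. R y \<noteq> 0) \<and> (\<forall>q F \<eta>. R q \<noteq> 0 \<longrightarrow> \<eta> \<in> Fibre F q \<longrightarrow> D \<eta> \<noteq> 0)"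
proof -
  obtain R where R: "R \<in> polyfuns E" "\<exists>y. R y \<noteq> 0" "\<And>\<xi>. R (\<lambda>e. weight e \<xi>) \<noteq> 0 \<Longrightarrow> D \<xi> \<noteq> 0"
    using image_of_hypersurface[of params E weight D \<xi>0] finite_params finite_E card_params
      weight_polyfuns assms by auto
  have "D \<eta> \<noteq> 0" if "R q \<noteq> 0" "\<eta> \<in> Fibre F q" for q F \<eta>
    using R(3)[of \<eta>] weight_fibre[OF R(1) that(2)] that(1) by simp
  with R(1,2) show ?thesis by blast
qed

text \<open>Along a tangent vector all weights are stationary, hence so are, over generic weights, all potentials.
  The flow is then stationary too, as the potential differences are nonzero.\<close>

lemma generic_rigid:
  "\<exists>R\<in>polyfuns E. (\<exists>y. R y \<noteq> 0) \<and> (\<forall>q \<eta>. R q \<noteq> 0 \<longrightarrow> \<eta> \<in> Fibre E q \<longrightarrow> rigid I E s t \<eta>)"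
proof -
  have "\<forall>x\<in>I. \<exists>R\<in>polyfuns E. (\<exists>y. R y \<noteq> 0) \<and>
    (\<forall>\<xi> v \<gamma>. R (\<lambda>j. weight j \<xi>) \<noteq> 0 \<longrightarrow>
       (\<forall>j\<in>E. ((\<lambda>\<sigma>. weight j (\<lambda>i. \<xi> i + \<sigma> * v i)) has_field_derivative 0) (at 0)) \<longrightarrow>
       ((\<lambda>\<sigma>. \<xi> (Inl x) + \<sigma> * v (Inl x)) has_field_derivative \<gamma>) (at 0) \<longrightarrow> \<gamma> = 0)"
  proof
    fix x assume "x \<in> I"
    then have "(\<lambda>\<xi>. \<xi> (Inl x)) \<in> polyfuns params" by (intro polyfuns.coord) (auto simp: params_def)
    from generically_unramified[of params E weight, OF finite_params finite_E _ weight_polyfuns this]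
    show "\<exists>R\<in>polyfuns E. (\<exists>y. R y \<noteq> 0) \<and>
      (\<forall>\<xi> v \<gamma>. R (\<lambda>j. weight j \<xi>) \<noteq> 0 \<longrightarrow>
       (\<forall>j\<in>E. ((\<lambda>\<sigma>. weight j (\<lambda>i. \<xi> i + \<sigma> * v i)) has_field_derivative 0) (at 0)) \<longrightarrow>
       ((\<lambda>\<sigma>. \<xi> (Inl x) + \<sigma> * v (Inl x)) has_field_derivative \<gamma>) (at 0) \<longrightarrow> \<gamma> = 0)"
      by (simp add: card_params)
  qed
  from bchoice[OF this[unfolded Bex_def]] obtain R where R: "\<forall>x\<in>I. R x \<in> polyfuns E \<and> (\<exists>y. R x y \<noteq> 0) \<and>
    (\<forall>\<xi> v \<gamma>. R x (\<lambda>j. weight j \<xi>) \<noteq> 0 \<longrightarrow>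
       (\<forall>j\<in>E. ((\<lambda>\<sigma>. weight j (\<lambda>i. \<xi> i + \<sigma> * v i)) has_field_derivative 0) (at 0)) \<longrightarrow>
       ((\<lambda>\<sigma>. \<xi> (Inl x) + \<sigma> * v (Inl x)) has_field_derivative \<gamma>) (at 0) \<longrightarrow> \<gamma> = 0)"
    by (rule exE)
  have R_poly: "R x \<in> polyfuns E" if "x \<in> I" for x
    by (rule conjunct1[OF bspec[OF R that]])
  have R_nz: "\<exists>y. R x y \<noteq> 0" if "x \<in> I" for x
    by (rule conjunct1[OF conjunct2[OF bspec[OF R that]]])
  define P where "P = (\<lambda>y. \<Prod>x\<in>I. R x y)"
  have P: "P \<in> polyfuns E" unfolding P_def by (intro polyfuns_prod R_poly)
  moreover have "\<exists>y. P y \<noteq> 0"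
    using polyfuns_common_nonzero[of I R E, OF finite_I R_poly R_nz] finite_I by (auto simp: P_def)
  moreover have "rigid I E s t \<eta>" if "P q \<noteq> 0" and \<eta>: "\<eta> \<in> Fibre E q" for q \<eta>
    unfolding rigid_def
  proof (intro allI impI, elim conjE)
    fix \<zeta> k
    assume off: "\<forall>x. x \<notin> I \<longrightarrow> \<zeta> (Inl x) = 0" "\<forall>e. e \<notin> E \<longrightarrow> \<zeta> (Inr e) = 0"
      and cons: "\<forall>x\<in>I. outflow E s t \<zeta> x = 0"
      and tan: "\<forall>e\<in>E. \<eta> (Inr e) * stretch s t \<zeta> e + \<zeta> (Inr e) * stretch s t \<eta> e = 0"
    have "complete (\<lambda>i. \<eta> i + \<sigma> * \<zeta> i) = (\<lambda>i. \<eta> i + \<sigma> * \<zeta> i)" for \<sigma>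
      using off cons \<eta> by (intro complete_eq) (auto simp: fibre_def outflow_add outflow_scale)
    then have "weight e (\<lambda>i. \<eta> i + \<sigma> * \<zeta> i) =
        (\<eta> (Inr e) + \<sigma> * \<zeta> (Inr e)) * (stretch s t \<eta> e + \<sigma> * stretch s t \<zeta> e)" for e \<sigma>
      by (simp add: weight_def stretch_add stretch_scale)
    moreover have "((\<lambda>\<sigma>. (\<eta> (Inr e) + \<sigma> * \<zeta> (Inr e)) * (stretch s t \<eta> e + \<sigma> * stretch s t \<zeta> e))
        has_field_derivative 0) (at 0)" if "e \<in> E" for e
      using tan[rule_format, OF that] by (auto intro!: derivative_eq_intros simp: algebra_simps)
    ultimately have dweight: "\<forall>j\<in>E. ((\<lambda>\<sigma>. weight j (\<lambda>i. \<eta> i + \<sigma> * \<zeta> i)) has_field_derivative 0) (at 0)"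
      by simp
    have w0: "\<zeta> (Inl x) = 0" for x
    proof (cases "x \<in> I")
      case True
      have nz: "R x (\<lambda>e. weight e \<eta>) \<noteq> 0"
        using \<open>P q \<noteq> 0\<close> finite_I True unfolding weight_fibre[OF R_poly[OF True] \<eta>] P_def by simp
      have dw: "((\<lambda>\<sigma>. \<eta> (Inl x) + \<sigma> * \<zeta> (Inl x)) has_field_derivative \<zeta> (Inl x)) (at 0)"
        by (auto intro!: derivative_eq_intros)
      show ?thesis
        by (rule bspec[OF R True, THEN conjunct2, THEN conjunct2, THEN spec, THEN spec, THEN spec,
              THEN mp, THEN mp, THEN mp, OF nz dweight dw])
    qed (use off in blast)
    then have "stretch s t \<zeta> e = 0" for e by (simp add: stretch_def)
    then have "\<zeta> (Inr e) = 0" for e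
      using off(2) tan \<eta> by (cases "e \<in> E") (auto simp: fibre_def)
    with w0 show "\<zeta> k = 0" by (cases k) auto
  qed
  ultimately show ?thesis by blast
qed

end

definition generic_count :: "'v set \<Rightarrow> 'e set \<Rightarrow> ('e \<Rightarrow> 'v) \<Rightarrow> ('e \<Rightarrow> 'v) \<Rightarrow> ('v \<Rightarrow> complex) \<Rightarrow> nat \<Rightarrow> bool" where
  "generic_count I E s t a n \<longleftrightarrow> (\<exists>R\<in>polyfuns E. (\<exists>y. R y \<noteq> 0) \<and>
     (\<forall>q. R q \<noteq> 0 \<longrightarrow> finite (fibre I E s t a E q) \<and> card (fibre I E s t a E q) = n))"

lemma generic_subset_sums:
  fixes E :: "'e set"
  assumes "finite E"
  shows "\<exists>R\<in>polyfuns E. (\<exists>y. R y \<noteq> (0::complex)) \<and>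
    (\<forall>q. R q \<noteq> 0 \<longrightarrow> (\<forall>A\<subseteq>E. A \<noteq> {} \<longrightarrow> (\<Sum>e\<in>A. q e) \<noteq> 0))"
proof -
  define R where "R = (\<lambda>q :: 'e \<Rightarrow> complex. \<Prod>A\<in>Pow E - {{}}. \<Sum>e\<in>A. q e)"
  have "R \<in> polyfuns E" unfolding R_def
    by (intro polyfuns_prod polyfuns_sum polyfuns.coord) auto
  moreover have "R (\<lambda>_. 1) \<noteq> 0"
    using assms by (auto simp: R_def card_eq_0_iff dest: finite_subset[OF _ assms])
  moreover have "(\<Sum>e\<in>A. q e) \<noteq> 0" if "R q \<noteq> 0" "A \<subseteq> E" "A \<noteq> {}" for q A
    using that assms by (auto simp: R_def)
  ultimately show ?thesis by blast
qed

text \<open>Two generic weights are joined by a complex line. The parameters of nongeneric points on it form a finite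
  set, whose complement in the complex plane is connected, and the number of solutions is locally constant there.\<close>

theorem (in network) generic_count_exists: "\<exists>n. generic_count I E s t a n"
proof -
  obtain R1 where R1: "R1 \<in> polyfuns E" "\<exists>y. R1 y \<noteq> 0"
    "\<And>q \<eta>. R1 q \<noteq> 0 \<Longrightarrow> \<eta> \<in> Fibre E q \<Longrightarrow> rigid I E s t \<eta>"
    using generic_rigid by blast
  obtain R2 :: "('e \<Rightarrow> complex) \<Rightarrow> complex" where R2: "R2 \<in> polyfuns E" "\<exists>y. R2 y \<noteq> 0"
    "\<forall>q. R2 q \<noteq> 0 \<longrightarrow> (\<forall>A\<subseteq>E. A \<noteq> {} \<longrightarrow> (\<Sum>e\<in>A. q e) \<noteq> 0)"
    using generic_subset_sums[OF finite_E] by (elim bexE conjE)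
  define R where "R = (\<lambda>q. R1 q * R2 q)"
  have R: "R \<in> polyfuns E" unfolding R_def by (intro polyfuns.mult R1 R2)
  obtain q1 where q1: "R q1 \<noteq> 0"
    using polyfuns_mult_nonzero[OF R1(1) R2(1)] R1(2) R2(2) by (auto simp: R_def)
  have local: "finite (Fibre E q0) \<and> (\<exists>\<epsilon>>0. \<forall>q. (\<forall>e\<in>E. norm (q e - q0 e) < \<epsilon>) \<longrightarrow>
      finite (Fibre E q) \<and> card (Fibre E q) = card (Fibre E q0))" if "R q0 \<noteq> 0" for q0
  proof (rule fibre_locally_constant[where ?e0.0 = undefined])
    show "h ` I \<subseteq> E" using h_in by blast
    show "(\<Sum>e\<in>A. q0 e) \<noteq> 0" if "A \<subseteq> E" "A \<inter> E \<noteq> {}" for A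
      using R2(3)[rule_format, of q0 A] that \<open>R q0 \<noteq> 0\<close> by (auto simp: R_def)
    show "rigid I E s t \<eta>" if "\<eta> \<in> Fibre E q0" for \<eta>
      using R1(3)[OF _ that] \<open>R q0 \<noteq> 0\<close> by (simp add: R_def)
  qed auto
  have "card (Fibre E q2) = card (Fibre E q1)" if q2: "R q2 \<noteq> 0" for q2
  proof -
    define q where "q = (\<lambda>\<tau> e. q1 e + \<tau> * (q2 e - q1 e))"
    have fin: "finite {\<tau>. R (q \<tau>) = 0}"
      unfolding q_def using polyfuns_segment_zeros_finite[OF R, of q1 q2] q1 by simp
    define S where "S = UNIV - {\<tau>. R (q \<tau>) = 0}"
    have "connected S"
      unfolding S_def using fin by (intro connected_open_delete_finite) auto
    have "eventually (\<lambda>\<tau>'. card (Fibre E (q \<tau>)) = card (Fibre E (q \<tau>'))) (at \<tau> within S)"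
      if "\<tau> \<in> S" for \<tau>
    proof -
      have "R (q \<tau>) \<noteq> 0" using that by (simp add: S_def)
      from local[OF this] obtain \<epsilon> where \<epsilon>: "\<epsilon> > 0"
        "\<And>q'. (\<forall>e\<in>E. norm (q' e - q \<tau> e) < \<epsilon>) \<Longrightarrow> card (Fibre E q') = card (Fibre E (q \<tau>))"
        by blast
      have "eventually (\<lambda>\<tau>'. \<forall>e\<in>E. norm (q \<tau>' e - q \<tau> e) < \<epsilon>) (at \<tau> within S)"
      proof (intro eventually_ball_finite finite_E ballI)
        fix e
        have "((\<lambda>\<tau>'. q \<tau>' e) \<longlongrightarrow> q \<tau> e) (at \<tau> within S)"
          unfolding q_def by (intro tendsto_intros)
        from tendstoD[OF this \<epsilon>(1)]
        show "eventually (\<lambda>\<tau>'. norm (q \<tau>' e - q \<tau> e) < \<epsilon>) (at \<tau> within S)"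
          by (simp add: dist_norm)
      qed
      then show ?thesis by eventually_elim (simp add: \<epsilon>(2))
    qed
    then have "card (Fibre E (q 0)) = card (Fibre E (q 1))"
      using q1 q2 \<open>connected S\<close>
      by (intro connected_local_const[where A = S and f = "\<lambda>\<tau>. card (Fibre E (q \<tau>))"])
        (auto simp: S_def q_def)
    then show ?thesis by (simp add: q_def)
  qed
  then show ?thesis
    unfolding generic_count_def using R q1 local by blast
qed

section \<open>Deletion and contraction\<close>

lemma outflow_cong:
  assumes "\<And>e. e \<in> E \<Longrightarrow> \<eta> (Inr e) = \<zeta> (Inr e)"
  shows "outflow E s t \<eta> x = outflow E s t \<zeta> x"
  unfolding outflow_def using assms by (intro arg_cong2[where f="(-)"] sum.cong) auto

lemma outflow_remove:
  assumes "finite E" "e0 \<in> E"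
  shows "outflow E s t \<eta> x = outflow (E - {e0}) s t \<eta> x
    + (if x = s e0 then \<eta> (Inr e0) else 0) - (if x = t e0 then \<eta> (Inr e0) else 0)"
proof -
  have *: "(\<Sum>e\<in>{e\<in>E. g e = x}. \<eta> (Inr e)) =
      (\<Sum>e\<in>{e\<in>E - {e0}. g e = x}. \<eta> (Inr e)) + (if x = g e0 then \<eta> (Inr e0) else 0)"
    for g :: "_ \<Rightarrow> _"
  proof (cases "x = g e0")
    case True
    have "{e\<in>E - {e0}. g e = x} = {e\<in>E. g e = x} - {e0}" by auto
    then show ?thesis
      using True assms sum.remove[of "{e\<in>E. g e = x}" e0 "\<lambda>e. \<eta> (Inr e)"] by (simp add: add.commute)
  next
    case False
    then have "{e\<in>E - {e0}. g e = x} = {e\<in>E. g e = x}" by auto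
    then show ?thesis using False by simp
  qed
  show ?thesis unfolding outflow_def *[of s] *[of t] by simp
qed

text \<open>Conservation at the merged vertex is the sum of the laws at the two vertices that are identified.\<close>

lemma outflow_merge:
  assumes "finite E" "u \<noteq> v"
  defines "\<rho> \<equiv> \<lambda>y. if y = v then u else y"
  shows "outflow E (\<lambda>e. \<rho> (s e)) (\<lambda>e. \<rho> (t e)) \<eta> u = outflow E s t \<eta> u + outflow E s t \<eta> v"
    and "x \<noteq> u \<Longrightarrow> x \<noteq> v \<Longrightarrow> outflow E (\<lambda>e. \<rho> (s e)) (\<lambda>e. \<rho> (t e)) \<eta> x = outflow E s t \<eta> x"
proof -
  have "(\<Sum>e\<in>{e\<in>E. \<rho> (g e) = u}. \<eta> (Inr e)) =
      (\<Sum>e\<in>{e\<in>E. g e = u}. \<eta> (Inr e)) + (\<Sum>e\<in>{e\<in>E. g e = v}. \<eta> (Inr e))" for g :: "_ \<Rightarrow> _"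
  proof -
    have "{e\<in>E. \<rho> (g e) = u} = {e\<in>E. g e = u} \<union> {e\<in>E. g e = v}" by (auto simp: \<rho>_def)
    then show ?thesis using assms(1,2) by (simp add: sum.union_disjoint disjoint_iff)
  qed
  then show "outflow E (\<lambda>e. \<rho> (s e)) (\<lambda>e. \<rho> (t e)) \<eta> u = outflow E s t \<eta> u + outflow E s t \<eta> v"
    by (simp add: outflow_def)
  assume "x \<noteq> u" "x \<noteq> v"
  then have "{e\<in>E. \<rho> (g e) = x} = {e\<in>E. g e = x}" for g :: "_ \<Rightarrow> _" by (auto simp: \<rho>_def)
  then show "outflow E (\<lambda>e. \<rho> (s e)) (\<lambda>e. \<rho> (t e)) \<eta> x = outflow E s t \<eta> x"
    by (simp add: outflow_def)
qed

text \<open>Contraction of \<open>e0\<close> keeps the name \<open>u\<close> and redirects all ends at \<open>v\<close> to \<open>u\<close>. Parallel edges that arise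
  are kept, so that the edge set is the same as for deletion.\<close>

locale contractible_network = network I E s t a h
  for I :: "'v set" and E :: "'e set" and s t :: "'e \<Rightarrow> 'v" and a :: "'v \<Rightarrow> complex"
    and h :: "'v \<Rightarrow> 'e" +
  fixes e0 :: 'e and u v :: 'v
  assumes e0: "e0 \<in> E" "s e0 = u" "t e0 = v" and v_in: "v \<in> I"
    and no_parallel: "e \<in> E \<Longrightarrow> e \<noteq> e0 \<Longrightarrow> {s e, t e} \<noteq> {u, v}"
begin

lemma u_in: "u \<in> I" and u_ne_v: "u \<noteq> v"
  using s_in[OF e0(1)] no_loop[OF e0(1)] e0 by auto

abbreviation "E1 \<equiv> E - {e0}"
definition "\<rho> = (\<lambda>y. if y = v then u else y)"
abbreviation "s2 \<equiv> \<lambda>e. \<rho> (s e)"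
abbreviation "t2 \<equiv> \<lambda>e. \<rho> (t e)"
abbreviation "I2 \<equiv> I - {v}"

lemma e0_not_h: "x \<in> I \<Longrightarrow> h x \<noteq> e0"
  using t_h[of x] e0 v_in by auto

sublocale deleted: network I E1 s t a h
  using finite_I finite_E s_in no_loop h_in s_h t_h e0_not_h by unfold_locales auto

sublocale contracted: network I2 E1 s2 t2 a h
proof
  show "s2 e \<in> I2" if "e \<in> E1" for e
    using s_in[of e] that u_in u_ne_v by (auto simp: \<rho>_def)
  show "s2 e \<noteq> t2 e" if "e \<in> E1" for e
    using no_loop[of e] no_parallel[of e] that by (auto simp: \<rho>_def)
  show "s2 (h x) = x" "t2 (h x) \<notin> I2" "h x \<in> E1" if "x \<in> I2" for x
    using s_h[of x] t_h[of x] h_in[of x] e0_not_h[of x] that v_in by (auto simp: \<rho>_def)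
qed (use finite_I finite_E in auto)

text \<open>The passage from a pair with equal potentials at \<open>u\<close> and \<open>v\<close> to the contracted network, and back. The
  vertex \<open>v\<close> and the edge \<open>e0\<close> are absent from the contracted network, where a fibre prescribes the value
  \<open>a v\<close> at \<open>v\<close> and a tangent vector the value \<open>0\<close>, which is why \<open>c\<close> is a parameter; on the way back the flow through \<open>e0\<close> is what conservation at \<open>v\<close> demands.\<close>

definition collapse :: "complex \<Rightarrow> ('v + 'e \<Rightarrow> complex) \<Rightarrow> 'v + 'e \<Rightarrow> complex" where
  "collapse c \<eta> k = (if k = Inl v then c else if k = Inr e0 then 0 else \<eta> k)"

definition expand :: "('v + 'e \<Rightarrow> complex) \<Rightarrow> 'v + 'e \<Rightarrow> complex" where
  "expand \<eta> k = (if k = Inl v then \<eta> (Inl u) else if k = Inr e0 then outflow E1 s t \<eta> v else \<eta> k)"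

lemma outflow_E: "outflow E s t \<eta> x = outflow E1 s t \<eta> x
    + (if x = u then \<eta> (Inr e0) else 0) - (if x = v then \<eta> (Inr e0) else 0)"
  using outflow_remove[OF finite_E e0(1), of s t \<eta> x] e0 by simp

lemma outflow_contracted:
  assumes "\<And>e. e \<in> E1 \<Longrightarrow> \<eta> (Inr e) = \<zeta> (Inr e)"
  shows "outflow E1 s2 t2 \<eta> u = outflow E s t \<zeta> u + outflow E s t \<zeta> v"
    and "x \<noteq> u \<Longrightarrow> x \<noteq> v \<Longrightarrow> outflow E1 s2 t2 \<eta> x = outflow E s t \<zeta> x"
proof -
  have fin: "finite E1" using finite_E by simp
  show "outflow E1 s2 t2 \<eta> u = outflow E s t \<zeta> u + outflow E s t \<zeta> v"
    using outflow_merge(1)[OF fin u_ne_v, of s t \<eta>] outflow_cong[of E1 \<eta> \<zeta> s t, OF assms] u_ne_v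
    by (simp add: \<rho>_def outflow_E)
  show "outflow E1 s2 t2 \<eta> x = outflow E s t \<zeta> x" if "x \<noteq> u" "x \<noteq> v"
    using outflow_merge(2)[OF fin u_ne_v that, of s t \<eta>] outflow_cong[of E1 \<eta> \<zeta> s t, OF assms] that
    by (simp add: \<rho>_def outflow_E)
qed

lemma stretch_collapse:
  assumes "\<eta> (Inl u) = \<eta> (Inl v)"
  shows "stretch s2 t2 (collapse c \<eta>) e = stretch s t \<eta> e"
  using assms u_ne_v by (simp add: stretch_def collapse_def \<rho>_def)

lemma deleted_fibre_eq: "{\<eta> \<in> Fibre E1 q. \<eta> (Inr e0) = 0} = deleted.Fibre E1 q" if "q e0 = 0"
proof (intro set_eqI)
  fix \<eta>
  show "\<eta> \<in> {\<eta> \<in> Fibre E1 q. \<eta> (Inr e0) = 0} \<longleftrightarrow> \<eta> \<in> deleted.Fibre E1 q"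
  proof (cases "\<eta> (Inr e0) = 0")
    case True
    then have "outflow E s t \<eta> x = outflow E1 s t \<eta> x" for x by (simp add: outflow_E)
    moreover have "(\<forall>e\<in>E. P e) \<longleftrightarrow> P e0 \<and> (\<forall>e\<in>E1. P e)" for P using e0(1) by blast
    moreover have "(\<forall>e. e \<notin> E1 \<longrightarrow> \<eta> (Inr e) = 0) \<longleftrightarrow> (\<forall>e. e \<notin> E \<longrightarrow> \<eta> (Inr e) = 0)"
      using True by auto
    ultimately show ?thesis using True that by (simp add: fibre_def)
  next
    case False
    then show ?thesis by (auto simp: fibre_def)
  qed
qed

lemma contracted_fibre_bij:
  assumes "q e0 = 0"
  shows "bij_betw (collapse (a v)) {\<eta> \<in> Fibre E1 q. stretch s t \<eta> e0 = 0} (contracted.Fibre E1 q)"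
proof (rule bij_betw_byWitness[where f' = expand])
  show "\<forall>\<eta>\<in>{\<eta> \<in> Fibre E1 q. stretch s t \<eta> e0 = 0}. expand (collapse (a v) \<eta>) = \<eta>"
  proof
    fix \<eta> assume \<eta>: "\<eta> \<in> {\<eta> \<in> Fibre E1 q. stretch s t \<eta> e0 = 0}"
    have uv: "\<eta> (Inl u) = \<eta> (Inl v)" using \<eta> e0 by (simp add: stretch_def)
    have "outflow E1 s t (collapse (a v) \<eta>) v = outflow E1 s t \<eta> v"
      by (rule outflow_cong) (simp add: collapse_def)
    also have "\<dots> = \<eta> (Inr e0)"
      using \<eta> v_in u_ne_v outflow_E[of \<eta> v] by (simp add: fibre_def)
    finally show "expand (collapse (a v) \<eta>) = \<eta>"
      using uv u_ne_v by (auto simp: expand_def collapse_def fun_eq_iff)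
  qed
  show "\<forall>\<eta>\<in>contracted.Fibre E1 q. collapse (a v) (expand \<eta>) = \<eta>"
    by (auto simp: fun_eq_iff fibre_def collapse_def expand_def)
  show "collapse (a v) ` {\<eta> \<in> Fibre E1 q. stretch s t \<eta> e0 = 0} \<subseteq> contracted.Fibre E1 q"
  proof (rule image_subsetI)
    fix \<eta> assume \<eta>: "\<eta> \<in> {\<eta> \<in> Fibre E1 q. stretch s t \<eta> e0 = 0}"
    let ?\<zeta> = "collapse (a v) \<eta>"
    have uv: "\<eta> (Inl u) = \<eta> (Inl v)" using \<eta> e0 by (simp add: stretch_def)
    have "outflow E1 s2 t2 ?\<zeta> x = 0" if "x \<in> I2" for x
      using outflow_contracted[of ?\<zeta> \<eta>] \<eta> that u_in v_in
      by (cases "x = u") (auto simp: collapse_def fibre_def)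
    moreover have "?\<zeta> (Inr e) = \<eta> (Inr e)" if "e \<in> E1" for e using that by (simp add: collapse_def)
    moreover have "stretch s2 t2 ?\<zeta> e = stretch s t \<eta> e" for e by (rule stretch_collapse[OF uv])
    moreover have "?\<zeta> (Inl x) = a x" if "x \<notin> I2" for x
      using \<eta> that by (auto simp: collapse_def fibre_def)
    moreover have "?\<zeta> (Inr e) = 0" if "e \<notin> E1" for e
      using \<eta> that by (auto simp: collapse_def fibre_def)
    ultimately show "?\<zeta> \<in> contracted.Fibre E1 q" using \<eta> by (simp add: fibre_def)
  qed
  show "expand ` contracted.Fibre E1 q \<subseteq> {\<eta> \<in> Fibre E1 q. stretch s t \<eta> e0 = 0}"
  proof (rule image_subsetI)
    fix \<eta> assume \<eta>: "\<eta> \<in> contracted.Fibre E1 q"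
    let ?\<zeta> = "expand \<eta>"
    have uv: "?\<zeta> (Inl u) = ?\<zeta> (Inl v)" using u_ne_v by (simp add: expand_def)
    then have st0: "stretch s t ?\<zeta> e0 = 0" using e0 by (simp add: stretch_def)
    have "collapse (a v) ?\<zeta> = \<eta>"
      using \<eta> by (auto simp: fun_eq_iff fibre_def collapse_def expand_def)
    then have st: "stretch s t ?\<zeta> e = stretch s2 t2 \<eta> e" for e
      using stretch_collapse[OF uv, of "a v" e] by simp
    have on_E1: "?\<zeta> (Inr e) = \<eta> (Inr e)" if "e \<in> E1" for e using that by (simp add: expand_def)
    have v0: "outflow E s t ?\<zeta> v = 0"
      using outflow_cong[of E1 ?\<zeta> \<eta> s t v, OF on_E1] u_ne_v by (simp add: outflow_E expand_def)
    have "outflow E s t ?\<zeta> x = 0" if "x \<in> I" for x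
    proof -
      consider "x = v" | "x = u" | "x \<noteq> u" "x \<noteq> v" by blast
      then show ?thesis
      proof cases
        case 2
        then show ?thesis
          using outflow_contracted(1)[of \<eta> ?\<zeta>] on_E1 \<eta> u_in u_ne_v v0 by (simp add: fibre_def)
      next
        case 3
        then show ?thesis
          using outflow_contracted(2)[of \<eta> ?\<zeta> x] on_E1 \<eta> that by (simp add: fibre_def)
      qed (use v0 in simp)
    qed
    moreover have "?\<zeta> (Inl x) = a x" if "x \<notin> I" for x
      using \<eta> that v_in by (auto simp: expand_def fibre_def)
    moreover have "?\<zeta> (Inr e) = 0" if "e \<notin> E" for e
      using \<eta> that e0(1) by (auto simp: expand_def fibre_def)
    moreover have "?\<zeta> (Inr e) * stretch s t ?\<zeta> e = q e" if "e \<in> E" for e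
    proof (cases "e = e0")
      case True then show ?thesis using st0 assms by simp
    next
      case False then show ?thesis using \<eta> that by (simp add: st on_E1 fibre_def)
    qed
    moreover have "stretch s t ?\<zeta> e \<noteq> 0" if "e \<in> E1" for e
      using \<eta> that by (simp add: st fibre_def)
    ultimately show "?\<zeta> \<in> {\<eta> \<in> Fibre E1 q. stretch s t \<eta> e0 = 0}"
      using st0 by (simp add: fibre_def)
  qed
qed

text \<open>A point with \<open>q\<^sub>e = 0\<close> inherits rigidity from the smaller network to which it belongs: in this lemma the
  tangent equation at \<open>e0\<close> forces the flow component there to vanish, in the next one it forces equal potential components
  at \<open>u\<close> and \<open>v\<close>.\<close>

lemma rigid_of_deleted:
  assumes "rigid I E1 s t \<eta>" "\<eta> (Inr e0) = 0" "stretch s t \<eta> e0 \<noteq> 0"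
  shows "rigid I E s t \<eta>"
  unfolding rigid_def
proof (intro allI impI, elim conjE)
  fix \<zeta> k
  assume off: "\<forall>x. x \<notin> I \<longrightarrow> \<zeta> (Inl x) = 0" "\<forall>e. e \<notin> E \<longrightarrow> \<zeta> (Inr e) = 0"
    and cons: "\<forall>x\<in>I. outflow E s t \<zeta> x = 0"
    and tan: "\<forall>e\<in>E. \<eta> (Inr e) * stretch s t \<zeta> e + \<zeta> (Inr e) * stretch s t \<eta> e = 0"
  have "\<zeta> (Inr e0) = 0" using bspec[OF tan e0(1)] assms(2,3) by simp
  then have "outflow E s t \<zeta> x = outflow E1 s t \<zeta> x" for x by (simp add: outflow_E)
  then have "\<forall>x\<in>I. outflow E1 s t \<zeta> x = 0" "\<forall>e. e \<notin> E1 \<longrightarrow> \<zeta> (Inr e) = 0"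
    using cons off \<open>\<zeta> (Inr e0) = 0\<close> by auto
  then show "\<zeta> k = 0"
    using assms(1) off(1) tan unfolding rigid_def by blast
qed

lemma rigid_of_contracted:
  assumes "rigid I2 E1 s2 t2 (collapse (a v) \<eta>)" "\<eta> (Inr e0) \<noteq> 0" "stretch s t \<eta> e0 = 0"
  shows "rigid I E s t \<eta>"
  unfolding rigid_def
proof (intro allI impI, elim conjE)
  fix \<zeta> k
  assume off: "\<forall>x. x \<notin> I \<longrightarrow> \<zeta> (Inl x) = 0" "\<forall>e. e \<notin> E \<longrightarrow> \<zeta> (Inr e) = 0"
    and cons: "\<forall>x\<in>I. outflow E s t \<zeta> x = 0"
    and tan: "\<forall>e\<in>E. \<eta> (Inr e) * stretch s t \<zeta> e + \<zeta> (Inr e) * stretch s t \<eta> e = 0"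
  have \<eta>_uv: "\<eta> (Inl u) = \<eta> (Inl v)" using assms(3) e0 by (simp add: stretch_def)
  have "stretch s t \<zeta> e0 = 0" using bspec[OF tan e0(1)] assms(2,3) by simp
  then have \<zeta>_uv: "\<zeta> (Inl u) = \<zeta> (Inl v)" using e0 by (simp add: stretch_def)
  let ?\<xi> = "collapse 0 \<zeta>"
  have \<xi>_cons: "outflow E1 s2 t2 ?\<xi> x = 0" if "x \<in> I2" for x
    using outflow_contracted[of ?\<xi> \<zeta>] cons that u_in v_in
    by (cases "x = u") (auto simp: collapse_def)
  have \<xi>_I2: "?\<xi> (Inl x) = 0" if "x \<notin> I2" for x using that off by (auto simp: collapse_def)
  have \<xi>_E1: "?\<xi> (Inr e) = 0" if "e \<notin> E1" for e using that off by (auto simp: collapse_def)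
  have \<xi>_tan: "collapse (a v) \<eta> (Inr e) * stretch s2 t2 ?\<xi> e
      + ?\<xi> (Inr e) * stretch s2 t2 (collapse (a v) \<eta>) e = 0" if "e \<in> E1" for e
    unfolding stretch_collapse[OF \<eta>_uv] stretch_collapse[OF \<zeta>_uv]
    using tan that by (simp add: collapse_def)
  have \<xi>: "?\<xi> k = 0" for k
    by (rule rigidD[OF assms(1) \<xi>_I2 \<xi>_E1 \<xi>_cons \<xi>_tan])
  have others: "\<zeta> k = 0" if "k \<noteq> Inl v" "k \<noteq> Inr e0" for k
    using \<xi>[of k] that by (simp add: collapse_def)
  have "\<zeta> (Inl v) = 0" using others[of "Inl u"] u_ne_v \<zeta>_uv by simp
  moreover have "\<zeta> (Inr e0) = 0"
  proof -
    have "outflow E1 s t \<zeta> v = 0" unfolding outflow_def using others by simp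
    then show ?thesis using bspec[OF cons v_in] u_ne_v by (simp add: outflow_E)
  qed
  ultimately show "\<zeta> k = 0" using others[of k] by (cases "k = Inl v \<or> k = Inr e0") auto
qed

text \<open>Choose \<open>q0\<close> generic on the other edges and \<open>0\<close> on \<open>e0\<close>. The fibre over \<open>q0\<close>, with equal potentials allowed
  at the ends of \<open>e0\<close>, is the disjoint union of the two smaller fibres and is rigid, so nearby fibres have the same
  number of points. Some nearby weight is generic for the whole network and nonzero on \<open>e0\<close>.\<close>

theorem generic_count_deletion_contraction:
  assumes "generic_count I E s t a n" "generic_count I E1 s t a n1" "generic_count I2 E1 s2 t2 a n2"
  shows "n = n1 + n2"
proof -
  have fin: "finite E1" using finite_E by simp
  obtain R where R: "R \<in> polyfuns E" "\<exists>y. R y \<noteq> 0" "\<And>q. R q \<noteq> 0 \<Longrightarrow> card (Fibre E q) = n"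
    using assms(1) unfolding generic_count_def by blast
  obtain R1 where R1: "R1 \<in> polyfuns E1" "\<exists>y. R1 y \<noteq> 0"
    "\<And>q. R1 q \<noteq> 0 \<Longrightarrow> finite (deleted.Fibre E1 q) \<and> card (deleted.Fibre E1 q) = n1"
    using assms(2) unfolding generic_count_def by blast
  obtain R2 where R2: "R2 \<in> polyfuns E1" "\<exists>y. R2 y \<noteq> 0"
    "\<And>q. R2 q \<noteq> 0 \<Longrightarrow> finite (contracted.Fibre E1 q) \<and> card (contracted.Fibre E1 q) = n2"
    using assms(3) unfolding generic_count_def by blast
  obtain R3 :: "('e \<Rightarrow> complex) \<Rightarrow> complex" where R3: "R3 \<in> polyfuns E1" "\<exists>y. R3 y \<noteq> 0"
    "\<forall>q. R3 q \<noteq> 0 \<longrightarrow> (\<forall>A\<subseteq>E1. A \<noteq> {} \<longrightarrow> (\<Sum>e\<in>A. q e) \<noteq> 0)"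
    using generic_subset_sums[OF fin] by (elim bexE conjE)
  obtain R4 where R4: "R4 \<in> polyfuns E1" "\<exists>y. R4 y \<noteq> 0"
    "\<And>q \<eta>. R4 q \<noteq> 0 \<Longrightarrow> \<eta> \<in> deleted.Fibre E1 q \<Longrightarrow> rigid I E1 s t \<eta>"
    using deleted.generic_rigid by blast
  obtain R5 where R5: "R5 \<in> polyfuns E1" "\<exists>y. R5 y \<noteq> 0"
    "\<And>q \<eta>. R5 q \<noteq> 0 \<Longrightarrow> \<eta> \<in> contracted.Fibre E1 q \<Longrightarrow> rigid I2 E1 s2 t2 \<eta>"
    using contracted.generic_rigid by blast
  \<comment> \<open>generically no solution of the deleted network has equal potentials at u and v, which keeps the two parts disjoint\<close>
  let ?D = "\<lambda>\<xi> :: 'v + 'e \<Rightarrow> complex. \<xi> (Inl u) - \<xi> (Inl v)"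
  have "?D \<in> polyfuns deleted.params"
    using u_in v_in by (intro polyfuns_diff polyfuns.coord) (auto simp: deleted.params_def)
  moreover have "?D (\<lambda>k. if k = Inl u then 1 else 0) \<noteq> 0" using u_ne_v by simp
  ultimately obtain R6 where R6: "R6 \<in> polyfuns E1" "\<exists>y. R6 y \<noteq> 0"
    "\<And>q \<eta>. R6 q \<noteq> 0 \<Longrightarrow> \<eta> \<in> deleted.Fibre E1 q \<Longrightarrow> \<eta> (Inl u) \<noteq> \<eta> (Inl v)"
    using deleted.generic_fibre_avoids[of ?D "\<lambda>k. if k = Inl u then 1 else 0"] by auto
  obtain y where y: "\<forall>P\<in>{R1, R2, R3, R4, R5, R6}. P y \<noteq> 0"
    using polyfuns_common_nonzero[of "{R1, R2, R3, R4, R5, R6}" "\<lambda>P. P" E1]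
      R1(1,2) R2(1,2) R3(1,2) R4(1,2) R5(1,2) R6(1,2) by auto
  define q0 where "q0 = y(e0 := 0)"
  have "P q0 = P y" if "P \<in> polyfuns E1" for P
    using polyfuns_cong[OF that, of q0 y] by (simp add: q0_def)
  then have "P q0 \<noteq> 0" if "P \<in> polyfuns E1" "P \<in> {R1, R2, R3, R4, R5, R6}" for P
    using y that by metis
  then have nz: "R1 q0 \<noteq> 0" "R2 q0 \<noteq> 0" "R3 q0 \<noteq> 0" "R4 q0 \<noteq> 0" "R5 q0 \<noteq> 0" "R6 q0 \<noteq> 0"
    using R1(1) R2(1) R3(1) R4(1) R5(1) R6(1) by blast+
  have q0_e0: "q0 e0 = 0" by (simp add: q0_def)
  let ?X1 = "{\<eta> \<in> Fibre E1 q0. \<eta> (Inr e0) = 0}" and ?X2 = "{\<eta> \<in> Fibre E1 q0. stretch s t \<eta> e0 = 0}"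
  have X1: "?X1 = deleted.Fibre E1 q0" by (rule deleted_fibre_eq[of q0, OF q0_e0])
  have X2: "bij_betw (collapse (a v)) ?X2 (contracted.Fibre E1 q0)"
    by (rule contracted_fibre_bij[of q0, OF q0_e0])
  have split: "Fibre E1 q0 = ?X1 \<union> ?X2"
  proof -
    have "\<eta> (Inr e0) * stretch s t \<eta> e0 = 0" if "\<eta> \<in> Fibre E1 q0" for \<eta>
      using that e0(1) q0_e0 by (simp add: fibre_def)
    then show ?thesis by auto
  qed
  have apart: "stretch s t \<eta> e0 \<noteq> 0" if "\<eta> \<in> ?X1" for \<eta>
    using R6(3)[OF nz(6)] that e0 unfolding X1 stretch_def by auto
  have "rigid I E s t \<eta>" if "\<eta> \<in> Fibre E1 q0" for \<eta>
  proof (cases "\<eta> \<in> ?X1")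
    case True
    then show ?thesis using R4(3)[OF nz(4), of \<eta>] apart[OF True] X1 by (intro rigid_of_deleted) auto
  next
    case False
    then have "\<eta> \<in> ?X2" "\<eta> (Inr e0) \<noteq> 0" using that split by auto
    moreover have "collapse (a v) \<eta> \<in> contracted.Fibre E1 q0"
      using X2 \<open>\<eta> \<in> ?X2\<close> by (rule bij_betwE[THEN bspec])
    ultimately show ?thesis using R5(3)[OF nz(5)] by (intro rigid_of_contracted) auto
  qed
  moreover have "(\<Sum>e\<in>A. q0 e) \<noteq> 0" if "A \<subseteq> E" "A \<inter> E1 \<noteq> {}" for A
  proof -
    have "(\<Sum>e\<in>A \<inter> E1. q0 e) = (\<Sum>e\<in>A. q0 e)"
      using that(1) finite_E finite_subset q0_e0 by (intro sum.mono_neutral_left) auto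
    then show ?thesis using R3(3)[rule_format, OF nz(3), of "A \<inter> E1"] that(2) by auto
  qed
  moreover have "h ` I \<subseteq> E1" using h_in e0_not_h by auto
  ultimately obtain \<epsilon> where \<epsilon>: "\<epsilon> > 0" "\<And>q. (\<forall>e\<in>E. norm (q e - q0 e) < \<epsilon>) \<Longrightarrow>
      card (Fibre E1 q) = card (Fibre E1 q0)"
    using fibre_locally_constant[of E1 e0 q0] by blast
  have "card (?X1 \<union> ?X2) = card ?X1 + card ?X2"
  proof (rule card_Un_disjoint)
    show "finite ?X1" unfolding X1 using R1(3)[OF nz(1)] by blast
    show "finite ?X2" using R2(3)[OF nz(2)] X2 bij_betw_finite by blast
    show "?X1 \<inter> ?X2 = {}" using apart by blast
  qed
  also have "\<dots> = n1 + n2"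
    using R1(3)[OF nz(1)] R2(3)[OF nz(2)] bij_betw_same_card[OF X2] X1 by simp
  finally have count: "card (Fibre E1 q0) = n1 + n2" using split by simp
  have "(\<lambda>q. R q * q e0) \<in> polyfuns E" using R(1) e0(1) by (intro polyfuns.intros)
  moreover obtain y' where "R y' * y' e0 \<noteq> 0"
    using polyfuns_mult_nonzero[OF R(1) polyfuns.coord[OF e0(1)], of _ "\<lambda>_. 1"] R(2) by auto
  ultimately obtain q where q: "R q * q e0 \<noteq> 0" "\<forall>e\<in>E. norm (q e - q0 e) < \<epsilon>"
    using polyfuns_nonzero_nearby[of "\<lambda>q. R q * q e0" E y' \<epsilon> q0] finite_E \<epsilon>(1) by blast
  have "stretch s t \<eta> e0 \<noteq> 0" if "\<eta> \<in> Fibre E1 q" for \<eta>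
    using that q(1) e0(1) by (auto simp: fibre_def)
  then have "Fibre E1 q = Fibre E q" unfolding fibre_def by blast
  then show ?thesis using R(3)[of q] q \<epsilon>(2)[of q] count by simp
qed

end

section \<open>From networks back to graphs\<close>

text \<open>Two generic properties hold simultaneously somewhere on the line through a witness for each, because
  each can fail only finitely often on it.\<close>

lemma generically_meet:
  assumes "generically I X P" "generically I X Q"
    and line: "\<And>x y t. x \<in> X \<Longrightarrow> y \<in> X \<Longrightarrow> (\<lambda>i. x i + t * (y i - x i)) \<in> X"
  shows "\<exists>q. P q \<and> Q q"
proof -
  have witness: "\<exists>f\<in>polyfuns I. \<exists>x\<in>X. f x \<noteq> 0 \<and> (\<forall>q\<in>X. f q \<noteq> 0 \<longrightarrow> P q)"
    if gen: "generically I X P" for P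
  proof -
    obtain F where F: "F \<subseteq> polyfuns I" "X - {q \<in> X. \<forall>f\<in>F. f q = 0} \<noteq> {}"
      "\<And>q. q \<in> X - {q \<in> X. \<forall>f\<in>F. f q = 0} \<Longrightarrow> P q"
      using gen unfolding generically_def zariski_open_in_def polynomial_functions_eq by blast
    then obtain x f where "x \<in> X" "f \<in> F" "f x \<noteq> 0" by blast
    with F show ?thesis by blast
  qed
  obtain f x where f: "f \<in> polyfuns I" "x \<in> X" "f x \<noteq> 0" "\<And>q. q \<in> X \<Longrightarrow> f q \<noteq> 0 \<Longrightarrow> P q"
    using witness[OF assms(1)] by blast
  obtain g y where g: "g \<in> polyfuns I" "y \<in> X" "g y \<noteq> 0" "\<And>q. q \<in> X \<Longrightarrow> g q \<noteq> 0 \<Longrightarrow> Q q"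
    using witness[OF assms(2)] by blast
  let ?l = "\<lambda>t i. x i + t * (y i - x i)"
  have "finite ({t. f (?l t) = 0} \<union> {t. g (?l t) = 0})"
    using polyfuns_segment_zeros_finite[OF f(1)] polyfuns_segment_zeros_finite[OF g(1)] f(3) g(3)
    by blast
  then obtain t where "t \<notin> {t. f (?l t) = 0} \<union> {t. g (?l t) = 0}"
    using ex_new_if_finite[OF infinite_UNIV_char_0] by blast
  then show ?thesis using f(4)[OF line] g(4)[OF line] f(2) g(2) by blast
qed

lemma balanced_weights_line:
  assumes "x \<in> balanced_weights V E B" "y \<in> balanced_weights V E B"
  shows "(\<lambda>i. x i + t * (y i - x i)) \<in> balanced_weights V E B"
proof -
  have "(\<Sum>v\<in>nbrs E u. x {u, v} + t * (y {u, v} - x {u, v})) = 0" if "u \<in> V - B" for u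
    using assms that
    by (simp add: balanced_weights_def sum.distrib sum_distrib_left[symmetric] sum_subtractf)
  then show ?thesis using assms by (simp add: balanced_weights_def)
qed

lemma generic_number_unique:
  assumes "generic_number V E B b m" "generic_number V E B b n"
  shows "m = n"
proof -
  have "\<exists>q. (finite (solutions V E B b q) \<and> card (solutions V E B b q) = m) \<and>
      (finite (solutions V E B b q) \<and> card (solutions V E B b q) = n)"
    by (rule generically_meet[OF assms[unfolded generic_number_def] balanced_weights_line])
  then show ?thesis by (elim exE conjE) simp
qed

lemma polyfuns_Re_Im:
  fixes f :: "('i \<Rightarrow> complex) \<Rightarrow> complex"
  assumes "f \<in> polyfuns I"
  shows "(\<lambda>q. Re (f (\<lambda>i. of_real (q i)))) \<in> polyfuns I \<and> (\<lambda>q. Im (f (\<lambda>i. of_real (q i)))) \<in> polyfuns I"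
  using assms by induction (auto intro!: polyfuns_intros)

text \<open>A complex polynomial condition restricts to a real Zariski open condition, given by the real and
  imaginary parts.\<close>

lemma generically_of_complex:
  fixes T :: "('i \<Rightarrow> complex) \<Rightarrow> complex"
  assumes "T \<in> polyfuns I" "q0 \<in> X" "T (\<lambda>i. of_real (q0 i)) \<noteq> 0"
    and "\<And>q. q \<in> X \<Longrightarrow> T (\<lambda>i. of_real (q i)) \<noteq> 0 \<Longrightarrow> P q"
  shows "generically I X P"
proof -
  let ?F = "{\<lambda>q. Re (T (\<lambda>i. of_real (q i))), \<lambda>q. Im (T (\<lambda>i. of_real (q i)))}"
  have sub: "?F \<subseteq> polynomial_functions I"
    unfolding polynomial_functions_eq using polyfuns_Re_Im[OF assms(1)] by blast
  have eq: "X - {q \<in> X. \<forall>f\<in>?F. f q = 0} = {q \<in> X. T (\<lambda>i. of_real (q i)) \<noteq> 0}"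
    by (auto simp: complex_eq_iff)
  have "zariski_open_in I X {q \<in> X. T (\<lambda>i. of_real (q i)) \<noteq> 0}"
    unfolding zariski_open_in_def by (intro exI[of _ ?F] conjI sub eq[symmetric])
  moreover have "{q \<in> X. T (\<lambda>i. of_real (q i)) \<noteq> 0} \<noteq> {}"
    using assms(2,3) by blast
  ultimately show ?thesis unfolding generically_def using assms(4)
    by (intro exI[of _ "{q \<in> X. T (\<lambda>i. of_real (q i)) \<noteq> 0}"]) simp
qed

text \<open>A graph \<open>G\<close> and a network that covers it after the boundary vertex \<open>o'\<close> has been moved to infinity. Several
  edges of the network may lie over one edge of the graph; this occurs for a contracted graph.\<close>

locale graph_network = network I E s t a h
  for I :: "'v set" and E :: "'e set" and s t :: "'e \<Rightarrow> 'v" and a :: "'v \<Rightarrow> complex"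
    and h :: "'v \<Rightarrow> 'e" +
  fixes V B :: "'v set" and G :: "'v set set" and b :: "'v \<Rightarrow> complex" and o' :: 'v
  assumes I_eq: "I = V - B" and B_sub: "B \<subseteq> V" and G_sub: "\<epsilon> \<in> G \<Longrightarrow> \<epsilon> \<subseteq> V"
    and o_in: "o' \<in> B" and b_ne: "y \<in> B \<Longrightarrow> y \<noteq> o' \<Longrightarrow> b y \<noteq> b o'"
    and a_eq: "y \<in> B \<Longrightarrow> a y = inverse (b y - b o')"
    and ends: "(\<lambda>e. {s e, t e}) ` E = {\<epsilon> \<in> G. o' \<notin> \<epsilon>}"
    and at_o: "\<epsilon> \<in> G \<Longrightarrow> o' \<in> \<epsilon> \<Longrightarrow> \<exists>x\<in>I. \<epsilon> = {x, o'}" and star: "x \<in> I \<Longrightarrow> {x, o'} \<in> G"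
begin

definition "G' = {\<epsilon> \<in> G. o' \<notin> \<epsilon>}"

lemma o_notin: "o' \<notin> I" using o_in I_eq by blast

lemma ends_G': "e \<in> E \<Longrightarrow> {s e, t e} \<in> G'" using ends by (auto simp: G'_def)

lemma G'_ends:
  assumes "\<epsilon> \<in> G'"
  shows "\<exists>e\<in>E. {s e, t e} = \<epsilon>"
proof -
  have "\<epsilon> \<in> (\<lambda>e. {s e, t e}) ` E" using assms by (simp only: ends G'_def)
  then obtain e where "\<epsilon> = {s e, t e}" "e \<in> E" by (rule imageE)
  then show ?thesis by (intro bexI[of _ e]) simp_all
qed

lemma nbrs_G:
  assumes "x \<in> I"
  shows "nbrs G x = insert o' (nbrs G' x)" "o' \<notin> nbrs G' x"
  using assms star o_notin by (auto simp: nbrs_def G'_def)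

lemma finite_nbrs: "finite (nbrs G' x)"
proof -
  have "nbrs G' x \<subseteq> s ` E \<union> t ` E"
    using G'_ends by (fastforce simp: nbrs_def doubleton_eq_iff)
  then show ?thesis using finite_E finite_subset by blast
qed

lemma nbrs_G'_cases:
  assumes "y \<in> nbrs G' x"
  shows "y \<in> V - {o'} \<and> y \<noteq> x"
proof -
  have "{x, y} \<in> G'" using assms by (simp add: nbrs_def)
  then obtain e where "e \<in> E" "{s e, t e} = {x, y}" using G'_ends by blast
  then have "y \<noteq> x" using no_loop[of e] by (auto simp: doubleton_eq_iff)
  then show ?thesis using \<open>{x, y} \<in> G'\<close> G_sub[of "{x, y}"] by (auto simp: G'_def)
qed

text \<open>The Moebius change of coordinates. Balance at \<open>x\<close> eliminates the weight of the edge to \<open>o'\<close>.\<close>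

lemma moebius_equation:
  fixes q :: "'v set \<Rightarrow> complex"
  assumes x: "x \<in> I" and bal: "(\<Sum>y\<in>nbrs G x. q {x, y}) = 0"
    and z: "\<And>y. y \<in> V - {o'} \<Longrightarrow> z y = z o' + inverse (w y)"
    and w0: "\<And>y. y \<in> V - {o'} \<Longrightarrow> w y \<noteq> 0"
    and ne: "\<And>y. y \<in> nbrs G' x \<Longrightarrow> w x \<noteq> w y"
  shows "(\<Sum>y\<in>nbrs G x. q {x, y} / (z x - z y)) = - (w x)\<^sup>2 * (\<Sum>y\<in>nbrs G' x. q {x, y} / (w x - w y))"
proof -
  have xV: "x \<in> V - {o'}" using x o_notin I_eq by blast
  have qo: "q {x, o'} = - (\<Sum>y\<in>nbrs G' x. q {x, y})"
    using bal nbrs_G[OF x] finite_nbrs by (simp add: eq_neg_iff_add_eq_0)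
  have "(\<Sum>y\<in>nbrs G x. q {x, y} / (z x - z y)) =
      q {x, o'} * w x + (\<Sum>y\<in>nbrs G' x. q {x, y} / (z x - z y))"
    using nbrs_G[OF x] finite_nbrs z[OF xV] by (simp add: divide_inverse)
  also have "\<dots> = (\<Sum>y\<in>nbrs G' x. q {x, y} / (z x - z y) - q {x, y} * w x)"
    by (simp add: qo sum_subtractf sum_distrib_right)
  also have "\<dots> = (\<Sum>y\<in>nbrs G' x. - (w x)\<^sup>2 * (q {x, y} / (w x - w y)))"
  proof (rule sum.cong[OF refl])
    fix y assume y: "y \<in> nbrs G' x"
    have yV: "y \<in> V - {o'}" using nbrs_G'_cases[OF y] by blast
    have z_diff: "z x - z y = (w y - w x) / (w x * w y)"
      using w0[OF xV] w0[OF yV] by (simp add: z[OF xV] z[OF yV] field_simps)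
    show "q {x, y} / (z x - z y) - q {x, y} * w x = - (w x)\<^sup>2 * (q {x, y} / (w x - w y))"
      unfolding z_diff using ne[OF y] w0[OF xV] w0[OF yV]
      by (simp add: divide_simps power2_eq_square) (simp add: algebra_simps)
  qed
  finally show ?thesis by (simp add: sum_distrib_left)
qed

text \<open>Edges of the network over the same edge of the graph have the same potential difference, so only their
  total weight matters.\<close>

lemma outflow_equation:
  fixes q :: "'v set \<Rightarrow> complex" and q' :: "'e \<Rightarrow> complex"
  assumes q': "\<And>\<epsilon>. \<epsilon> \<in> G' \<Longrightarrow> (\<Sum>e\<in>{e\<in>E. {s e, t e} = \<epsilon>}. q' e) = q \<epsilon>"
    and \<eta>: "\<And>e. e \<in> E \<Longrightarrow> \<eta> (Inr e) = q' e / (w (s e) - w (t e))"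
  shows "outflow E s t \<eta> x = (\<Sum>y\<in>nbrs G' x. q {x, y} / (w x - w y))"
proof -
  let ?N = "nbrs G' x"
  let ?S = "\<lambda>y. {e\<in>{e\<in>E. s e = x}. t e = y}" and ?T = "\<lambda>y. {e\<in>{e\<in>E. t e = x}. s e = y}"
  have "(\<Sum>y\<in>?N. q {x, y} / (w x - w y)) =
      (\<Sum>y\<in>?N. (\<Sum>e\<in>?S y. \<eta> (Inr e)) - (\<Sum>e\<in>?T y. \<eta> (Inr e)))"
  proof (rule sum.cong[OF refl])
    fix y assume y: "y \<in> ?N"
    have "x \<noteq> y" using nbrs_G'_cases[OF y] by blast
    have "{e\<in>E. {s e, t e} = {x, y}} = ?S y \<union> ?T y"
      by (auto simp: doubleton_eq_iff)
    moreover have "?S y \<inter> ?T y = {}" using \<open>x \<noteq> y\<close> by auto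
    ultimately have "q {x, y} = (\<Sum>e\<in>?S y. q' e) + (\<Sum>e\<in>?T y. q' e)"
      using q'[of "{x, y}"] y finite_E by (simp add: nbrs_def sum.union_disjoint)
    moreover have "(\<Sum>e\<in>?S y. \<eta> (Inr e)) = (\<Sum>e\<in>?S y. q' e) / (w x - w y)"
      unfolding sum_divide_distrib using \<eta> by (intro sum.cong) auto
    moreover have "(\<Sum>e\<in>?T y. \<eta> (Inr e)) = - (\<Sum>e\<in>?T y. q' e) / (w x - w y)"
      unfolding sum_negf[symmetric] sum_divide_distrib using \<eta>
      by (intro sum.cong refl) (auto simp: minus_divide_right)
    ultimately show "q {x, y} / (w x - w y) = (\<Sum>e\<in>?S y. \<eta> (Inr e)) - (\<Sum>e\<in>?T y. \<eta> (Inr e))"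
      by (simp add: add_divide_distrib)
  qed
  also have "\<dots> = outflow E s t \<eta> x"
  proof -
    have "t ` {e\<in>E. s e = x} \<subseteq> ?N" "s ` {e\<in>E. t e = x} \<subseteq> ?N"
      using ends_G' by (auto simp: nbrs_def insert_commute)
    then show ?thesis
      using finite_E finite_nbrs unfolding sum_subtractf outflow_def
      by (intro arg_cong2[where f = "(-)"] sum.group) auto
  qed
  finally show ?thesis by simp
qed

text \<open>The two directions of the correspondence between fibres and solutions on the graph.\<close>

definition potential :: "('v + 'e \<Rightarrow> complex) \<Rightarrow> 'v \<Rightarrow> complex" where
  "potential \<eta> x = (if x \<in> V then if x \<in> B then b x else b o' + inverse (\<eta> (Inl x)) else undefined)"

definition flow :: "('e \<Rightarrow> complex) \<Rightarrow> ('v \<Rightarrow> complex) \<Rightarrow> 'v + 'e \<Rightarrow> complex" where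
  "flow q' z k = (let w = \<lambda>x. if x \<in> I then inverse (z x - b o') else a x in
     case k of Inl x \<Rightarrow> w x | Inr e \<Rightarrow> if e \<in> E then q' e / (w (s e) - w (t e)) else 0)"

text \<open>A solution on the graph is finite at every vertex, which corresponds to the potential \<open>w\<close> being nonzero at
  interior vertices.\<close>

lemma solutions_bij:
  assumes q: "q \<in> balanced_weights V G B"
    and q': "\<And>\<epsilon>. \<epsilon> \<in> G' \<Longrightarrow> (\<Sum>e\<in>{e\<in>E. {s e, t e} = \<epsilon>}. q' e) = of_real (q \<epsilon>)"
    and nz: "\<And>\<eta> x. \<eta> \<in> Fibre E q' \<Longrightarrow> x \<in> I \<Longrightarrow> \<eta> (Inl x) \<noteq> 0"
  shows "bij_betw potential (Fibre E q') (solutions V G B b q)"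
proof (rule bij_betw_byWitness[where f' = "flow q'"])
  have bal: "(\<Sum>y\<in>nbrs G x. complex_of_real (q {x, y})) = 0" if "x \<in> I" for x
    using q that unfolding balanced_weights_def I_eq of_real_sum[symmetric] by simp
  have I_iff: "x \<in> I \<longleftrightarrow> x \<in> V \<and> x \<notin> B" for x using I_eq by blast
  have V_cases: "x \<in> I \<or> x \<in> B" if "x \<in> V" for x using that I_eq by blast
  show "\<forall>\<eta>\<in>Fibre E q'. flow q' (potential \<eta>) = \<eta>"
  proof
    fix \<eta> assume \<eta>: "\<eta> \<in> Fibre E q'"
    have w: "(if x \<in> I then inverse (potential \<eta> x - b o') else a x) = \<eta> (Inl x)" for x
      using \<eta> I_eq by (auto simp: potential_def fibre_def)
    show "flow q' (potential \<eta>) = \<eta>"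
    proof
      fix k show "flow q' (potential \<eta>) k = \<eta> k"
      proof (cases k)
        case (Inr e)
        show ?thesis
        proof (cases "e \<in> E")
          case True
          then have "\<eta> (Inr e) * stretch s t \<eta> e = q' e" "stretch s t \<eta> e \<noteq> 0"
            using \<eta> by (auto simp: fibre_def)
          then show ?thesis using True Inr
            unfolding flow_def Let_def w by (simp add: stretch_def field_simps)
        qed (use \<eta> Inr in \<open>simp add: flow_def fibre_def\<close>)
      qed (simp add: flow_def w)
    qed
  qed
  show "\<forall>z\<in>solutions V G B b q. potential (flow q' z) = z"
  proof
    fix z assume z: "z \<in> solutions V G B b q"
    show "potential (flow q' z) = z"
    proof
      fix x
      have "z x = undefined" if "x \<notin> V" using z that by (auto simp: solutions_def extensional_def)
      moreover have "z x = b x" if "x \<in> B" using z that by (auto simp: solutions_def)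
      ultimately show "potential (flow q' z) x = z x"
        using V_cases[of x] I_iff by (auto simp: potential_def flow_def Let_def)
    qed
  qed
  show "potential ` Fibre E q' \<subseteq> solutions V G B b q"
  proof (rule image_subsetI)
    fix \<eta> assume \<eta>: "\<eta> \<in> Fibre E q'"
    let ?z = "potential \<eta>" and ?w = "\<lambda>x. \<eta> (Inl x)"
    have zo: "?z o' = b o'" using o_in B_sub by (auto simp: potential_def)
    have z_eq: "?z y = ?z o' + inverse (?w y)" if "y \<in> V - {o'}" for y
    proof (cases "y \<in> B")
      case True
      then have "?w y = a y" using \<eta> I_eq by (simp add: fibre_def)
      then show ?thesis using True that a_eq[OF True] zo by (simp add: potential_def)
    next
      case False then show ?thesis using that zo by (simp add: potential_def)
    qed
    have w0: "?w y \<noteq> 0" if "y \<in> V - {o'}" for y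
    proof (cases "y \<in> B")
      case True
      then have "?w y = a y" using \<eta> I_eq by (simp add: fibre_def)
      then show ?thesis using True that a_eq[OF True] b_ne[OF True] by simp
    next
      case False then show ?thesis using nz[OF \<eta>] that I_eq by blast
    qed
    have w_ne: "?w x \<noteq> ?w y" if "{x, y} \<in> G'" for x y
      using G'_ends[OF that] \<eta> by (auto simp: fibre_def stretch_def doubleton_eq_iff)
    have "?z x \<noteq> ?z y" if "{x, y} \<in> G" for x y
    proof (cases "o' \<in> {x, y}")
      case True
      have oI: "?z x' \<noteq> ?z o'" if "x' \<in> I" for x'
      proof -
        have "x' \<in> V - {o'}" using that I_eq o_notin by blast
        then show ?thesis using z_eq w0 by simp
      qed
      obtain x' where "x' \<in> I" "{x, y} = {x', o'}" using at_o[OF \<open>{x, y} \<in> G\<close> True] by blast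
      then show ?thesis using oI[of x'] by (auto simp: doubleton_eq_iff)
    next
      case False
      then have "{x, y} \<in> G'" using that by (simp add: G'_def)
      moreover have "x \<in> V - {o'}" "y \<in> V - {o'}" using G_sub[OF that] False by auto
      ultimately show ?thesis using z_eq w_ne by simp
    qed
    moreover have "(\<Sum>y\<in>nbrs G x. complex_of_real (q {x, y}) / (?z x - ?z y)) = 0" if x: "x \<in> V - B" for x
    proof -
      have xI: "x \<in> I" using x I_eq by simp
      have "\<eta> (Inr e) = q' e / (?w (s e) - ?w (t e))" if "e \<in> E" for e
      proof -
        have "\<eta> (Inr e) * stretch s t \<eta> e = q' e" "stretch s t \<eta> e \<noteq> 0"
          using \<eta> that by (auto simp: fibre_def)
        then show ?thesis by (simp add: stretch_def field_simps)
      qed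
      from outflow_equation[of q' "\<lambda>\<epsilon>. of_real (q \<epsilon>)" \<eta> ?w x, OF q' this]
      have "(\<Sum>y\<in>nbrs G' x. complex_of_real (q {x, y}) / (?w x - ?w y)) = 0"
        using \<eta> xI by (simp add: fibre_def)
      moreover have "?w x \<noteq> ?w y" if "y \<in> nbrs G' x" for y using that w_ne by (simp add: nbrs_def)
      ultimately show ?thesis
        using moebius_equation[OF xI, of "\<lambda>\<epsilon>. of_real (q \<epsilon>)" ?z ?w, OF bal[OF xI] z_eq w0] by simp
    qed
    moreover have "?z \<in> extensional V" by (simp add: potential_def extensional_def)
    moreover have "\<forall>x\<in>B. ?z x = b x" using B_sub by (auto simp: potential_def)
    ultimately show "?z \<in> solutions V G B b q" unfolding solutions_def by blast
  qed
  show "flow q' ` solutions V G B b q \<subseteq> Fibre E q'"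
  proof (rule image_subsetI)
    fix z assume z: "z \<in> solutions V G B b q"
    let ?\<eta> = "flow q' z"
    let ?w = "\<lambda>x. ?\<eta> (Inl x)"
    have zB: "z y = b y" if "y \<in> B" for y using z that by (simp add: solutions_def)
    have z_ne: "z x \<noteq> z y" if "{x, y} \<in> G" for x y using z that by (simp add: solutions_def)
    have w: "?w y = inverse (z y - z o')" if "y \<in> V" for y
    proof (cases "y \<in> I")
      case True then show ?thesis by (simp add: flow_def zB[OF o_in])
    next
      case False
      then have "y \<in> B" using V_cases[OF that] by blast
      then show ?thesis using False by (simp add: flow_def zB[OF o_in] zB a_eq)
    qed
    have zo: "z y \<noteq> z o'" if "y \<in> V - {o'}" for y
    proof (cases "y \<in> B")
      case True then show ?thesis using that b_ne zB zB[OF o_in] by simp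
    next
      case False then show ?thesis using that I_eq star[of y] z_ne by blast
    qed
    have w_ne: "?w x \<noteq> ?w y" if "{x, y} \<in> G'" for x y
    proof -
      have "x \<in> V" "y \<in> V" "{x, y} \<in> G" using that G_sub[of "{x, y}"] by (auto simp: G'_def)
      then show ?thesis using w z_ne by auto
    qed
    have stretch: "stretch s t ?\<eta> e \<noteq> 0" if "e \<in> E" for e
      using w_ne[OF ends_G'[OF that]] by (simp add: stretch_def)
    have p: "?\<eta> (Inr e) = q' e / (?w (s e) - ?w (t e))" if "e \<in> E" for e
      using that by (simp add: flow_def Let_def)
    have "outflow E s t ?\<eta> x = 0" if x: "x \<in> I" for x
    proof -
      have xV: "x \<in> V - {o'}" using x I_eq o_notin by blast
      have "?w x \<noteq> ?w y" if "y \<in> nbrs G' x" for y using that w_ne by (simp add: nbrs_def)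
      moreover have "z y = z o' + inverse (?w y)" if "y \<in> V - {o'}" for y
        using that w[of y] by simp
      moreover have w0: "?w y \<noteq> 0" if "y \<in> V - {o'}" for y using that w[of y] zo[OF that] by simp
      ultimately have "- (?w x)\<^sup>2 * (\<Sum>y\<in>nbrs G' x. complex_of_real (q {x, y}) / (?w x - ?w y)) =
          (\<Sum>y\<in>nbrs G x. complex_of_real (q {x, y}) / (z x - z y))"
        using moebius_equation[OF x, of "\<lambda>\<epsilon>. of_real (q \<epsilon>)" z ?w, OF bal[OF x]] by simp
      also have "\<dots> = 0" using z x I_eq by (simp add: solutions_def)
      finally have "(\<Sum>y\<in>nbrs G' x. complex_of_real (q {x, y}) / (?w x - ?w y)) = 0"
        using w0[OF xV] by simp
      then show ?thesis
        using outflow_equation[of q' "\<lambda>\<epsilon>. of_real (q \<epsilon>)" ?\<eta> ?w x, OF q' p] by simp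
    qed
    moreover have "?\<eta> (Inr e) * stretch s t ?\<eta> e = q' e" if "e \<in> E" for e
      using p[OF that] stretch[OF that] by (simp add: stretch_def)
    moreover have "?\<eta> (Inl x) = a x" if "x \<notin> I" for x using that by (simp add: flow_def Let_def)
    moreover have "?\<eta> (Inr e) = 0" if "e \<notin> E" for e using that by (simp add: flow_def Let_def)
    ultimately show "?\<eta> \<in> Fibre E q'" using stretch by (simp add: fibre_def)
  qed
qed

text \<open>The edges at \<open>o'\<close> absorb any imbalance.\<close>

lemma balanced_extension:
  obtains q where "q \<in> balanced_weights V G B" "\<And>\<epsilon>. \<epsilon> \<in> G' \<Longrightarrow> q \<epsilon> = r \<epsilon>"
proof
  define q where "q = (\<lambda>\<epsilon>. if \<epsilon> \<in> G' then r \<epsilon> else if \<epsilon> \<in> G then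
    - (\<Sum>y\<in>nbrs G' (THE x. x \<in> I \<and> \<epsilon> = {x, o'}). r {THE x. x \<in> I \<and> \<epsilon> = {x, o'}, y}) else (0::real))"
  show "q \<epsilon> = r \<epsilon>" if "\<epsilon> \<in> G'" for \<epsilon> using that by (simp add: q_def)
  have "(\<Sum>y\<in>nbrs G x. q {x, y}) = 0" if x: "x \<in> I" for x
  proof -
    have the: "(THE x'. x' \<in> I \<and> {x, o'} = {x', o'}) = x"
      using x o_notin by (intro the_equality) (auto simp: doubleton_eq_iff)
    have "{x, o'} \<notin> G'" by (simp add: G'_def)
    then have "q {x, o'} = - (\<Sum>y\<in>nbrs G' x. r {x, y})"
      using star[OF x] by (simp add: q_def the)
    moreover have "(\<Sum>y\<in>nbrs G' x. q {x, y}) = (\<Sum>y\<in>nbrs G' x. r {x, y})"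
      by (rule sum.cong) (auto simp: q_def nbrs_def)
    ultimately show ?thesis using nbrs_G[OF x] finite_nbrs by simp
  qed
  moreover have "q \<epsilon> = 0" if "\<epsilon> \<notin> G" for \<epsilon> using that by (auto simp: q_def G'_def)
  ultimately show "q \<in> balanced_weights V G B" by (simp add: balanced_weights_def I_eq)
qed

text \<open>Fix generic weights \<open>p\<close> on the network. Real weights \<open>q\<close> on the graph are lifted by keeping \<open>p\<close> on all but one edge
  over each graph edge and adjusting the remaining one, so that the totals are \<open>q\<close>. The lift is
  affine and attains \<open>p\<close> itself, so it is generic for generic \<open>q\<close>. The values \<open>p\<close> may be complex.\<close>

theorem generic_number_of_count:
  assumes "generic_count I E s t a n"
  shows "generic_number V G B b n"
proof -
  obtain R where R: "R \<in> polyfuns E" "\<exists>y. R y \<noteq> 0"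
    "\<And>q. R q \<noteq> 0 \<Longrightarrow> finite (Fibre E q) \<and> card (Fibre E q) = n"
    using assms unfolding generic_count_def by blast
  \<comment> \<open>generically no potential vanishes, that is, no solution on the graph has a vertex at infinity\<close>
  let ?D = "\<lambda>\<xi> :: 'v + 'e \<Rightarrow> complex. \<Prod>x\<in>I. \<xi> (Inl x)"
  have "?D \<in> polyfuns params" by (intro polyfuns_prod polyfuns.coord) (auto simp: params_def)
  then obtain S where S: "S \<in> polyfuns E" "\<exists>y. S y \<noteq> 0"
    "\<And>q \<eta>. S q \<noteq> 0 \<Longrightarrow> \<eta> \<in> Fibre E q \<Longrightarrow> ?D \<eta> \<noteq> 0"
    using generic_fibre_avoids[of ?D "\<lambda>_. 1"] by auto
  obtain p where p: "R p \<noteq> 0" "S p \<noteq> 0" using polyfuns_mult_nonzero[OF R(1) S(1)] R(2) S(2) by blast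
  define rep where "rep = (\<lambda>\<epsilon>. SOME e. e \<in> E \<and> {s e, t e} = \<epsilon>)"
  have rep: "rep \<epsilon> \<in> E \<and> {s (rep \<epsilon>), t (rep \<epsilon>)} = \<epsilon>" if "\<epsilon> \<in> G'" for \<epsilon>
  proof -
    from G'_ends[OF that] have "\<exists>e. e \<in> E \<and> {s e, t e} = \<epsilon>" by (simp only: Bex_def)
    from someI_ex[OF this] show ?thesis by (simp only: rep_def)
  qed
  define \<sigma> where "\<sigma> = (\<lambda>(q :: 'v set \<Rightarrow> complex) e. if e = rep {s e, t e}
    then q {s e, t e} - (\<Sum>e'\<in>{e'\<in>E. {s e', t e'} = {s e, t e}} - {e}. p e') else p e)"
  have \<sigma>_sum: "(\<Sum>e\<in>{e\<in>E. {s e, t e} = \<epsilon>}. \<sigma> q e) = q \<epsilon>" if "\<epsilon> \<in> G'" for q \<epsilon>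
  proof -
    let ?A = "{e\<in>E. {s e, t e} = \<epsilon>}"
    have "(\<Sum>e\<in>?A. \<sigma> q e) = \<sigma> q (rep \<epsilon>) + (\<Sum>e\<in>?A - {rep \<epsilon>}. \<sigma> q e)"
      using rep[OF that] finite_E by (intro sum.remove) auto
    moreover have "(\<Sum>e\<in>?A - {rep \<epsilon>}. \<sigma> q e) = (\<Sum>e\<in>?A - {rep \<epsilon>}. p e)"
      by (rule sum.cong) (auto simp: \<sigma>_def)
    moreover have "\<sigma> q (rep \<epsilon>) = q \<epsilon> - (\<Sum>e\<in>?A - {rep \<epsilon>}. p e)"
      using rep[OF that] by (simp add: \<sigma>_def)
    ultimately show ?thesis by simp
  qed
  define T where "T = (\<lambda>q. R (\<sigma> q) * S (\<sigma> q))"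
  have \<sigma>_poly: "(\<lambda>q. \<sigma> q e) \<in> polyfuns G'" if "e \<in> E" for e
    using ends_G'[OF that] unfolding \<sigma>_def
    by (cases "e = rep {s e, t e}") (auto intro!: polyfuns_diff polyfuns.coord polyfuns.const)
  have T: "T \<in> polyfuns G'" unfolding T_def
    using polyfuns_compose[OF R(1), of "\<lambda>e q. \<sigma> q e" G', OF \<sigma>_poly]
      polyfuns_compose[OF S(1), of "\<lambda>e q. \<sigma> q e" G', OF \<sigma>_poly]
    by (intro polyfuns.mult)
  let ?q = "\<lambda>\<epsilon>. \<Sum>e\<in>{e\<in>E. {s e, t e} = \<epsilon>}. p e"
  have "\<sigma> ?q e = p e" if "e \<in> E" for e
    using that finite_E sum.remove[of "{e'\<in>E. {s e', t e'} = {s e, t e}}" e p] by (simp add: \<sigma>_def)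
  then have "T ?q \<noteq> 0"
    using p polyfuns_cong[OF R(1), of "\<sigma> ?q" p] polyfuns_cong[OF S(1), of "\<sigma> ?q" p]
    by (simp add: T_def)
  then obtain r :: "'v set \<Rightarrow> real" where r: "T (\<lambda>\<epsilon>. of_real (r \<epsilon>)) \<noteq> 0"
    using polyfuns_real_nonzero[OF T] by blast
  obtain q0 where q0: "q0 \<in> balanced_weights V G B" "\<And>\<epsilon>. \<epsilon> \<in> G' \<Longrightarrow> q0 \<epsilon> = r \<epsilon>"
    by (rule balanced_extension[of r]) blast
  show ?thesis unfolding generic_number_def
  proof (rule generically_of_complex)
    show "T \<in> polyfuns G" using T by (rule polyfuns_mono) (auto simp: G'_def)
    show "q0 \<in> balanced_weights V G B" by (rule q0)
    show "T (\<lambda>i. complex_of_real (q0 i)) \<noteq> 0"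
      using r polyfuns_cong[OF T, of "\<lambda>i. of_real (q0 i)" "\<lambda>i. of_real (r i)"] q0(2) by simp
    fix q assume q: "q \<in> balanced_weights V G B" and Tq: "T (\<lambda>i. complex_of_real (q i)) \<noteq> 0"
    let ?q' = "\<sigma> (\<lambda>i. of_real (q i))"
    have "R ?q' \<noteq> 0" "S ?q' \<noteq> 0" using Tq by (auto simp: T_def)
    moreover have "bij_betw potential (Fibre E ?q') (solutions V G B b q)"
      using S(3)[OF \<open>S ?q' \<noteq> 0\<close>] finite_I by (intro solutions_bij q \<sigma>_sum) auto
    ultimately show "finite (solutions V G B b q) \<and> card (solutions V G B b q) = n"
      using R(3) bij_betw_finite bij_betw_same_card by metis
  qed
qed

end

text \<open>Send a boundary vertex to infinity, orient every edge from an interior vertex, \<open>{u, v}\<close> from \<open>u\<close> to \<open>v\<close>,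
  and anchor each interior vertex at a second boundary vertex; this is where two boundary vertices are used.\<close>

theorem theorem4:
  fixes V B :: "'a set" and E :: "'a set set" and b :: "'a \<Rightarrow> complex" and u v :: 'a
  assumes "graph_with_boundary V E B"
    and "card B \<ge> 2"
    and "\<forall>x\<in>V - B. \<forall>y\<in>B. {x, y} \<in> E"
    and "inj_on b B"
    and "u \<in> V - B" and "v \<in> V - B" and "{u, v} \<in> E"
  shows "(\<exists>!n. generic_number V E B b n) \<and>
    (\<exists>!n. generic_number V (delete_edge E {u, v}) B b n) \<and>
    (\<exists>!n. generic_number (contract_vertices V u v) (contract_edges E u v) B b n) \<and>
    num_solutions V E B b =
      num_solutions V (delete_edge E {u, v}) B b +
      num_solutions (contract_vertices V u v) (contract_edges E u v) B b"
proof -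
  have fin: "finite V" and BV: "B \<subseteq> V" and EV: "\<And>e. e \<in> E \<Longrightarrow> e \<subseteq> V"
    and E2: "\<And>e. e \<in> E \<Longrightarrow> card e = 2" and Eint: "\<And>e. e \<in> E \<Longrightarrow> \<exists>x\<in>e. x \<notin> B"
    using assms(1) unfolding graph_with_boundary_def by auto
  have "\<not> is_singleton B" "B \<noteq> {}" using assms(2) by (auto simp: is_singleton_altdef)
  then obtain o' v1 where ov: "o' \<in> B" "v1 \<in> B" "v1 \<noteq> o'"
    by (metis all_not_in_conv is_singletonI')
  define I where "I = V - B"
  define E' where "E' = {e \<in> E. o' \<notin> e}"
  define s where "s = (\<lambda>e. if e = {u, v} then u else SOME x. x \<in> e \<and> x \<in> I)"
  define t where "t = (\<lambda>e. SOME y. e = {s e, y})"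
  define a where "a = (\<lambda>y. inverse (b y - b o'))"
  define h where "h = (\<lambda>x. {x, v1})"
  have uv: "u \<in> I" "v \<in> I" "u \<noteq> v"
    using assms(5,6) E2[OF assms(7)] by (auto simp: I_def)
  have s: "s e \<in> e \<and> s e \<in> I" if "e \<in> E" for e
  proof (cases "e = {u, v}")
    case False
    have "\<exists>x. x \<in> e \<and> x \<in> I" using Eint[OF that] EV[OF that] by (auto simp: I_def)
    from someI_ex[OF this] False show ?thesis by (simp add: s_def)
  qed (use uv in \<open>simp add: s_def\<close>)
  have st: "e = {s e, t e}" if e: "e \<in> E" for e
  proof -
    obtain x y where "e = {x, y}" using E2[OF e] by (auto simp: card_2_iff)
    then have "\<exists>y. e = {s e, y}" using s[OF e] by auto
    then show ?thesis unfolding t_def by (rule someI_ex)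
  qed
  have st_ne: "s e \<noteq> t e" if "e \<in> E" for e
  proof
    assume "s e = t e"
    then have "e = {s e}" using st[OF that] by simp
    then have "card e = 1" by (metis card.empty card.insert finite.emptyI empty_iff One_nat_def)
    then show False using E2[OF that] by simp
  qed
  have h: "h x \<in> E'" "s (h x) = x" "t (h x) = v1" if "x \<in> I" for x
  proof -
    have hE: "h x \<in> E" using assms(3) that ov by (simp add: h_def I_def)
    then show "h x \<in> E'" using that ov by (auto simp: E'_def h_def I_def)
    show "s (h x) = x" using s[OF hE] ov by (auto simp: h_def I_def)
    then show "t (h x) = v1" using st[OF hE] by (auto simp: h_def doubleton_eq_iff)
  qed
  have ov_I: "o' \<notin> I" "v1 \<notin> I" using ov by (auto simp: I_def)
  have finE: "finite E'"
    using fin EV by (intro finite_subset[of E' "Pow V"]) (auto simp: E'_def)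
  have suv: "s {u, v} = u" by (simp add: s_def)
  then have tuv: "t {u, v} = v" using st[OF assms(7)] by (auto simp: doubleton_eq_iff)
  have uvE': "{u, v} \<in> E'" using assms(7) uv ov_I by (auto simp: E'_def)
  interpret N: contractible_network I E' s t a h "{u, v}" u v
  proof
    show "finite I" using fin by (simp add: I_def)
    show "finite E'" by (rule finE)
    show "s e \<in> I" "s e \<noteq> t e" if "e \<in> E'" for e using s st_ne that by (auto simp: E'_def)
    show "h x \<in> E'" "s (h x) = x" "t (h x) \<notin> I" if "x \<in> I" for x using h[OF that] ov_I by auto
    show "{s e, t e} \<noteq> {u, v}" if "e \<in> E'" "e \<noteq> {u, v}" for e
      using that st[of e] by (simp add: E'_def)
  qed (use uvE' suv tuv uv in auto)
  have b_ne: "b y \<noteq> b o'" if "y \<in> B" "y \<noteq> o'" for y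
    using assms(4) that ov(1) by (auto dest: inj_onD)
  have at_o: "\<exists>x\<in>I. e = {x, o'}" if "e \<in> E" "o' \<in> e" for e
  proof -
    have "s e \<in> I" using s[OF that(1)] by blast
    moreover have "o' \<in> {s e, t e}" by (subst st[OF that(1), symmetric]) (rule that(2))
    ultimately have "t e = o'" using ov_I by auto
    with st[OF that(1)] have "e = {s e, o'}" by simp
    with \<open>s e \<in> I\<close> show ?thesis by blast
  qed
  have ends: "(\<lambda>e. {s e, t e}) ` A = A" if "A \<subseteq> E" for A
  proof -
    have "(\<lambda>e. {s e, t e}) ` A = (\<lambda>e. e) ` A"
    proof (rule image_cong[OF refl])
      fix e assume "e \<in> A"
      with that show "{s e, t e} = e" by (intro st[symmetric]) blast
    qed
    then show ?thesis by simp
  qed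
  interpret GN: graph_network I E' s t a h V B E b o'
  proof
    show "(\<lambda>e. {s e, t e}) ` E' = {e \<in> E. o' \<notin> e}"
      using ends[of E'] by (simp add: E'_def)
  qed (use BV EV ov b_ne at_o assms(3) in \<open>auto simp: I_def a_def\<close>)
  interpret GD: graph_network I "E' - {{u, v}}" s t a h V B "delete_edge E {u, v}" b o'
  proof
    have "E' - {{u, v}} \<subseteq> E" unfolding E'_def by blast
    moreover have "E' - {{u, v}} = {e \<in> delete_edge E {u, v}. o' \<notin> e}"
      unfolding delete_edge_def E'_def by blast
    ultimately show "(\<lambda>e. {s e, t e}) ` (E' - {{u, v}}) = {e \<in> delete_edge E {u, v}. o' \<notin> e}"
      by (simp only: ends)
    show "{x, o'} \<in> delete_edge E {u, v}" if "x \<in> I" for x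
      using that assms(3) ov uv ov_I by (auto simp: delete_edge_def I_def doubleton_eq_iff)
  qed (use BV EV ov b_ne at_o in \<open>auto simp: I_def a_def delete_edge_def\<close>)
  have \<rho>: "id(v := u) = N.\<rho>" by (auto simp: N.\<rho>_def fun_eq_iff)
  have \<rho>_id: "N.\<rho> x = x" if "x \<noteq> v" for x using that by (simp add: N.\<rho>_def)
  have V2: "contract_vertices V u v = V - {v}"
    using uv by (auto simp: contract_vertices_def I_def)
  have o_\<rho>: "o' \<in> N.\<rho> ` e \<longleftrightarrow> o' \<in> e" for e
    using uv ov_I by (auto simp: N.\<rho>_def image_iff)
  interpret GC: graph_network "I - {v}" "E' - {{u, v}}" N.s2 N.t2 a h
    "contract_vertices V u v" B "contract_edges E u v" b o'
  proof
    show "(\<lambda>e. {N.s2 e, N.t2 e}) ` (E' - {{u, v}}) = {e \<in> contract_edges E u v. o' \<notin> e}"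
    proof -
      have "{N.s2 e, N.t2 e} = N.\<rho> ` e" if "e \<in> E" for e
        using arg_cong[OF st[OF that], of "(`) N.\<rho>"] by simp
      then have "(\<lambda>e. {N.s2 e, N.t2 e}) ` (E' - {{u, v}}) = (`) N.\<rho> ` (E' - {{u, v}})"
        by (intro image_cong) (auto simp: E'_def)
      moreover have "E' - {{u, v}} = {e \<in> E - {{u, v}}. o' \<notin> e}" unfolding E'_def by blast
      ultimately have "(\<lambda>e. {N.s2 e, N.t2 e}) ` (E' - {{u, v}}) =
          (`) N.\<rho> ` {e \<in> E - {{u, v}}. o' \<notin> e}" by (simp only:)
      also have "\<dots> = {e \<in> contract_edges E u v. o' \<notin> e}"
        by (simp only: contract_edges_def \<rho> Compr_image_eq o_\<rho>)
      finally show ?thesis .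
    qed
    show "e \<subseteq> contract_vertices V u v" if "e \<in> contract_edges E u v" for e
      using that EV unfolding contract_edges_def contract_vertices_def by blast
    show "\<exists>x\<in>I - {v}. e = {x, o'}" if e: "e \<in> contract_edges E u v" "o' \<in> e" for e
    proof -
      obtain e' where e': "e' \<in> E" "e = N.\<rho> ` e'" using e(1) unfolding contract_edges_def \<rho> by blast
      then obtain x where x: "x \<in> I" "e' = {x, o'}" using at_o[of e'] e(2) o_\<rho> by auto
      have "N.\<rho> x \<in> I - {v}" using x uv by (auto simp: N.\<rho>_def)
      moreover have "N.\<rho> o' = o'" using uv ov_I by (intro \<rho>_id) auto
      ultimately show ?thesis using e'(2) x(2) by auto
    qed
    show "{x, o'} \<in> contract_edges E u v" if "x \<in> I - {v}" for x
    proof -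
      have "{x, o'} \<in> E - {{u, v}}" using that assms(3) ov uv ov_I by (auto simp: I_def doubleton_eq_iff)
      moreover have "o' \<noteq> v" "x \<noteq> v" using that uv ov_I by auto
      then have "N.\<rho> ` {x, o'} = {x, o'}" by (simp add: \<rho>_id)
      ultimately show ?thesis unfolding contract_edges_def \<rho> by (metis image_eqI)
    qed
  qed (use BV ov b_ne uv in \<open>auto simp: V2 I_def a_def\<close>)
  obtain n where n: "generic_count I E' s t a n" using N.generic_count_exists by blast
  obtain n1 where n1: "generic_count I (E' - {{u, v}}) s t a n1"
    using N.deleted.generic_count_exists by blast
  obtain n2 where n2: "generic_count (I - {v}) (E' - {{u, v}}) N.s2 N.t2 a n2"
    using N.contracted.generic_count_exists by blast
  have sum: "n = n1 + n2" by (rule N.generic_count_deletion_contraction[OF n n1 n2])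
  note g = GN.generic_number_of_count[OF n] GD.generic_number_of_count[OF n1]
    GC.generic_number_of_count[OF n2]
  have unique: "\<exists>!m. generic_number V' F B b m" "num_solutions V' F B b = m"
    if "generic_number V' F B b m" for V' F m
    using that generic_number_unique unfolding num_solutions_def by blast+
  show ?thesis
    using unique(1)[OF g(1)] unique(1)[OF g(2)] unique(1)[OF g(3)]
    by (simp add: unique(2)[OF g(1)] unique(2)[OF g(2)] unique(2)[OF g(3)] sum)
qed

end
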